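(* Let $f_0$ be a probability density on $\mathbb{R}^3$, let $f(t)$ be the solution of the homogeneous Boltzmann equation with initial datum $f_0$, and, for each $\mu>0$, let $\{f^\mu_j(t)\}_{j\ge 1}$ be the rescaled correlation functions at time $t$ of the grand canonical Kac model with parameter $\mu$ (all defined in the context). Assume that $f^\mu_j(0)=f_0^{\otimes j}$ for all $j\ge 1$ and all $\mu>0$. Then for every $t>0$ there exist $G>1$ and $\delta>0$ (depending on $t$ but not on $j$ or $\mu$) such that, for all integers $j\geq 1$ and all $\mu>0$ with $\frac{j}{\sqrt{\mu}}\le\delta$, $$\| f^\mu_j(t) - f(t)^{\otimes j} \|_{L^1(\mathbb{R}^{3j})} \leq \frac{G\,j^2}{\mu}.$$
   Context: Velocities are in $\mathbb{R}^3$, and $V_n=(v_1,\dots,v_n)\in\mathbb{R}^{3n}$. For a unit vector $\omega\in S^2$, the collision of $v_i,v_j$ gives the outgoing velocities $v_i'=v_i-[\omega\cdot(v_i-v_j)]\omega$ and $v_j'=v_j+[\omega\cdot(v_i-v_j)]\omega$. The kernel $B(\omega;v)\ge 0$ is measurable and bounded, $B(\omega;v)/|v|$ is the differential cross-section of the two-body process, and $B(\omega;v)$ depends only on $|v|$ and $|\omega\cdot v|$. Operators. For a function $W$ on $\mathbb{R}^{3n}$ and $1\le i<k\le n$, $$T_{i,k}W(V_n)=\int_{S^2} d\omega\, B(\omega;v_i-v_k)\{W(V_n^{i,k})-W(V_n)\},\qquad T_nW=\sum_{1\le i<k\le n}T_{i,k}W,$$ where $V_n^{i,k}$ is obtained from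 $V_n$ by replacing $v_i,v_k$ by $v_i',v_k'$. Grand canonical Kac model. Fix $\mu>0$. A state is a sequence $\{W^n\}_{n\ge0}$ of nonnegative functions, $W^n$ symmetric on $\mathbb{R}^{3n}$, such that $\frac1{n!}W^n(V_n)$ is the probability density that there are exactly $n$ particles and their velocities are $V_n$ (so $\sum_n\frac1{n!}\int W^n\,dV_n=1$), with average particle number $\mu=\sum_n n\int\frac{1}{n!}W^n\,dV_n$. The time-evolved state solves $\partial_tW^n=\frac1\mu T_nW^n$ for every $n$. The rescaled correlation functions are $$f^\mu_j(V_j,t)=\mu^{-j}\sum_{k\ge0}\frac1{k!}\int dv_{j+1}\cdots dv_{j+k}\,W^{j+k}(V_{j+k},t).$$ The initial state $W^n(0)=e^{-\mu}\mu^n f_0^{\otimes n}$, $n\ge0$, gives $f_j^\mu(0)=f_0^{\otimes j}$ for all $j$. The correlation functions satisfy, for all $j\ge1$, $$\partial_tf_j^\mu=\frac{T_j}{\mu}f_j^\mu+C_{j+1}f^\mu_{j+1},\qquad C_{j+1}f^\mu_{j+1}(V_j)=\sum_{i=1}^j\int dv_{j+1}\int_{S^2} d\omega\,B(\omega;v_i-v_{j+1})\{f^\mu_{j+1}(V_{j+1}^{i,j+1})-f^\mu_{j+1}(V_{j+1})\}.$$ Homogeneous Boltzmann equation: $$\partial_tf(v)=\int_{\mathbb{R}^3}dv_1\int_{S^2}d\omega\,B(\omega;v-v_1)\{f(v')f(v_1')-f(v)f(v_1)\},\qquad f(0)=f_0,$$ where $v',v_1'$ are the outgoing velocities of the pair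 $v,v_1$. Here $f^{\otimes j}(V_j)=f(v_1)\cdots f(v_j)$. *)

theory Defs
  imports "HOL-Analysis.Analysis"
begin

type_synonym velocity = "real ^ 3"

(* A configuration V_n = (v_1, ..., v_n) is a function in the extensional space of
   Pi_M {..<n}; particles are numbered 0, ..., n - 1. *)
type_synonym configuration = "nat \<Rightarrow> velocity"

abbreviation velocities :: "nat \<Rightarrow> configuration measure" where
  "velocities n \<equiv> Pi\<^sub>M {..<n} (\<lambda>_. lborel)"

(* Surface measure d\<omega> on S^2, in the normalisation of polar coordinates
   dx = r^2 dr d\<omega>: the surface of A is 3 times the volume of the cone
   {r *\<^sub>R \<omega> | 0 < r < 1, \<omega> \<in> A}. *)
definition sphere_measure :: "velocity measure" where
  "sphere_measure =
     scale_measure 3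
       (distr (restrict_space lborel (ball 0 1 - {0}))
              (restrict_space borel (sphere 0 1))
              (\<lambda>x. x /\<^sub>R norm x))"

lemma emeasure_sphere_measure_total: "emeasure sphere_measure (sphere 0 1) = ennreal (4 * pi)"
proof -
  let ?D = "ball (0::velocity) 1 - {0}"
  have D: "?D \<in> sets lborel" by simp
  have m: "(\<lambda>x::velocity. x /\<^sub>R norm x)
             \<in> restrict_space lborel ?D \<rightarrow>\<^sub>M restrict_space borel (sphere 0 1)"
    by (intro measurable_restrict_space3) auto
  have s: "sphere (0::velocity) 1 \<in> sets (restrict_space borel (sphere 0 1))"
    by (simp add: sets_restrict_space_iff)
  have p: "(\<lambda>x::velocity. x /\<^sub>R norm x) -` sphere 0 1 \<inter> space (restrict_space lborel ?D) = ?D"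
    by (auto simp: space_restrict_space)
  have "emeasure lborel ?D = emeasure lborel (ball (0::velocity) 1)"
    by (intro emeasure_Diff_null_set) auto
  also have "\<dots> = ennreal (4 / 3 * pi)"
    by (simp add: emeasure_ball unit_ball_vol_3)
  finally have e: "emeasure lborel ?D = ennreal (4 / 3 * pi)" .
  have "emeasure sphere_measure (sphere 0 1) = 3 * emeasure lborel ?D"
    unfolding sphere_measure_def emeasure_scale_measure
    by (subst emeasure_distr[OF m s]) (simp only: p, subst emeasure_restrict_space, use D in auto)
  also have "\<dots> = ennreal (3 * (4 / 3 * pi))"
    unfolding e by (subst ennreal_mult) auto
  finally show ?thesis by simp
qed

definition collision_kernel :: "(velocity \<Rightarrow> velocity \<Rightarrow> real) \<Rightarrow> bool" where
  "collision_kernel B \<longleftrightarrow>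
     (\<lambda>(\<omega>, v). B \<omega> v) \<in> borel_measurable (restrict_space borel (sphere 0 1) \<Otimes>\<^sub>M borel) \<and>
     (\<forall>\<omega>\<in>sphere 0 1. \<forall>v. 0 \<le> B \<omega> v) \<and>
     (\<exists>C. \<forall>\<omega>\<in>sphere 0 1. \<forall>v. B \<omega> v \<le> C) \<and>
     (\<forall>\<omega>\<in>sphere 0 1. \<forall>\<omega>'\<in>sphere 0 1. \<forall>v v'.
        norm v = norm v' \<longrightarrow> \<bar>\<omega> \<bullet> v\<bar> = \<bar>\<omega>' \<bullet> v'\<bar> \<longrightarrow> B \<omega> v = B \<omega>' v')"

definition outgoing1 :: "velocity \<Rightarrow> velocity \<Rightarrow> velocity \<Rightarrow> velocity" where
  "outgoing1 \<omega> v w = v - (\<omega> \<bullet> (v - w)) *\<^sub>R \<omega>"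

definition outgoing2 :: "velocity \<Rightarrow> velocity \<Rightarrow> velocity \<Rightarrow> velocity" where
  "outgoing2 \<omega> v w = w + (\<omega> \<bullet> (v - w)) *\<^sub>R \<omega>"

definition collide :: "velocity \<Rightarrow> nat \<Rightarrow> nat \<Rightarrow> configuration \<Rightarrow> configuration" where
  "collide \<omega> i k V = V(i := outgoing1 \<omega> (V i) (V k), k := outgoing2 \<omega> (V i) (V k))"

definition T_pair ::
  "(velocity \<Rightarrow> velocity \<Rightarrow> real) \<Rightarrow> nat \<Rightarrow> nat \<Rightarrow> (configuration \<Rightarrow> real) \<Rightarrow> configuration \<Rightarrow> real" where
  "T_pair B i k W V =
     (LINT \<omega>|sphere_measure. B \<omega> (V i - V k) * (W (collide \<omega> i k V) - W V))"

definition T_op ::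
  "(velocity \<Rightarrow> velocity \<Rightarrow> real) \<Rightarrow> nat \<Rightarrow> (configuration \<Rightarrow> real) \<Rightarrow> configuration \<Rightarrow> real" where
  "T_op B n W V = (\<Sum>k<n. \<Sum>i<k. T_pair B i k W V)"

(* Strong derivative in L^1(M): the difference quotients of u at t converge to D in the
   L^1 norm; at t = 0 the derivative is one-sided. *)
definition has_L1_derivative ::
  "'a measure \<Rightarrow> (real \<Rightarrow> 'a \<Rightarrow> real) \<Rightarrow> ('a \<Rightarrow> real) \<Rightarrow> real \<Rightarrow> bool" where
  "has_L1_derivative M u D t \<longleftrightarrow>
     ((\<lambda>s. \<integral>\<^sup>+x. ennreal \<bar>(u s x - u t x) / (s - t) - D x\<bar> \<partial>M) \<longlongrightarrow> 0) (at t within {0..})"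

definition grand_canonical_state :: "real \<Rightarrow> (nat \<Rightarrow> configuration \<Rightarrow> real) \<Rightarrow> bool" where
  "grand_canonical_state \<mu> W \<longleftrightarrow>
     (\<forall>n. integrable (velocities n) (W n) \<and>
          (AE V in velocities n. 0 \<le> W n V) \<and>
          (\<forall>\<pi>. \<pi> permutes {..<n} \<longrightarrow> (AE V in velocities n. W n (V \<circ> \<pi>) = W n V))) \<and>
     (\<lambda>n. (1 / fact n) * (LINT V|velocities n. W n V)) sums 1 \<and>
     (\<lambda>n. real n * ((1 / fact n) * (LINT V|velocities n. W n V))) sums \<mu>"

(* W t n is the function W^n at time t. *)
definition kac_evolution ::
  "(velocity \<Rightarrow> velocity \<Rightarrow> real) \<Rightarrow> real \<Rightarrow> (real \<Rightarrow> nat \<Rightarrow> configuration \<Rightarrow> real) \<Rightarrow> bool" where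
  "kac_evolution B \<mu> W \<longleftrightarrow>
     (\<forall>t\<ge>0. grand_canonical_state \<mu> (W t)) \<and>
     (\<forall>t\<ge>0. \<forall>n. has_L1_derivative (velocities n) (\<lambda>s. W s n)
                   (\<lambda>V. (1 / \<mu>) * T_op B n (W t n) V) t)"

(* Rescaled correlation function f^\<mu>_j of the state W.  All terms are nonnegative, so the
   series of integrals is taken in [0, \<infinity>] and needs no convergence hypothesis. *)
definition correlation ::
  "real \<Rightarrow> (nat \<Rightarrow> configuration \<Rightarrow> real) \<Rightarrow> nat \<Rightarrow> configuration \<Rightarrow> ennreal" where
  "correlation \<mu> W j V =
     ennreal (1 / \<mu> ^ j) *
     (\<Sum>k. ennreal (1 / fact k) *
        (\<integral>\<^sup>+U. ennreal (W (j + k) (merge {..<j} {j..<j + k} (V, U)))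
           \<partial>Pi\<^sub>M {j..<j + k} (\<lambda>_. lborel)))"

definition tensor_power :: "nat \<Rightarrow> (velocity \<Rightarrow> real) \<Rightarrow> configuration \<Rightarrow> real" where
  "tensor_power j f V = (\<Prod>i<j. f (V i))"

definition probability_density :: "(velocity \<Rightarrow> real) \<Rightarrow> bool" where
  "probability_density f \<longleftrightarrow>
     f \<in> borel_measurable borel \<and> (\<forall>v. 0 \<le> f v) \<and> (\<integral>\<^sup>+v. ennreal (f v) \<partial>lborel) = 1"

definition boltzmann_operator ::
  "(velocity \<Rightarrow> velocity \<Rightarrow> real) \<Rightarrow> (velocity \<Rightarrow> real) \<Rightarrow> velocity \<Rightarrow> real" where
  "boltzmann_operator B f v =
     (LINT w|lborel. LINT \<omega>|sphere_measure.
        B \<omega> (v - w) * (f (outgoing1 \<omega> v w) * f (outgoing2 \<omega> v w) - f v * f w))"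

definition boltzmann_solution ::
  "(velocity \<Rightarrow> velocity \<Rightarrow> real) \<Rightarrow> (velocity \<Rightarrow> real) \<Rightarrow> (real \<Rightarrow> velocity \<Rightarrow> real) \<Rightarrow> bool" where
  "boltzmann_solution B f0 f \<longleftrightarrow>
     (AE v in lborel. f 0 v = f0 v) \<and>
     (\<forall>t\<ge>0. integrable lborel (f t)) \<and>
     (\<forall>t\<ge>0. has_L1_derivative lborel f (boltzmann_operator B (f t)) t)"

(* Stated for extended real functions, so that the distance of a correlation function to a
   real function is infinite unless the correlation function is finite almost everywhere. *)
definition L1_norm :: "'a measure \<Rightarrow> ('a \<Rightarrow> ereal) \<Rightarrow> ennreal" where
  "L1_norm M g = (\<integral>\<^sup>+x. e2ennreal \<bar>g x\<bar> \<partial>M)"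

end

theory Submission
  imports Defs
begin

text \<open>Conditioned on the particle number \<open>n\<close>, the state is an exchangeable \<open>n\<close>-particle density, and the
  initial correlation functions force the law of \<open>n\<close> to be Poisson with mean \<open>\<mu>\<close> and the initial densities
  to be \<open>f0\<close>-chaotic.  Everything is tested against bounded functions of the first \<open>j\<close> velocities.  By
  self-adjointness of the collision operator, the tested \<open>j\<close>-particle marginals satisfy a hierarchy that
  differs from the one of \<open>f(\<alpha> t)\<close> tensorised, \<open>\<alpha> = n / \<mu>\<close>, by a source of size \<open>j\<^sup>2 / \<mu>\<close>.  Adding fictitious
  collisions makes the total rate constant; the resulting damping balances the factor \<open>j\<close> in the gain term, so
  that downward induction on \<open>j\<close> gives an error \<open>O(j\<^sup>2 / \<mu>)\<close> for all times, without loss of constants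
  exponential in \<open>j\<close>.  Averaging over the Poisson law of \<open>n\<close> and expanding to second order in \<open>\<alpha> - 1\<close>, whose
  Poisson moments are of order \<open>j / \<mu>\<close> and \<open>1 / \<mu>\<close>, gives the theorem with \<open>\<delta> = 1\<close>.\<close>

text \<open>Iterating the correlation hierarchy directly produces products j (j + 1) (j + 2) ... of
  gain factors, which limits a series expansion to short times. For fixed n the hierarchy ends at
  level n, where the trivial bound 2 on a difference of normalised observables is bounded by a
  multiple of n (n + 1) / \<mu> once n is comparable to \<mu>. The weight j (j + 1) / \<mu> is
  chosen because one gain step turns it into (j + 2) times itself: the part j is paid for by the
  damping, and only the constant 2 is left for an exponential in time. Fixing n makes the clock run
  at speed n / \<mu>. This random speed fluctuates by 1 / sqrt \<mu>, too much for an estimate in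
  absolute value; hence the linear term of the expansion is averaged with its sign. In the
  correlation of order j the number k of further particles is Poisson and n = j + k, so the mean of
  n / \<mu> - 1 is j / \<mu> rather than 0. As the coefficient of the linear term is of order j,
  this yields j^2 / \<mu>, the same size as the collisions among the j particles.\<close>

interpretation velocity_product: product_sigma_finite "\<lambda>_::nat. lborel :: velocity measure"
  by standard

lemma sigma_finite_velocities: "finite I \<Longrightarrow> sigma_finite_measure (Pi\<^sub>M I (\<lambda>_::nat. lborel :: velocity measure))"
  by (rule velocity_product.sigma_finite)

section \<open>The surface measure and the invariance of Lebesgue measure under collisions\<close>

lemma sets_sphere_measure [measurable_cong]:
  "sets sphere_measure = sets (restrict_space borel (sphere 0 1))"
  by (simp add: sphere_measure_def)

lemma space_sphere_measure [simp]: "space sphere_measure = sphere 0 1"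
  using sets_eq_imp_space_eq[OF sets_sphere_measure] by (simp add: space_restrict_space)

interpretation sphere_measure: finite_measure sphere_measure
  by standard (simp add: emeasure_sphere_measure_total)

lemma measure_sphere_measure: "measure sphere_measure (sphere 0 1) = 4 * pi"
  by (simp add: measure_def emeasure_sphere_measure_total)

text \<open>Lebesgue measure is determined by its values on boxes, and the preimage of a box is its
  image under the inverse of \<open>R\<close>, again orthogonal. The invariance of volume is taken
  from \<open>lebesgue\<close>, with which \<open>lborel\<close> agrees on Borel sets.\<close>

lemma lborel_distr_orthogonal:
  fixes R :: "velocity \<Rightarrow> velocity"
  assumes R: "orthogonal_transformation R"
  shows "distr lborel borel R = lborel"
proof (rule sym, rule lborel_eqI)
  have [measurable]: "R \<in> borel_measurable borel"
    using R by (intro borel_measurable_continuous_onI linear_continuous_on)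
      (simp add: orthogonal_transformation_linear linear_conv_bounded_linear[symmetric])
  fix l u :: "velocity"
  assume lu: "\<And>b. b \<in> Basis \<Longrightarrow> l \<bullet> b \<le> u \<bullet> b"
  have bij: "bij R" using R by (rule orthogonal_transformation_bij)
  have inv: "orthogonal_transformation (inv R)" using R by (rule orthogonal_transformation_inv)
  have vi: "R -` box l u = inv R ` box l u" using bij by (simp add: bij_vimage_eq_inv_image)
  have b: "R -` box l u \<in> sets borel"
    using measurable_sets[of R borel borel "box l u"] by simp
  have m: "box l u \<in> lmeasurable" by simp
  have "emeasure (distr lborel borel R) (box l u) = emeasure lborel (R -` box l u)"
    by (subst emeasure_distr) auto
  also have "\<dots> = emeasure lebesgue (inv R ` box l u)"
    using b by (simp add: vi)
  also have "\<dots> = ennreal (measure lebesgue (inv R ` box l u))"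
    using measurable_orthogonal_image[OF inv m] by (simp add: emeasure_eq_measure2)
  also have "\<dots> = ennreal (measure lebesgue (box l u))"
    by (simp add: measure_orthogonal_image[OF inv m])
  also have "\<dots> = emeasure lborel (box l u)"
    using m by (simp add: emeasure_eq_measure2)
  also have "\<dots> = (\<Prod>b\<in>Basis. (u - l) \<bullet> b)"
    using lu by (simp add: emeasure_lborel_box_eq)
  finally show "emeasure (distr lborel borel R) (box l u) = (\<Prod>b\<in>Basis. (u - l) \<bullet> b)" .
qed simp

lemma nn_integral_lborel_orthogonal:
  fixes R :: "velocity \<Rightarrow> velocity"
  assumes "orthogonal_transformation R" and [measurable]: "h \<in> borel_measurable borel"
  shows "(\<integral>\<^sup>+x. h (R x) \<partial>lborel) = (\<integral>\<^sup>+x. h x \<partial>lborel)"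
proof -
  have [measurable]: "R \<in> borel_measurable borel"
    using assms(1) by (intro borel_measurable_continuous_onI linear_continuous_on)
      (simp add: orthogonal_transformation_linear linear_conv_bounded_linear[symmetric])
  show ?thesis
    by (subst (2) lborel_distr_orthogonal[OF assms(1), symmetric], subst nn_integral_distr) auto
qed

lemma nn_integral_lborel_translate:
  fixes c :: "'a :: euclidean_space"
  assumes [measurable]: "h \<in> borel_measurable borel"
  shows "(\<integral>\<^sup>+x. h (c + x) \<partial>lborel) = (\<integral>\<^sup>+x. h x \<partial>lborel)"
  by (subst (2) lborel_distr_plus[symmetric, of c], subst nn_integral_distr) auto

lemma nn_integral_lborel_reflect:
  fixes c :: velocity
  assumes [measurable]: "h \<in> borel_measurable borel"
  shows "(\<integral>\<^sup>+x. h (c - x) \<partial>lborel) = (\<integral>\<^sup>+x. h x \<partial>lborel)"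
proof -
  have o: "orthogonal_transformation (uminus :: velocity \<Rightarrow> velocity)"
    using orthogonal_transformation_neg[of "\<lambda>x. x"] by simp
  have "(\<integral>\<^sup>+x. h (c - x) \<partial>lborel) = (\<integral>\<^sup>+x. h (c + (- x)) \<partial>lborel)" by simp
  also have "\<dots> = (\<integral>\<^sup>+x. h (c + x) \<partial>lborel)"
    by (rule nn_integral_lborel_orthogonal[OF o]) simp
  finally show ?thesis by (simp add: nn_integral_lborel_translate)
qed

lemma outgoing_measurable [measurable]:
  assumes [measurable]: "f \<in> borel_measurable M" "g \<in> borel_measurable M" "h \<in> borel_measurable M"
  shows "(\<lambda>x. outgoing1 (f x) (g x) (h x)) \<in> borel_measurable M"
    and "(\<lambda>x. outgoing2 (f x) (g x) (h x)) \<in> borel_measurable M"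
  unfolding outgoing1_def outgoing2_def by measurable

text \<open>This reflection is the action of a collision on the relative velocity. Its orthogonality
  gives both the invariance of Lebesgue measure and that of the kernel.\<close>

lemma orthogonal_reflection:
  fixes \<omega> :: velocity
  assumes "norm \<omega> = 1"
  shows "orthogonal_transformation (\<lambda>u. u - (2 * (\<omega> \<bullet> u)) *\<^sub>R \<omega>)"
  unfolding orthogonal_transformation_def
proof (intro conjI allI)
  show "linear (\<lambda>u. u - (2 * (\<omega> \<bullet> u)) *\<^sub>R \<omega>)"
    by (rule linearI) (auto simp: algebra_simps inner_add_right scaleR_add_left)
  have w: "\<omega> \<bullet> \<omega> = 1" using assms by (simp add: dot_square_norm)
  show "(v - (2 * (\<omega> \<bullet> v)) *\<^sub>R \<omega>) \<bullet> (w - (2 * (\<omega> \<bullet> w)) *\<^sub>R \<omega>) = v \<bullet> w" for v w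
    by (simp add: inner_diff_left inner_diff_right w inner_commute algebra_simps)
qed

text \<open>In the coordinates \<open>(v, u)\<close> with \<open>u = v - w\<close> the collision is a translation of \<open>v\<close> by a
  function of \<open>u\<close>, followed by a reflection of \<open>u\<close>.\<close>

lemma nn_integral_outgoing:
  fixes h :: "velocity \<times> velocity \<Rightarrow> ennreal"
  assumes \<omega>: "norm \<omega> = 1" and [measurable]: "h \<in> borel_measurable (borel \<Otimes>\<^sub>M borel)"
  shows "(\<integral>\<^sup>+v. \<integral>\<^sup>+w. h (outgoing1 \<omega> v w, outgoing2 \<omega> v w) \<partial>lborel \<partial>lborel)
       = (\<integral>\<^sup>+v. \<integral>\<^sup>+w. h (v, w) \<partial>lborel \<partial>lborel)"
proof -
  define R where "R u = u - (2 * (\<omega> \<bullet> u)) *\<^sub>R \<omega>" for u :: velocity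
  have R: "orthogonal_transformation R"
    using orthogonal_reflection[OF \<omega>] by (simp add: R_def[abs_def])
  have [measurable]: "R \<in> borel_measurable borel" unfolding R_def by measurable
  have 1: "(\<integral>\<^sup>+w. h (outgoing1 \<omega> v w, outgoing2 \<omega> v w) \<partial>lborel)
      = (\<integral>\<^sup>+u. h (v - (\<omega> \<bullet> u) *\<^sub>R \<omega>, v - u + (\<omega> \<bullet> u) *\<^sub>R \<omega>) \<partial>lborel)" for v
    by (subst nn_integral_lborel_reflect[of _ v, symmetric]) (simp_all add: outgoing1_def outgoing2_def)
  have 2: "(\<integral>\<^sup>+v. h (v - (\<omega> \<bullet> u) *\<^sub>R \<omega>, v - u + (\<omega> \<bullet> u) *\<^sub>R \<omega>) \<partial>lborel)
      = (\<integral>\<^sup>+v. h (v, v - R u) \<partial>lborel)" for u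
    by (subst nn_integral_lborel_translate[of _ "(\<omega> \<bullet> u) *\<^sub>R \<omega>", symmetric])
      (simp_all add: R_def scaleR_add_left[symmetric] algebra_simps)
  have 3: "(\<integral>\<^sup>+u. h (v, v - R u) \<partial>lborel) = (\<integral>\<^sup>+w. h (v, w) \<partial>lborel)" for v
    by (subst nn_integral_lborel_orthogonal[OF R, of "\<lambda>u. h (v, v - u)"], measurable)
      (rule nn_integral_lborel_reflect[of "\<lambda>u. h (v, u)"], measurable)
  have "(\<integral>\<^sup>+v. \<integral>\<^sup>+w. h (outgoing1 \<omega> v w, outgoing2 \<omega> v w) \<partial>lborel \<partial>lborel)
      = (\<integral>\<^sup>+v. \<integral>\<^sup>+u. h (v - (\<omega> \<bullet> u) *\<^sub>R \<omega>, v - u + (\<omega> \<bullet> u) *\<^sub>R \<omega>) \<partial>lborel \<partial>lborel)"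
    by (simp add: 1)
  also have "\<dots> = (\<integral>\<^sup>+u. \<integral>\<^sup>+v. h (v - (\<omega> \<bullet> u) *\<^sub>R \<omega>, v - u + (\<omega> \<bullet> u) *\<^sub>R \<omega>) \<partial>lborel \<partial>lborel)"
    by (rule lborel_pair.Fubini'[symmetric]) measurable
  also have "\<dots> = (\<integral>\<^sup>+u. \<integral>\<^sup>+v. h (v, v - R u) \<partial>lborel \<partial>lborel)"
    by (simp add: 2)
  also have "\<dots> = (\<integral>\<^sup>+v. \<integral>\<^sup>+u. h (v, v - R u) \<partial>lborel \<partial>lborel)"
    by (rule lborel_pair.Fubini') measurable
  finally show ?thesis by (simp add: 3)
qed

text \<open>Configuration and \<omega> vary jointly because the collision integrals are treated by
  Fubini on the product with the sphere. The bounds on \<open>i\<close> and \<open>k\<close> keep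
  updated configurations in the extensional space underlying \<open>velocities n\<close>.\<close>

lemma collide_measurable [measurable]:
  assumes [measurable]: "f \<in> borel_measurable M" "g \<in> M \<rightarrow>\<^sub>M velocities n"
    and "i < n" "k < n"
  shows "(\<lambda>x. collide (f x) i k (g x)) \<in> M \<rightarrow>\<^sub>M velocities n"
proof (rule measurable_PiM_single')
  have [measurable]: "(\<lambda>x. g x i) \<in> borel_measurable M" "(\<lambda>x. g x k) \<in> borel_measurable M"
    using assms(3,4) measurable_compose[OF assms(2) measurable_component_singleton] by auto
  fix l assume l: "l \<in> {..<n}"
  then have [measurable]: "(\<lambda>x. g x l) \<in> borel_measurable M"
    using measurable_compose[OF assms(2) measurable_component_singleton] by auto
  have "(\<lambda>x. collide (f x) i k (g x) l) = (\<lambda>x. if l = k then outgoing2 (f x) (g x i) (g x k)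
      else if l = i then outgoing1 (f x) (g x i) (g x k) else g x l)"
    by (auto simp: collide_def)
  then show "(\<lambda>x. collide (f x) i k (g x) l) \<in> M \<rightarrow>\<^sub>M lborel" by simp
next
  show "(\<lambda>x. collide (f x) i k (g x)) \<in> space M \<rightarrow> (\<Pi>\<^sub>E l\<in>{..<n}. space lborel)"
  proof
    fix x assume "x \<in> space M"
    then have "g x \<in> extensional {..<n}"
      using measurable_space[OF assms(2)] by (auto simp: space_PiM PiE_def)
    then show "collide (f x) i k (g x) \<in> (\<Pi>\<^sub>E l\<in>{..<n}. space lborel)"
      using assms(3,4) by (auto simp: collide_def PiE_def extensional_def)
  qed
qed

text \<open>Tonelli isolates the coordinates \<open>i\<close> and \<open>k\<close>; with all others
  frozen, the claim is the two-particle identity \<open>nn_integral_outgoing\<close>.\<close>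

lemma nn_integral_collide:
  fixes h :: "configuration \<Rightarrow> ennreal"
  assumes \<omega>: "norm \<omega> = 1" and ik: "i < k" "k < n"
    and [measurable]: "h \<in> borel_measurable (velocities n)"
  shows "(\<integral>\<^sup>+V. h (collide \<omega> i k V) \<partial>velocities n) = (\<integral>\<^sup>+V. h V \<partial>velocities n)"
proof -
  define J where "J = {..<n} - {i, k}"
  have J: "finite J" "k \<notin> J" "i \<notin> insert k J" and n: "{..<n} = insert i (insert k J)"
    using ik by (auto simp: J_def)
  have split: "(\<integral>\<^sup>+V. g V \<partial>velocities n)
      = (\<integral>\<^sup>+x. \<integral>\<^sup>+w. \<integral>\<^sup>+v. g (x(k := w, i := v)) \<partial>lborel \<partial>lborel \<partial>Pi\<^sub>M J (\<lambda>_. lborel))"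
    if [measurable]: "g \<in> borel_measurable (velocities n)" for g :: "configuration \<Rightarrow> ennreal"
  proof -
    have g: "g \<in> borel_measurable (Pi\<^sub>M (insert i (insert k J)) (\<lambda>_. lborel))"
      using that by (simp only: n)
    have g2: "(\<lambda>x. \<integral>\<^sup>+v. g (x(i := v)) \<partial>lborel) \<in> borel_measurable (Pi\<^sub>M (insert k J) (\<lambda>_. lborel))"
      using lborel.borel_measurable_nn_integral_fst[OF measurable_compose[OF measurable_add_dim g]]
      by (simp only: prod.case)
    show ?thesis
      unfolding n
      by (subst velocity_product.product_nn_integral_insert[OF _ J(3) g], simp add: J)
        (rule velocity_product.product_nn_integral_insert[OF J(1,2) g2])
  qed
  have upd: "(\<lambda>p. x(k := snd p, i := fst p)) \<in> (borel :: velocity measure) \<Otimes>\<^sub>M borel \<rightarrow>\<^sub>M velocities n"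
    if "x \<in> space (Pi\<^sub>M J (\<lambda>_. lborel))" for x :: configuration
  proof (rule measurable_PiM_single')
    fix l assume "l \<in> {..<n}"
    show "(\<lambda>p. (x(k := snd p, i := fst p)) l) \<in> (borel :: velocity measure) \<Otimes>\<^sub>M borel \<rightarrow>\<^sub>M lborel"
      by (cases "l = i"; cases "l = k") auto
  next
    show "(\<lambda>p. x(k := snd p, i := fst p)) \<in> space ((borel :: velocity measure) \<Otimes>\<^sub>M borel)
        \<rightarrow> (\<Pi>\<^sub>E l\<in>{..<n}. space lborel)"
      using that by (auto simp: n space_PiM PiE_def extensional_def)
  qed
  have eq: "(\<integral>\<^sup>+w. \<integral>\<^sup>+v. h (collide \<omega> i k (x(k := w, i := v))) \<partial>lborel \<partial>lborel)
      = (\<integral>\<^sup>+w. \<integral>\<^sup>+v. h (x(k := w, i := v)) \<partial>lborel \<partial>lborel)"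
    if x: "x \<in> space (Pi\<^sub>M J (\<lambda>_. lborel))" for x
  proof -
    define H where "H p = h (x(k := snd p, i := fst p))" for p
    have [measurable]: "H \<in> borel_measurable (borel \<Otimes>\<^sub>M borel)"
      unfolding H_def using measurable_compose[OF upd[OF x] assms(4)] by simp
    have c: "h (collide \<omega> i k (x(k := w, i := v))) = H (outgoing1 \<omega> v w, outgoing2 \<omega> v w)" for v w
      using ik by (auto simp: H_def collide_def intro!: arg_cong[of _ _ h])
    have "(\<integral>\<^sup>+w. \<integral>\<^sup>+v. h (collide \<omega> i k (x(k := w, i := v))) \<partial>lborel \<partial>lborel)
        = (\<integral>\<^sup>+v. \<integral>\<^sup>+w. H (outgoing1 \<omega> v w, outgoing2 \<omega> v w) \<partial>lborel \<partial>lborel)"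
      unfolding c by (rule lborel_pair.Fubini') measurable
    also have "\<dots> = (\<integral>\<^sup>+v. \<integral>\<^sup>+w. H (v, w) \<partial>lborel \<partial>lborel)"
      by (rule nn_integral_outgoing[OF \<omega>]) measurable
    also have "\<dots> = (\<integral>\<^sup>+w. \<integral>\<^sup>+v. H (v, w) \<partial>lborel \<partial>lborel)"
      by (rule lborel_pair.Fubini'[symmetric]) measurable
    finally show ?thesis by (simp add: H_def)
  qed
  have [measurable]: "(\<lambda>V. h (collide \<omega> i k V)) \<in> borel_measurable (velocities n)"
    by (rule measurable_compose[OF collide_measurable assms(4)]) (use ik in auto)
  show ?thesis
    by (simp only: split[OF \<open>h \<in> borel_measurable (velocities n)\<close>]
      split[OF \<open>(\<lambda>V. h (collide \<omega> i k V)) \<in> borel_measurable (velocities n)\<close>])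
      (rule nn_integral_cong, rule eq)
qed

text \<open>Push-forward form of \<open>nn_integral_collide\<close>, through which the invariance
  passes to signed integrands.\<close>

lemma distr_collide:
  assumes "norm \<omega> = 1" "i < k" "k < n"
  shows "distr (velocities n) (velocities n) (collide \<omega> i k) = velocities n"
proof (rule measure_eqI)
  fix A assume "A \<in> sets (distr (velocities n) (velocities n) (collide \<omega> i k))"
  then have A[measurable]: "A \<in> sets (velocities n)" by simp
  have c[measurable]: "collide \<omega> i k \<in> velocities n \<rightarrow>\<^sub>M velocities n"
    using collide_measurable[of "\<lambda>_. \<omega>" "velocities n" "\<lambda>x. x" n i k] assms by simp
  have "emeasure (distr (velocities n) (velocities n) (collide \<omega> i k)) A
      = (\<integral>\<^sup>+V. indicator A V \<partial>distr (velocities n) (velocities n) (collide \<omega> i k))"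
    by simp
  also have "\<dots> = (\<integral>\<^sup>+V. indicator A (collide \<omega> i k V) \<partial>velocities n)"
    by (rule nn_integral_distr) simp_all
  also have "\<dots> = (\<integral>\<^sup>+V. indicator A V \<partial>velocities n)"
    by (rule nn_integral_collide[OF assms]) simp
  finally show "emeasure (distr (velocities n) (velocities n) (collide \<omega> i k)) A = emeasure (velocities n) A"
    by simp
qed simp

text \<open>A collision changes the sign of the normal component of the relative velocity, so the
  second collision returns exactly what the first one transferred.\<close>

lemma collide_collide:
  assumes "norm \<omega> = 1" "i \<noteq> k"
  shows "collide \<omega> i k (collide \<omega> i k V) = V"
proof -
  have w: "\<omega> \<bullet> \<omega> = 1" using assms by (simp add: dot_square_norm)
  define c where "c = \<omega> \<bullet> (V i - V k)"
  have "\<omega> \<bullet> ((V i - c *\<^sub>R \<omega>) - (V k + c *\<^sub>R \<omega>)) = - c"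
    unfolding c_def inner_diff_right inner_add_right inner_scaleR_right w by simp
  then show ?thesis using assms(2)
    by (auto simp: collide_def outgoing1_def outgoing2_def fun_eq_iff c_def[symmetric])
qed

lemma collide_diff:
  assumes "i \<noteq> k"
  shows "collide \<omega> i k V i - collide \<omega> i k V k = (V i - V k) - (2 * (\<omega> \<bullet> (V i - V k))) *\<^sub>R \<omega>"
proof -
  have "(x - c *\<^sub>R \<omega>) - (y + c *\<^sub>R \<omega>) = (x - y) - (2 * c) *\<^sub>R \<omega>" for x y :: velocity and c
    unfolding mult_2 scaleR_add_left by simp
  then show ?thesis
    using assms by (simp add: collide_def outgoing1_def outgoing2_def)
qed

subsection \<open>Collision operators\<close>

lemma integrable_mult_bounded:
  fixes u \<phi> :: "'a \<Rightarrow> real"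
  assumes "integrable M u" "\<phi> \<in> borel_measurable M" "\<And>x. \<bar>\<phi> x\<bar> \<le> K"
  shows "integrable M (\<lambda>x. u x * \<phi> x)"
proof (rule Bochner_Integration.integrable_bound)
  show "integrable M (\<lambda>x. \<bar>u x\<bar> * K)" using assms(1) by auto
  show "(\<lambda>x. u x * \<phi> x) \<in> borel_measurable M" using assms(1,2) by auto
  have "0 \<le> K" using assms(3)[of undefined] by linarith
  then show "AE x in M. norm (u x * \<phi> x) \<le> norm (\<bar>u x\<bar> * K)"
    using assms(3) by (auto simp: abs_mult intro!: mult_left_mono)
qed

section \<open>Test functions of finitely many velocities and the duality bracket\<close>

text \<open>Dependence on the first \<open>j\<close> velocities is encoded as invariance under
  restriction, so that one and the same \<phi> can be integrated at every level \<open>n\<close>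
  with \<open>j \<le> n\<close>. The sup bound \<open>K\<close> is an index of the predicate because
  all error estimates are proportional to it.\<close>

definition test_function :: "nat \<Rightarrow> real \<Rightarrow> (configuration \<Rightarrow> real) \<Rightarrow> bool" where
  "test_function j K \<phi> \<longleftrightarrow> \<phi> \<in> borel_measurable (velocities j) \<and>
     (\<forall>V. \<phi> (restrict V {..<j}) = \<phi> V) \<and> (\<forall>V. \<bar>\<phi> V\<bar> \<le> K)"

lemma test_function_cong:
  assumes "test_function j K \<phi>" "\<And>l. l < j \<Longrightarrow> V l = V' l"
  shows "\<phi> V = \<phi> V'"
proof -
  have "restrict V {..<j} = restrict V' {..<j}" using assms(2) by (auto simp: restrict_def)
  then show ?thesis using assms(1) by (metis test_function_def)
qed

lemma test_function_bound: "test_function j K \<phi> \<Longrightarrow> \<bar>\<phi> V\<bar> \<le> K"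
  by (simp add: test_function_def)

lemma test_function_measurable:
  assumes "test_function j K \<phi>" "j \<le> n"
  shows "\<phi> \<in> borel_measurable (velocities n)"
proof -
  have "(\<lambda>V. \<phi> (restrict V {..<j})) \<in> borel_measurable (velocities n)"
    using assms by (intro measurable_compose[OF measurable_restrict_subset])
      (auto simp: test_function_def)
  then show ?thesis using assms(1) by (simp add: test_function_def)
qed

lemma test_function_const: "test_function j \<bar>c\<bar> (\<lambda>_. c)"
  by (simp add: test_function_def)

lemma test_function_mono: "test_function j K \<phi> \<Longrightarrow> K \<le> K' \<Longrightarrow> test_function j K' \<phi>"
  by (auto simp: test_function_def intro: order_trans)

lemma test_function_mono_dim:
  assumes "test_function j K \<phi>" "j \<le> n" shows "test_function n K \<phi>"
proof -
  have "\<phi> (restrict V {..<n}) = \<phi> V" for V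
    by (rule test_function_cong[OF assms(1)]) (use assms(2) in auto)
  then show ?thesis
    using test_function_measurable[OF assms] assms(1) by (simp add: test_function_def)
qed

lemma test_function_add:
  "test_function j K \<phi> \<Longrightarrow> test_function j K' \<psi> \<Longrightarrow> test_function j (K + K') (\<lambda>V. \<phi> V + \<psi> V)"
  unfolding test_function_def by (auto intro!: order_trans[OF abs_triangle_ineq add_mono])

lemma test_function_sum:
  "finite I \<Longrightarrow> (\<And>i. i \<in> I \<Longrightarrow> test_function j (K i) (\<phi> i)) \<Longrightarrow>
   test_function j (\<Sum>i\<in>I. K i) (\<lambda>V. \<Sum>i\<in>I. \<phi> i V)"
proof (induction I rule: finite_induct)
  case empty
  then show ?case using test_function_const[of j 0] by simp
qed (simp add: test_function_add)

lemma test_function_cmult: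
  "test_function j K \<phi> \<Longrightarrow> test_function j (\<bar>c\<bar> * K) (\<lambda>V. c * \<phi> V)"
  unfolding test_function_def by (auto simp: abs_mult intro: mult_left_mono)

text \<open>Taken with a test function of a level \<open>j\<close> below \<open>n\<close>, this is
  the pairing with the \<open>j\<close>-particle marginal of \<open>u\<close>, which never has to be
  formed.\<close>

definition pairing :: "nat \<Rightarrow> (configuration \<Rightarrow> real) \<Rightarrow> (configuration \<Rightarrow> real) \<Rightarrow> real" where
  "pairing n u \<phi> = (LINT V|velocities n. u V * \<phi> V)"

lemma integrable_test:
  assumes "integrable (velocities n) u" "test_function j K \<phi>" "j \<le> n"
  shows "integrable (velocities n) (\<lambda>V. u V * \<phi> V)"
  using assms(1) test_function_measurable[OF assms(2,3)] test_function_bound[OF assms(2)]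
  by (rule integrable_mult_bounded)

lemma pairing_add:
  assumes "integrable (velocities n) u" "test_function j K \<phi>" "test_function j K' \<psi>" "j \<le> n"
  shows "pairing n u (\<lambda>V. \<phi> V + \<psi> V) = pairing n u \<phi> + pairing n u \<psi>"
  unfolding pairing_def distrib_left
  by (intro Bochner_Integration.integral_add integrable_test[OF assms(1)]) (use assms in auto)

lemma pairing_cmult: "pairing n u (\<lambda>V. c * \<phi> V) = c * pairing n u \<phi>"
  unfolding pairing_def by (simp add: mult.left_commute[of _ c])

lemma pairing_sum:
  assumes "integrable (velocities n) u" "\<And>i. i \<in> I \<Longrightarrow> test_function j (K i) (\<phi> i)" "j \<le> n"
  shows "pairing n u (\<lambda>V. \<Sum>i\<in>I. \<phi> i V) = (\<Sum>i\<in>I. pairing n u (\<phi> i))"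
  unfolding pairing_def sum_distrib_left
  by (rule Bochner_Integration.integral_sum) (rule integrable_test[OF assms(1)], use assms in auto)

lemma pairing_bound:
  assumes "integrable (velocities n) u" "test_function j K \<phi>" "j \<le> n"
  shows "\<bar>pairing n u \<phi>\<bar> \<le> K * (LINT V|velocities n. \<bar>u V\<bar>)"
proof -
  have "\<bar>pairing n u \<phi>\<bar> \<le> (LINT V|velocities n. \<bar>u V * \<phi> V\<bar>)"
    unfolding pairing_def by (rule integral_abs_bound)
  also have "\<dots> \<le> (LINT V|velocities n. K * \<bar>u V\<bar>)"
  proof (rule integral_mono)
    show "integrable (velocities n) (\<lambda>V. \<bar>u V * \<phi> V\<bar>)"
      using integrable_test[OF assms] by (rule integrable_abs)
    show "integrable (velocities n) (\<lambda>V. K * \<bar>u V\<bar>)" using assms(1) by auto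
    show "\<bar>u V * \<phi> V\<bar> \<le> K * \<bar>u V\<bar>" for V
      using test_function_bound[OF assms(2), of V]
      by (simp add: abs_mult mult.commute[of K] mult_left_mono)
  qed
  finally show ?thesis by simp
qed

lemma sphere_measure_borel: "f \<in> M \<rightarrow>\<^sub>M sphere_measure \<Longrightarrow> f \<in> borel_measurable M"
  unfolding measurable_cong_sets[OF refl sets_sphere_measure] measurable_restrict_space2_iff by simp

section \<open>Collision operators with a bounded kernel\<close>

locale bounded_kernel =
  fixes B :: "velocity \<Rightarrow> velocity \<Rightarrow> real" and C :: real
  assumes kernel: "collision_kernel B"
    and kernel_le: "\<And>\<omega> v. \<omega> \<in> sphere 0 1 \<Longrightarrow> B \<omega> v \<le> C"
begin

text \<open>The bound on the kernel times the area of the sphere. It is the common rate to which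
  every pair is raised by fictitious collisions.\<close>

definition rate :: real where "rate = 4 * pi * C"

lemma kernel_nonneg: "\<omega> \<in> sphere 0 1 \<Longrightarrow> 0 \<le> B \<omega> v"
  using kernel[unfolded collision_kernel_def, THEN conjunct2, THEN conjunct1] by blast

lemma C_nonneg: "0 \<le> C"
proof -
  have "(axis 1 1 :: velocity) \<in> sphere 0 1" by (simp add: norm_axis_1)
  from order_trans[OF kernel_nonneg[OF this] kernel_le[OF this]] show ?thesis .
qed

lemma rate_nonneg: "0 \<le> rate"
  using C_nonneg by (simp add: rate_def)

lemma kernel_measurable:
  assumes "f \<in> M \<rightarrow>\<^sub>M sphere_measure" "g \<in> borel_measurable M"
  shows "(\<lambda>x. B (f x) (g x)) \<in> borel_measurable M"
proof -
  have 1: "sets (sphere_measure \<Otimes>\<^sub>M (borel :: velocity measure)) = sets (restrict_space borel (sphere 0 1) \<Otimes>\<^sub>M borel)"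
    by (intro sets_pair_measure_cong sets_sphere_measure refl)
  have "(\<lambda>(\<omega>, v). B \<omega> v) \<in> borel_measurable (restrict_space borel (sphere 0 1) \<Otimes>\<^sub>M borel)"
    using kernel unfolding collision_kernel_def by (rule conjunct1)
  then have "(\<lambda>(\<omega>, v). B \<omega> v) \<in> borel_measurable (sphere_measure \<Otimes>\<^sub>M borel)"
    by (rule measurable_cong_sets[OF 1 refl, THEN equalityD2, THEN subsetD])
  from measurable_compose[OF measurable_Pair[OF assms] this] show ?thesis by (simp only: prod.case)
qed

text \<open>Reflecting the relative velocity preserves its norm and the modulus of its component
  along \<omega>, the only quantities on which \<open>B\<close> depends.\<close>

lemma kernel_collide:
  assumes "\<omega> \<in> sphere 0 1" "i \<noteq> k"
  shows "B \<omega> (collide \<omega> i k V i - collide \<omega> i k V k) = B \<omega> (V i - V k)"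
proof -
  have w: "\<omega> \<bullet> \<omega> = 1" using assms by (simp add: dot_square_norm)
  have o: "orthogonal_transformation (\<lambda>u. u - (2 * (\<omega> \<bullet> u)) *\<^sub>R \<omega>)"
    using assms by (intro orthogonal_reflection) auto
  have "norm ((V i - V k) - (2 * (\<omega> \<bullet> (V i - V k))) *\<^sub>R \<omega>) = norm (V i - V k)"
    using o by (simp add: orthogonal_transformation)
  moreover have "\<bar>\<omega> \<bullet> ((V i - V k) - (2 * (\<omega> \<bullet> (V i - V k))) *\<^sub>R \<omega>)\<bar> = \<bar>\<omega> \<bullet> (V i - V k)\<bar>"
    by (subst inner_diff_right) (simp add: w)
  ultimately show ?thesis
    using kernel assms(1) unfolding collide_diff[OF assms(2)] collision_kernel_def by (elim conjE) blast
qed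

lemma pair_sigma_finite_sphere: "pair_sigma_finite sphere_measure (velocities n)"
  by (intro pair_sigma_finite.intro sphere_measure.sigma_finite_measure_axioms sigma_finite_velocities) simp

context
  fixes i k n :: nat assumes ik: "i < k" "k < n"
begin

lemma component_measurable:
  "(\<lambda>V. V i - V k) \<in> borel_measurable (velocities n)"
proof -
  have "(\<lambda>V. V l) \<in> velocities n \<rightarrow>\<^sub>M lborel" if "l < n" for l
    using that by (intro measurable_component_singleton) simp
  from this[of i] this[of k] show ?thesis using ik by simp
qed

lemma gain_measurable:
  fixes u :: "configuration \<Rightarrow> real"
  assumes u: "u \<in> borel_measurable (velocities n)"
  shows "(\<lambda>p. B (fst p) (snd p i - snd p k) * u (collide (fst p) i k (snd p)))
    \<in> borel_measurable (sphere_measure \<Otimes>\<^sub>M velocities n)"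
proof (rule borel_measurable_times)
  show "(\<lambda>p. B (fst p) (snd p i - snd p k)) \<in> borel_measurable (sphere_measure \<Otimes>\<^sub>M velocities n)"
    by (rule kernel_measurable[OF measurable_fst measurable_compose[OF measurable_snd component_measurable]])
  show "(\<lambda>p. u (collide (fst p) i k (snd p))) \<in> borel_measurable (sphere_measure \<Otimes>\<^sub>M velocities n)"
    by (rule measurable_compose[OF collide_measurable u])
      (use ik in \<open>auto intro: sphere_measure_borel\<close>)
qed

lemma loss_measurable:
  fixes u :: "configuration \<Rightarrow> real"
  assumes u: "u \<in> borel_measurable (velocities n)"
  shows "(\<lambda>p. B (fst p) (snd p i - snd p k) * u (snd p))
    \<in> borel_measurable (sphere_measure \<Otimes>\<^sub>M velocities n)"
  by (intro borel_measurable_times measurable_compose[OF measurable_snd u]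
      kernel_measurable[OF measurable_fst measurable_compose[OF measurable_snd component_measurable]])

lemma collide_fixed_measurable: "\<omega> \<in> sphere 0 1 \<Longrightarrow> collide \<omega> i k \<in> velocities n \<rightarrow>\<^sub>M velocities n"
  using collide_measurable[of "\<lambda>_. \<omega>" "velocities n" "\<lambda>x. x" n i k] ik by simp

lemma integral_collide:
  fixes h :: "configuration \<Rightarrow> real"
  assumes "\<omega> \<in> sphere 0 1" "h \<in> borel_measurable (velocities n)"
  shows "(LINT V|velocities n. h (collide \<omega> i k V)) = (LINT V|velocities n. h V)"
  by (subst (2) distr_collide[symmetric, OF _ ik, of \<omega>])
    (use assms collide_fixed_measurable in \<open>auto simp: integral_distr\<close>)

lemma integrable_loss:
  assumes "integrable (velocities n) u"
  shows "integrable (sphere_measure \<Otimes>\<^sub>M velocities n) (\<lambda>p. B (fst p) (snd p i - snd p k) * u (snd p))"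
proof (rule integrableI_bounded)
  interpret P: pair_sigma_finite sphere_measure "velocities n" by (rule pair_sigma_finite_sphere)
  have u: "u \<in> borel_measurable (velocities n)" using assms by auto
  show m: "(\<lambda>p. B (fst p) (snd p i - snd p k) * u (snd p)) \<in> borel_measurable (sphere_measure \<Otimes>\<^sub>M velocities n)"
    by (rule loss_measurable[OF u])
  have "(\<integral>\<^sup>+p. norm (B (fst p) (snd p i - snd p k) * u (snd p)) \<partial>(sphere_measure \<Otimes>\<^sub>M velocities n))
      = (\<integral>\<^sup>+\<omega>. \<integral>\<^sup>+V. norm (B \<omega> (V i - V k) * u V) \<partial>velocities n \<partial>sphere_measure)"
    using P.M2.nn_integral_fst[OF measurable_compose[OF measurable_compose[OF m borel_measurable_norm] measurable_ennreal]]
    by (simp only: fst_conv snd_conv)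
  also have "\<dots> \<le> (\<integral>\<^sup>+\<omega>. \<integral>\<^sup>+V. ennreal C * norm (u V) \<partial>velocities n \<partial>sphere_measure)"
    using kernel_nonneg kernel_le C_nonneg
    by (intro nn_integral_mono) (auto simp: abs_mult ennreal_mult'[symmetric] intro!: ennreal_leI mult_right_mono)
  also have "\<dots> = ennreal C * (\<integral>\<^sup>+V. norm (u V) \<partial>velocities n) * emeasure sphere_measure (sphere 0 1)"
    using u by (simp add: nn_integral_cmult)
  also have "\<dots> < \<infinity>"
    using assms by (auto simp: integrable_iff_bounded emeasure_sphere_measure_total ennreal_mult_less_top)
  finally show "(\<integral>\<^sup>+p. norm (B (fst p) (snd p i - snd p k) * u (snd p)) \<partial>(sphere_measure \<Otimes>\<^sub>M velocities n)) < \<infinity>" .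
qed

text \<open>Changing variables by the collision, under which the kernel is invariant, turns the
  integral of the modulus of the gain part into that of the loss part.\<close>

lemma integrable_gain:
  assumes "integrable (velocities n) u"
  shows "integrable (sphere_measure \<Otimes>\<^sub>M velocities n)
    (\<lambda>p. B (fst p) (snd p i - snd p k) * u (collide (fst p) i k (snd p)))"
proof (rule integrableI_bounded)
  interpret P: pair_sigma_finite sphere_measure "velocities n" by (rule pair_sigma_finite_sphere)
  have u: "u \<in> borel_measurable (velocities n)" using assms by auto
  show m: "(\<lambda>p. B (fst p) (snd p i - snd p k) * u (collide (fst p) i k (snd p)))
      \<in> borel_measurable (sphere_measure \<Otimes>\<^sub>M velocities n)"
    by (rule gain_measurable[OF u])
  have m2: "(\<lambda>V. ennreal (norm (B \<omega> (V i - V k) * u V))) \<in> borel_measurable (velocities n)"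
    if "\<omega> \<in> sphere 0 1" for \<omega>
  proof -
    have "(\<lambda>V. B \<omega> (V i - V k)) \<in> borel_measurable (velocities n)"
      by (rule kernel_measurable[OF _ component_measurable]) (use that in auto)
    then show ?thesis using u by auto
  qed
  have "(\<integral>\<^sup>+p. norm (B (fst p) (snd p i - snd p k) * u (collide (fst p) i k (snd p))) \<partial>(sphere_measure \<Otimes>\<^sub>M velocities n))
      = (\<integral>\<^sup>+\<omega>. \<integral>\<^sup>+V. norm (B \<omega> (V i - V k) * u (collide \<omega> i k V)) \<partial>velocities n \<partial>sphere_measure)"
    using P.M2.nn_integral_fst[OF measurable_compose[OF measurable_compose[OF m borel_measurable_norm] measurable_ennreal]]
    by (simp only: fst_conv snd_conv)
  also have "\<dots> = (\<integral>\<^sup>+\<omega>. \<integral>\<^sup>+V. norm (B \<omega> (V i - V k) * u V) \<partial>velocities n \<partial>sphere_measure)"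
  proof (rule nn_integral_cong)
    fix \<omega> assume "\<omega> \<in> space sphere_measure"
    then have \<omega>: "\<omega> \<in> sphere 0 1" "norm \<omega> = 1" by auto
    have "(\<integral>\<^sup>+V. norm (B \<omega> (V i - V k) * u (collide \<omega> i k V)) \<partial>velocities n)
        = (\<integral>\<^sup>+V. norm (B \<omega> (collide \<omega> i k V i - collide \<omega> i k V k) * u (collide \<omega> i k V)) \<partial>velocities n)"
      using kernel_collide[OF \<omega>(1) less_imp_neq[OF ik(1)]] by simp
    also have "\<dots> = (\<integral>\<^sup>+V. norm (B \<omega> (V i - V k) * u V) \<partial>velocities n)"
      by (rule nn_integral_collide[OF \<omega>(2) ik m2[OF \<omega>(1)]])
    finally show "(\<integral>\<^sup>+V. norm (B \<omega> (V i - V k) * u (collide \<omega> i k V)) \<partial>velocities n) = \<dots>" .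
  qed
  also have "\<dots> = (\<integral>\<^sup>+p. norm (B (fst p) (snd p i - snd p k) * u (snd p)) \<partial>(sphere_measure \<Otimes>\<^sub>M velocities n))"
    using P.M2.nn_integral_fst[OF measurable_compose[OF measurable_compose[OF loss_measurable[OF u] borel_measurable_norm] measurable_ennreal]]
    by (simp only: fst_conv snd_conv)
  also have "\<dots> < \<infinity>" using integrable_loss[OF assms] by (simp add: integrable_iff_bounded)
  finally show "(\<integral>\<^sup>+p. norm (B (fst p) (snd p i - snd p k) * u (collide (fst p) i k (snd p))) \<partial>(sphere_measure \<Otimes>\<^sub>M velocities n)) < \<infinity>" .
qed

lemma T_pair_measurable:
  assumes "u \<in> borel_measurable (velocities n)"
  shows "T_pair B i k u \<in> borel_measurable (velocities n)"
proof -
  have "(\<lambda>p. B (fst p) (snd p i - snd p k) * (u (collide (fst p) i k (snd p)) - u (snd p)))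
      \<in> borel_measurable (sphere_measure \<Otimes>\<^sub>M velocities n)"
    unfolding right_diff_distrib
    by (intro borel_measurable_diff gain_measurable loss_measurable assms)
  from measurable_compose[OF measurable_Pair[OF measurable_snd measurable_fst] this]
  have "(\<lambda>(V, \<omega>). B \<omega> (V i - V k) * (u (collide \<omega> i k V) - u V))
      \<in> borel_measurable (velocities n \<Otimes>\<^sub>M sphere_measure)" by (simp add: split_beta')
  from sphere_measure.borel_measurable_lebesgue_integral[OF this]
  show ?thesis unfolding T_pair_def[abs_def] .
qed

lemma integrable_T_pair:
  assumes "integrable (velocities n) u"
  shows "integrable (velocities n) (T_pair B i k u)"
proof -
  interpret P: pair_sigma_finite sphere_measure "velocities n" by (rule pair_sigma_finite_sphere)
  have "integrable (sphere_measure \<Otimes>\<^sub>M velocities n)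
     (\<lambda>(\<omega>, V). B \<omega> (V i - V k) * (u (collide \<omega> i k V) - u V))"
    using Bochner_Integration.integrable_diff[OF integrable_gain[OF assms] integrable_loss[OF assms]]
    by (simp add: right_diff_distrib split_beta')
  from P.integrable_snd[OF this] show ?thesis unfolding T_pair_def[abs_def] .
qed

text \<open>The collision map is a measure-preserving involution that leaves the kernel invariant.\<close>

lemma T_pair_adjoint:
  assumes u: "integrable (velocities n) u" and \<phi>: "test_function n K \<phi>"
  shows "pairing n (T_pair B i k u) \<phi> = pairing n u (T_pair B i k \<phi>)"
proof -
  interpret P: pair_sigma_finite sphere_measure "velocities n" by (rule pair_sigma_finite_sphere)
  let ?P = "sphere_measure \<Otimes>\<^sub>M velocities n"
  let ?B = "\<lambda>\<omega> V. B \<omega> (V i - V k)"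
  let ?c = "\<lambda>\<omega> V. collide \<omega> i k V"
  have \<phi>m: "\<phi> \<in> borel_measurable (velocities n)" using test_function_measurable[OF \<phi>] by simp
  have um: "u \<in> borel_measurable (velocities n)" using u by auto
  have cm: "(\<lambda>p. \<phi> (?c (fst p) (snd p))) \<in> borel_measurable ?P"
    by (rule measurable_compose[OF collide_measurable \<phi>m]) (use ik in \<open>auto intro: sphere_measure_borel\<close>)
  have g1: "integrable ?P (\<lambda>(\<omega>, V). ?B \<omega> V * u (?c \<omega> V) * \<phi> V)"
    unfolding split_beta'
    by (rule integrable_mult_bounded[OF integrable_gain[OF u] measurable_compose[OF measurable_snd \<phi>m]
          test_function_bound[OF \<phi>]])
  have g2: "integrable ?P (\<lambda>(\<omega>, V). ?B \<omega> V * u V * \<phi> V)"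
    unfolding split_beta'
    by (rule integrable_mult_bounded[OF integrable_loss[OF u] measurable_compose[OF measurable_snd \<phi>m]
          test_function_bound[OF \<phi>]])
  have g3: "integrable ?P (\<lambda>(\<omega>, V). ?B \<omega> V * u V * \<phi> (?c \<omega> V))"
    unfolding split_beta'
    by (rule integrable_mult_bounded[OF integrable_loss[OF u] cm test_function_bound[OF \<phi>]])
  have g12: "integrable ?P (\<lambda>(\<omega>, V). ?B \<omega> V * u (?c \<omega> V) * \<phi> V - ?B \<omega> V * u V * \<phi> V)"
    using Bochner_Integration.integrable_diff[OF g1 g2] by (simp only: split_beta')
  have g32: "integrable ?P (\<lambda>(\<omega>, V). ?B \<omega> V * u V * \<phi> (?c \<omega> V) - ?B \<omega> V * u V * \<phi> V)"
    using Bochner_Integration.integrable_diff[OF g3 g2] by (simp only: split_beta')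
  have "pairing n (T_pair B i k u) \<phi>
      = (LINT V|velocities n. LINT \<omega>|sphere_measure. ?B \<omega> V * u (?c \<omega> V) * \<phi> V - ?B \<omega> V * u V * \<phi> V)"
    unfolding pairing_def T_pair_def
    by (subst Bochner_Integration.integral_mult_left_zero[symmetric]) (simp add: algebra_simps)
  also have "\<dots> = integral\<^sup>L ?P (\<lambda>(\<omega>, V). ?B \<omega> V * u (?c \<omega> V) * \<phi> V - ?B \<omega> V * u V * \<phi> V)"
    using P.integral_snd[OF g12] by simp
  also have "\<dots> = integral\<^sup>L ?P (\<lambda>(\<omega>, V). ?B \<omega> V * u (?c \<omega> V) * \<phi> V)
      - integral\<^sup>L ?P (\<lambda>(\<omega>, V). ?B \<omega> V * u V * \<phi> V)"
    using Bochner_Integration.integral_diff[OF g1 g2] by (simp only: split_beta')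
  also have "integral\<^sup>L ?P (\<lambda>(\<omega>, V). ?B \<omega> V * u (?c \<omega> V) * \<phi> V)
      = (LINT \<omega>|sphere_measure. LINT V|velocities n. ?B \<omega> V * u (?c \<omega> V) * \<phi> V)"
    by (rule P.integral_fst[OF g1, symmetric])
  \<comment> \<open>Only the gain term has to be transformed: for fixed \<omega> the change of
    variables moves the collision from \<open>u\<close> to \<phi>. The loss term is the same on both
    sides.\<close>
  also have "\<dots> = (LINT \<omega>|sphere_measure. LINT V|velocities n. ?B \<omega> V * u V * \<phi> (?c \<omega> V))"
  proof (rule Bochner_Integration.integral_cong[OF refl])
    fix \<omega> assume "\<omega> \<in> space sphere_measure"
    then have \<omega>: "\<omega> \<in> sphere 0 1" "norm \<omega> = 1" by auto
    have "(\<lambda>V. ?B \<omega> V * u V * \<phi> (?c \<omega> V)) \<in> borel_measurable (velocities n)"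
      by (intro borel_measurable_times um kernel_measurable[OF _ component_measurable]
          measurable_compose[OF collide_fixed_measurable[OF \<omega>(1)] \<phi>m]) (use \<omega> in auto)
    from integral_collide[OF \<omega>(1) this]
    show "(LINT V|velocities n. ?B \<omega> V * u (?c \<omega> V) * \<phi> V) = (LINT V|velocities n. ?B \<omega> V * u V * \<phi> (?c \<omega> V))"
      using ik \<omega> by (simp add: kernel_collide collide_collide)
  qed
  also have "\<dots> = integral\<^sup>L ?P (\<lambda>(\<omega>, V). ?B \<omega> V * u V * \<phi> (?c \<omega> V))"
    by (rule P.integral_fst[OF g3])
  also have "\<dots> - integral\<^sup>L ?P (\<lambda>(\<omega>, V). ?B \<omega> V * u V * \<phi> V)
      = integral\<^sup>L ?P (\<lambda>(\<omega>, V). ?B \<omega> V * u V * \<phi> (?c \<omega> V) - ?B \<omega> V * u V * \<phi> V)"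
    using Bochner_Integration.integral_diff[OF g3 g2] by (simp only: split_beta')
  also have "\<dots> = (LINT V|velocities n. LINT \<omega>|sphere_measure. ?B \<omega> V * u V * \<phi> (?c \<omega> V) - ?B \<omega> V * u V * \<phi> V)"
    using P.integral_snd[OF g32] by simp
  also have "\<dots> = pairing n u (T_pair B i k \<phi>)"
    unfolding pairing_def T_pair_def
    by (subst Bochner_Integration.integral_mult_right_zero[symmetric]) (simp add: algebra_simps)
  finally show ?thesis .
qed

end

text \<open>Adding \<open>rate * \<phi>\<close> completes the collisions to a process with constant total rate, whose gain
  part does not increase the supremum norm.\<close>

lemma T_pair_gain_bound:
  assumes "\<And>V. \<bar>\<phi> V\<bar> \<le> K"
  shows "\<bar>T_pair B i k \<phi> V + rate * \<phi> V\<bar> \<le> rate * K"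
proof (cases "integrable sphere_measure (\<lambda>\<omega>. B \<omega> (V i - V k) * (\<phi> (collide \<omega> i k V) - \<phi> V))")
  \<comment> \<open>A non-integrable integrand has integral 0 by convention; the case must be
    covered because \<phi> is only assumed bounded here.\<close>
  case False
  then have "T_pair B i k \<phi> V = 0" unfolding T_pair_def by (rule not_integrable_integral_eq)
  then show ?thesis using assms[of V] rate_nonneg by (simp add: abs_mult mult_left_mono)
next
  case True
  have c: "integrable sphere_measure (\<lambda>\<omega>. C * \<phi> V)" by simp
  have "T_pair B i k \<phi> V + rate * \<phi> V
      = (LINT \<omega>|sphere_measure. B \<omega> (V i - V k) * (\<phi> (collide \<omega> i k V) - \<phi> V) + C * \<phi> V)"
    using Bochner_Integration.integral_add[OF True c] by (simp add: T_pair_def measure_sphere_measure rate_def)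
  also have "\<bar>\<dots>\<bar> \<le> (LINT \<omega>|sphere_measure. C * K)"
  proof (rule order_trans[OF integral_abs_bound], rule integral_mono)
    show "integrable sphere_measure (\<lambda>\<omega>. \<bar>B \<omega> (V i - V k) * (\<phi> (collide \<omega> i k V) - \<phi> V) + C * \<phi> V\<bar>)"
      by (intro integrable_abs Bochner_Integration.integrable_add True c)
    fix \<omega> assume "\<omega> \<in> space sphere_measure"
    then have \<omega>: "\<omega> \<in> sphere 0 1" by simp
    let ?b = "B \<omega> (V i - V k)"
    \<comment> \<open>Completed to the total weight \<open>C\<close>, a true collision has weight
      \<open>?b\<close> and a fictitious one, which changes nothing, has weight
      \<open>C - ?b\<close>. Both weights are nonnegative.\<close>
    have "\<bar>?b * (\<phi> (collide \<omega> i k V) - \<phi> V) + C * \<phi> V\<bar>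
        = \<bar>?b * \<phi> (collide \<omega> i k V) + (C - ?b) * \<phi> V\<bar>" by (simp add: algebra_simps)
    also have "\<dots> \<le> ?b * \<bar>\<phi> (collide \<omega> i k V)\<bar> + (C - ?b) * \<bar>\<phi> V\<bar>"
      using kernel_nonneg[OF \<omega>] kernel_le[OF \<omega>]
      by (intro order_trans[OF abs_triangle_ineq]) (simp add: abs_mult)
    also have "\<dots> \<le> ?b * K + (C - ?b) * K"
      using kernel_nonneg[OF \<omega>] kernel_le[OF \<omega>] assms by (intro add_mono mult_left_mono) auto
    also have "\<dots> = C * K" by (simp add: algebra_simps)
    finally show "\<bar>?b * (\<phi> (collide \<omega> i k V) - \<phi> V) + C * \<phi> V\<bar> \<le> C * K" .
  qed simp
  also have "\<dots> = rate * K" by (simp add: measure_sphere_measure rate_def)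
  finally show ?thesis .
qed

lemma T_pair_bound:
  assumes "\<And>V. \<bar>\<phi> V\<bar> \<le> K"
  shows "\<bar>T_pair B i k \<phi> V\<bar> \<le> 2 * rate * K"
proof -
  have "\<bar>rate * \<phi> V\<bar> \<le> rate * K"
    using assms[of V] rate_nonneg by (simp add: abs_mult mult_left_mono)
  with T_pair_gain_bound[of \<phi> K i k V, OF assms] show ?thesis by linarith
qed

text \<open>Colliding two particles below \<open>n\<close> commutes with forgetting the particles
  from \<open>n\<close> on, so the operator stays within the level.\<close>

lemma test_function_T_pair:
  assumes "test_function n K \<phi>" "i < k" "k < n"
  shows "test_function n (2 * rate * K) (T_pair B i k \<phi>)"
  unfolding test_function_def
proof (intro conjI allI)
  show "T_pair B i k \<phi> \<in> borel_measurable (velocities n)"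
    by (rule T_pair_measurable[OF assms(2,3) test_function_measurable[OF assms(1)]]) simp
  show "\<bar>T_pair B i k \<phi> V\<bar> \<le> 2 * rate * K" for V
    by (rule T_pair_bound[OF test_function_bound[OF assms(1)]])
  have "\<phi> (collide \<omega> i k (restrict V {..<n})) = \<phi> (collide \<omega> i k V)" for \<omega> V
    by (rule test_function_cong[OF assms(1)]) (use assms(2,3) in \<open>auto simp: collide_def\<close>)
  moreover have "\<phi> (restrict V {..<n}) = \<phi> V" for V using assms(1) by (simp add: test_function_def)
  ultimately show "T_pair B i k \<phi> (restrict V {..<n}) = T_pair B i k \<phi> V" for V
    using assms(2,3) by (simp add: T_pair_def)
qed

end

subsection \<open>Strong derivatives in \<open>L\<^sup>1\<close>\<close>

text \<open>A real-valued version of the quantity in \<open>has_L1_derivative\<close>, suited to the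
  limit rules for reals.\<close>

definition L1_error ::
  "'a measure \<Rightarrow> (real \<Rightarrow> 'a \<Rightarrow> real) \<Rightarrow> ('a \<Rightarrow> real) \<Rightarrow> real \<Rightarrow> real \<Rightarrow> real" where
  "L1_error M u D t s = (LINT x|M. \<bar>(u s x - u t x) / (s - t) - D x\<bar>)"

lemma integrable_quotient:
  fixes u :: "real \<Rightarrow> 'a \<Rightarrow> real"
  assumes "integrable M (u s)" "integrable M (u t)" "integrable M D"
  shows "integrable M (\<lambda>x. (u s x - u t x) / (s - t) - D x)"
  using assms by (intro Bochner_Integration.integrable_diff integrable_divide_zero) auto

lemma has_L1_derivative_iff_error:
  assumes u: "\<And>s. 0 \<le> s \<Longrightarrow> integrable M (u s)" and D: "integrable M D" and t: "0 \<le> t"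
  shows "has_L1_derivative M u D t \<longleftrightarrow> (L1_error M u D t \<longlongrightarrow> 0) (at t within {0..})"
proof -
  have eq: "(\<integral>\<^sup>+x. ennreal \<bar>(u s x - u t x) / (s - t) - D x\<bar> \<partial>M) = ennreal (L1_error M u D t s)"
    if "s \<in> {0..}" for s
    unfolding L1_error_def
    by (rule nn_integral_eq_integral) (use that u D t in \<open>auto intro!: integrable_abs integrable_quotient\<close>)
  have "has_L1_derivative M u D t \<longleftrightarrow> ((\<lambda>s. ennreal (L1_error M u D t s)) \<longlongrightarrow> ennreal 0) (at t within {0..})"
    unfolding has_L1_derivative_def ennreal_0
    by (rule tendsto_cong) (auto simp: eventually_at_filter eq)
  also have "\<dots> \<longleftrightarrow> (L1_error M u D t \<longlongrightarrow> 0) (at t within {0..})"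
    by (rule tendsto_ennreal_iff) (auto simp: L1_error_def intro!: always_eventually)
  finally show ?thesis .
qed

text \<open>The increment is \<open>s - t\<close> times the difference quotient, whose L^1 norm is
  at most that of \<open>D\<close> plus the derivative error.\<close>

lemma has_L1_derivative_imp_continuous:
  assumes u: "\<And>s. 0 \<le> s \<Longrightarrow> integrable M (u s)" and D: "integrable M D" and t: "0 \<le> t"
    and d: "has_L1_derivative M u D t"
  shows "((\<lambda>s. LINT x|M. \<bar>u s x - u t x\<bar>) \<longlongrightarrow> 0) (at t within {0..})"
proof -
  have lim: "((\<lambda>s. \<bar>s - t\<bar> * (L1_error M u D t s + (LINT x|M. \<bar>D x\<bar>))) \<longlongrightarrow> \<bar>t - t\<bar> * (0 + (LINT x|M. \<bar>D x\<bar>)))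
      (at t within {0..})"
    using has_L1_derivative_iff_error[of M u D t] u D t d by (intro tendsto_intros) blast
  show ?thesis
  proof (rule tendsto_sandwich[OF _ _ tendsto_const])
    show "\<forall>\<^sub>F s in at t within {0..}. 0 \<le> (LINT x|M. \<bar>u s x - u t x\<bar>)" by simp
    show "\<forall>\<^sub>F s in at t within {0..}. (LINT x|M. \<bar>u s x - u t x\<bar>)
        \<le> \<bar>s - t\<bar> * (L1_error M u D t s + (LINT x|M. \<bar>D x\<bar>))"
      unfolding eventually_at_filter
    proof (intro always_eventually allI impI)
      fix s assume s: "s \<noteq> t" "s \<in> {0..}"
      have i: "integrable M (\<lambda>x. (u s x - u t x) / (s - t) - D x)"
        using s t u D by (intro integrable_quotient) auto
      have "(LINT x|M. \<bar>u s x - u t x\<bar>) = (LINT x|M. \<bar>s - t\<bar> * \<bar>((u s x - u t x) / (s - t) - D x) + D x\<bar>)"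
        using s by (simp add: abs_divide)
      also have "\<dots> \<le> (LINT x|M. \<bar>s - t\<bar> * (\<bar>(u s x - u t x) / (s - t) - D x\<bar> + \<bar>D x\<bar>))"
        using i D by (intro integral_mono integrable_mult_right integrable_abs Bochner_Integration.integrable_add
            mult_left_mono abs_triangle_ineq) auto
      also have "\<dots> = \<bar>s - t\<bar> * (L1_error M u D t s + (LINT x|M. \<bar>D x\<bar>))"
        using i D unfolding L1_error_def
        by (subst Bochner_Integration.integral_add[symmetric]) auto
      finally show "(LINT x|M. \<bar>u s x - u t x\<bar>) \<le> \<bar>s - t\<bar> * (L1_error M u D t s + (LINT x|M. \<bar>D x\<bar>))" .
    qed
    show "((\<lambda>s. \<bar>s - t\<bar> * (L1_error M u D t s + (LINT x|M. \<bar>D x\<bar>))) \<longlongrightarrow> 0) (at t within {0..})"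
      using lim by simp
  qed
qed

text \<open>Pairing with \<phi> is linear and bounded by \<open>K\<close> times the L^1 norm, so it
  carries a strong derivative to an ordinary one.\<close>

lemma pairing_has_derivative:
  assumes u: "\<And>s. 0 \<le> s \<Longrightarrow> integrable (velocities n) (u s)" and D: "integrable (velocities n) D" and t: "0 \<le> t"
    and d: "has_L1_derivative (velocities n) u D t" and \<phi>: "test_function j K \<phi>" "j \<le> n"
  shows "((\<lambda>s. pairing n (u s) \<phi>) has_real_derivative pairing n D \<phi>) (at t within {0..})"
  unfolding has_field_derivative_iff
proof (rule Lim_null[THEN iffD2])
  have lim: "((\<lambda>s. K * L1_error (velocities n) u D t s) \<longlongrightarrow> K * 0) (at t within {0..})"
    using has_L1_derivative_iff_error[of "velocities n" u D t] u D t d by (intro tendsto_intros) blast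
  show "((\<lambda>s. (pairing n (u s) \<phi> - pairing n (u t) \<phi>) / (s - t) - pairing n D \<phi>) \<longlongrightarrow> 0) (at t within {0..})"
  proof (rule Lim_null_comparison)
    show "((\<lambda>s. K * L1_error (velocities n) u D t s) \<longlongrightarrow> 0) (at t within {0..})" using lim by simp
    show "\<forall>\<^sub>F s in at t within {0..}. norm ((pairing n (u s) \<phi> - pairing n (u t) \<phi>) / (s - t) - pairing n D \<phi>)
        \<le> K * L1_error (velocities n) u D t s"
      unfolding eventually_at_filter
    proof (intro always_eventually allI impI)
      fix s assume s: "s \<noteq> t" "s \<in> {0..}"
      have i_s: "integrable (velocities n) (u s)" and it: "integrable (velocities n) (u t)"
        using s t u by auto
      have "(pairing n (u s) \<phi> - pairing n (u t) \<phi>) / (s - t) - pairing n D \<phi>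
          = pairing n (\<lambda>x. (u s x - u t x) / (s - t) - D x) \<phi>"
        unfolding pairing_def left_diff_distrib times_divide_eq_left[symmetric] diff_divide_distrib
        using integrable_test[OF i_s \<phi>] integrable_test[OF it \<phi>] integrable_test[OF D \<phi>]
        by (simp add: Bochner_Integration.integral_diff)
      also have "norm \<dots> \<le> K * L1_error (velocities n) u D t s"
        unfolding L1_error_def real_norm_def
        by (rule pairing_bound[OF integrable_quotient[of "velocities n" u, OF i_s it D] \<phi>])
      finally show "norm ((pairing n (u s) \<phi> - pairing n (u t) \<phi>) / (s - t) - pairing n D \<phi>)
        \<le> K * L1_error (velocities n) u D t s" .
    qed
  qed
qed

section \<open>Tensor products and their strong derivatives\<close>

lemma lessThan_Suc_velocities: "velocities (Suc j) = Pi\<^sub>M (insert j {..<j}) (\<lambda>_. lborel)"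
  by (simp add: lessThan_Suc)

lemma measurable_update_velocities:
  "(\<lambda>p. (fst p)(j := snd p)) \<in> velocities j \<Otimes>\<^sub>M lborel \<rightarrow>\<^sub>M velocities (Suc j)"
  using measurable_add_dim[of j "{..<j}" "\<lambda>_. lborel :: velocity measure"]
  by (simp add: lessThan_Suc split_beta')

lemma local_update:
  fixes a :: "configuration \<Rightarrow> 'a"
  assumes "\<And>V. a (restrict V {..<j}) = a V" shows "a (V(j := w)) = a V"
proof -
  have "restrict (V(j := w)) {..<j} = restrict V {..<j}" by (auto simp: restrict_def fun_eq_iff)
  then show ?thesis by (metis assms)
qed

text \<open>The invariance under restriction makes \<open>a\<close> meaningful on
  \<open>j + 1\<close> velocities; splitting off coordinate \<open>j\<close> then factorises the
  integral.\<close>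

lemma tensor_integrable:
  fixes a :: "configuration \<Rightarrow> real"
  assumes a: "integrable (velocities j) a" and loc: "\<And>V. a (restrict V {..<j}) = a V"
    and g: "integrable lborel g"
  shows "integrable (velocities (Suc j)) (\<lambda>V. a V * g (V j))" (is ?i)
    and "(LINT V|velocities (Suc j). a V * g (V j)) = (LINT V|velocities j. a V) * (LINT v|lborel. g v)" (is ?e)
proof -
  have am: "a \<in> borel_measurable (velocities j)" and gm: "g \<in> borel_measurable lborel"
    using a g by auto
  have "(\<lambda>V. a (restrict V {..<j})) \<in> borel_measurable (velocities (Suc j))"
    by (rule measurable_compose[OF measurable_restrict_subset am]) auto
  then have am': "a \<in> borel_measurable (velocities (Suc j))" by (simp add: loc)
  have gm': "(\<lambda>V. g (V j)) \<in> borel_measurable (velocities (Suc j))"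
    by (rule measurable_compose[OF _ gm]) (rule measurable_component_singleton, simp)
  have m: "(\<lambda>V. ennreal (norm (a V * g (V j)))) \<in> borel_measurable (Pi\<^sub>M (insert j {..<j}) (\<lambda>_. lborel))"
    using borel_measurable_times[OF am' gm']
    by (intro measurable_compose[OF _ measurable_ennreal] measurable_compose[OF _ borel_measurable_norm])
      (simp add: lessThan_Suc)
  show i: ?i
  proof (rule integrableI_bounded)
    show "(\<lambda>V. a V * g (V j)) \<in> borel_measurable (velocities (Suc j))"
      by (rule borel_measurable_times[OF am' gm'])
    have "(\<integral>\<^sup>+V. norm (a V * g (V j)) \<partial>velocities (Suc j))
        = (\<integral>\<^sup>+V. \<integral>\<^sup>+w. ennreal (norm (a V)) * ennreal (norm (g w)) \<partial>lborel \<partial>velocities j)"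
      unfolding lessThan_Suc_velocities
      by (subst velocity_product.product_nn_integral_insert[OF _ _ m])
        (simp_all add: local_update[of a j, OF loc] abs_mult ennreal_mult)
    also have "\<dots> = (\<integral>\<^sup>+V. ennreal (norm (a V)) \<partial>velocities j) * (\<integral>\<^sup>+w. ennreal (norm (g w)) \<partial>lborel)"
      using am gm by (simp add: nn_integral_cmult nn_integral_multc)
    also have "\<dots> < \<infinity>"
      using a g by (simp add: integrable_iff_bounded ennreal_mult_less_top)
    finally show "(\<integral>\<^sup>+V. norm (a V * g (V j)) \<partial>velocities (Suc j)) < \<infinity>" .
  qed
  have "(LINT V|velocities (Suc j). a V * g (V j))
      = (LINT V|velocities j. LINT w|lborel. a (V(j := w)) * g ((V(j := w)) j))"
    unfolding lessThan_Suc_velocities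
    by (rule velocity_product.product_integral_insert) (use i in \<open>auto simp: lessThan_Suc\<close>)
  also have "\<dots> = (LINT V|velocities j. a V) * (LINT v|lborel. g v)"
    by (simp add: local_update[of a j, OF loc])
  finally show ?e .
qed

lemma L1_norm_tensor:
  fixes a :: "configuration \<Rightarrow> real"
  assumes a: "integrable (velocities j) a" and loc: "\<And>V. a (restrict V {..<j}) = a V"
    and g: "integrable lborel g"
  shows "(LINT V|velocities (Suc j). \<bar>a V * g (V j)\<bar>) = (LINT V|velocities j. \<bar>a V\<bar>) * (LINT v|lborel. \<bar>g v\<bar>)"
  using tensor_integrable(2)[of j "\<lambda>V. \<bar>a V\<bar>" "\<lambda>v. \<bar>g v\<bar>"] assms by (simp add: abs_mult)

text \<open>The product rule. The error splits into the error of \<open>a\<close> times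
  \<open>g s\<close>, \<open>A\<close> times the increment of \<open>g\<close>, and
  \<open>a t\<close> times the error of \<open>g\<close>; each L^1 norm factorises, and the middle
  one vanishes in the limit by continuity of \<open>g\<close>.\<close>

lemma has_L1_derivative_tensor:
  fixes a :: "real \<Rightarrow> configuration \<Rightarrow> real" and g :: "real \<Rightarrow> velocity \<Rightarrow> real"
  assumes a: "\<And>s. 0 \<le> s \<Longrightarrow> integrable (velocities j) (a s)" and a_loc: "\<And>s V. a s (restrict V {..<j}) = a s V"
    and A: "integrable (velocities j) A" and A_loc: "\<And>V. A (restrict V {..<j}) = A V"
    and g: "\<And>s. 0 \<le> s \<Longrightarrow> integrable lborel (g s)" and q: "integrable lborel q" and t: "0 \<le> t"
    and da: "has_L1_derivative (velocities j) a A t" and dg: "has_L1_derivative lborel g q t"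
  shows "has_L1_derivative (velocities (Suc j)) (\<lambda>s V. a s V * g s (V j)) (\<lambda>V. A V * g t (V j) + a t V * q (V j)) t"
proof -
  define e1 where "e1 = L1_error (velocities j) a A t"
  define e2 where "e2 = L1_error lborel g q t"
  define c where "c s = (LINT v|lborel. \<bar>g s v - g t v\<bar>)" for s
  define N where "N h = (LINT V|velocities j. \<bar>h V\<bar>)" for h :: "configuration \<Rightarrow> real"
  define G where "G = (LINT v|lborel. \<bar>g t v\<bar>)"
  let ?a = "\<lambda>s V. a s V * g s (V j)" and ?A = "\<lambda>V. A V * g t (V j) + a t V * q (V j)"
  let ?M = "velocities (Suc j)"
  have ia: "integrable ?M (?a s)" if "0 \<le> s" for s
    using that by (intro tensor_integrable(1) a a_loc g)
  have iA: "integrable ?M ?A"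
    using t by (intro Bochner_Integration.integrable_add tensor_integrable(1) a a_loc g A A_loc q)
  have e1: "(e1 \<longlongrightarrow> 0) (at t within {0..})"
    using da has_L1_derivative_iff_error[OF a A t] by (simp add: e1_def)
  have e2: "(e2 \<longlongrightarrow> 0) (at t within {0..})"
    using dg has_L1_derivative_iff_error[OF g q t] by (simp add: e2_def)
  have c: "(c \<longlongrightarrow> 0) (at t within {0..})"
    using has_L1_derivative_imp_continuous[OF g q t dg] by (simp add: c_def[abs_def])
  have bound: "L1_error ?M ?a ?A t s \<le> e1 s * (c s + G) + N A * c s + N (a t) * e2 s" if s: "0 \<le> s" for s
  proof -
    let ?q1 = "\<lambda>V. (a s V - a t V) / (s - t) - A V" and ?q2 = "\<lambda>v. (g s v - g t v) / (s - t) - q v"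
    have i1: "integrable (velocities j) ?q1" using s t by (intro integrable_quotient a A)
    have i2: "integrable lborel ?q2" using s t by (intro integrable_quotient g q)
    have i3: "integrable lborel (\<lambda>v. g s v - g t v)" using s t g by auto
    have l1: "?q1 (restrict V {..<j}) = ?q1 V" for V by (simp only: a_loc A_loc)
    have j1: "integrable ?M (\<lambda>V. ?q1 V * g s (V j))" by (rule tensor_integrable(1)[OF i1 l1 g[OF s]])
    have j2: "integrable ?M (\<lambda>V. A V * (g s (V j) - g t (V j)))" by (rule tensor_integrable(1)[OF A A_loc i3])
    have j3: "integrable ?M (\<lambda>V. a t V * ?q2 (V j))" by (rule tensor_integrable(1)[OF a[OF t] a_loc i2])
    have "L1_error ?M ?a ?A t s
       = (LINT V|?M. \<bar>?q1 V * g s (V j) + A V * (g s (V j) - g t (V j)) + a t V * ?q2 (V j)\<bar>)"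
      unfolding L1_error_def
      by (intro Bochner_Integration.integral_cong refl arg_cong[of _ _ abs])
        (simp add: algebra_simps add_divide_distrib diff_divide_distrib)
    also have "\<dots> \<le> (LINT V|?M. \<bar>?q1 V * g s (V j)\<bar> + \<bar>A V * (g s (V j) - g t (V j))\<bar> + \<bar>a t V * ?q2 (V j)\<bar>)"
      using j1 j2 j3 by (intro integral_mono integrable_abs Bochner_Integration.integrable_add) auto
    also have "\<dots> = (LINT V|?M. \<bar>?q1 V * g s (V j)\<bar>) + (LINT V|?M. \<bar>A V * (g s (V j) - g t (V j))\<bar>)
        + (LINT V|?M. \<bar>a t V * ?q2 (V j)\<bar>)"
      using integrable_abs[OF j1] integrable_abs[OF j2] integrable_abs[OF j3]
      by (simp only: Bochner_Integration.integral_add Bochner_Integration.integrable_add)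
    also have "\<dots> = e1 s * (LINT v|lborel. \<bar>g s v\<bar>) + N A * c s + N (a t) * e2 s"
      unfolding L1_norm_tensor[OF i1 l1 g[OF s]] L1_norm_tensor[OF A A_loc i3] L1_norm_tensor[OF a[OF t] a_loc i2]
      by (simp add: e1_def e2_def L1_error_def N_def c_def)
    also have "(LINT v|lborel. \<bar>g s v\<bar>) \<le> (LINT v|lborel. \<bar>g s v - g t v\<bar> + \<bar>g t v\<bar>)"
      using g s t by (intro integral_mono) auto
    also have "\<dots> = c s + G" unfolding c_def G_def
      using integrable_abs[OF i3] integrable_abs[OF g[OF t]] by (rule Bochner_Integration.integral_add)
    finally show ?thesis
      by (simp add: e1_def L1_error_def mult_left_mono)
  qed
  have lim: "((\<lambda>s. e1 s * (c s + G) + N A * c s + N (a t) * e2 s) \<longlongrightarrow> 0 * (0 + G) + N A * 0 + N (a t) * 0)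
      (at t within {0..})"
    by (intro tendsto_intros e1 e2 c)
  have "(L1_error ?M ?a ?A t \<longlongrightarrow> 0) (at t within {0..})"
  proof (rule tendsto_sandwich[OF _ _ tendsto_const])
    show "\<forall>\<^sub>F s in at t within {0..}. 0 \<le> L1_error ?M ?a ?A t s" by (simp add: L1_error_def)
    show "\<forall>\<^sub>F s in at t within {0..}. L1_error ?M ?a ?A t s \<le> e1 s * (c s + G) + N A * c s + N (a t) * e2 s"
      unfolding eventually_at_filter by (auto simp: bound)
    show "((\<lambda>s. e1 s * (c s + G) + N A * c s + N (a t) * e2 s) \<longlongrightarrow> 0) (at t within {0..})"
      using lim by simp
  qed
  then show ?thesis using has_L1_derivative_iff_error[of ?M ?a ?A t] ia iA t by blast
qed

text \<open>The Leibniz formula, where \<open>q\<close> stands for the time derivative of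
  \<open>f\<close> and replaces one factor at a time.\<close>

definition tensor_derivative ::
  "nat \<Rightarrow> (velocity \<Rightarrow> real) \<Rightarrow> (velocity \<Rightarrow> real) \<Rightarrow> configuration \<Rightarrow> real" where
  "tensor_derivative j f q V = (\<Sum>i<j. (\<Prod>k\<in>{..<j} - {i}. f (V k)) * q (V i))"

lemma tensor_power_Suc: "tensor_power (Suc j) f V = tensor_power j f V * f (V j)"
  by (simp add: tensor_power_def)

lemma tensor_power_restrict: "tensor_power j f (restrict V {..<j}) = tensor_power j f V"
  by (simp add: tensor_power_def)

lemma tensor_derivative_restrict: "tensor_derivative j f q (restrict V {..<j}) = tensor_derivative j f q V"
  by (simp add: tensor_derivative_def)

lemma tensor_derivative_Suc:
  "tensor_derivative (Suc j) f q V = tensor_derivative j f q V * f (V j) + tensor_power j f V * q (V j)"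
proof -
  have 1: "{..<Suc j} - {j} = {..<j}" by auto
  have 2: "(\<Prod>k\<in>{..<Suc j} - {i}. f (V k)) = (\<Prod>k\<in>{..<j} - {i}. f (V k)) * f (V j)" if "i < j" for i
  proof -
    have "{..<Suc j} - {i} = insert j ({..<j} - {i})" using that by auto
    then show ?thesis by (simp add: mult.commute)
  qed
  have "tensor_derivative (Suc j) f q V
     = (\<Sum>i<j. (\<Prod>k\<in>{..<j} - {i}. f (V k)) * f (V j) * q (V i)) + tensor_power j f V * q (V j)"
    unfolding tensor_derivative_def tensor_power_def by (simp add: 1 2)
  also have "(\<Sum>i<j. (\<Prod>k\<in>{..<j} - {i}. f (V k)) * f (V j) * q (V i)) = tensor_derivative j f q V * f (V j)"
    unfolding tensor_derivative_def sum_distrib_right by (simp add: mult_ac)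
  finally show ?thesis .
qed

lemma integrable_tensor_power: "integrable lborel f \<Longrightarrow> integrable (velocities j) (tensor_power j f)"
  unfolding tensor_power_def[abs_def] by (rule velocity_product.product_integrable_prod) auto

lemma integral_tensor_power:
  "integrable lborel f \<Longrightarrow> (LINT V|velocities j. tensor_power j f V) = (LINT v|lborel. f v) ^ j"
  unfolding tensor_power_def[abs_def] by (subst velocity_product.product_integral_prod) auto

lemma L1_norm_tensor_power:
  "integrable lborel f \<Longrightarrow> (LINT V|velocities j. \<bar>tensor_power j f V\<bar>) = (LINT v|lborel. \<bar>f v\<bar>) ^ j"
  using integral_tensor_power[of "\<lambda>v. \<bar>f v\<bar>" j] by (simp add: tensor_power_def abs_prod)

lemma integrable_tensor_derivative:
  assumes "integrable lborel f" "integrable lborel q"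
  shows "integrable (velocities j) (tensor_derivative j f q)"
proof (induction j)
  case 0
  show ?case by (simp add: tensor_derivative_def[abs_def])
next
  case (Suc j)
  show ?case
    unfolding tensor_derivative_Suc[abs_def]
    by (intro Bochner_Integration.integrable_add tensor_integrable(1) Suc integrable_tensor_power assms
        tensor_derivative_restrict tensor_power_restrict)
qed

lemma has_L1_derivative_tensor_power:
  assumes f: "\<And>s. 0 \<le> s \<Longrightarrow> integrable lborel (f s)" and q: "integrable lborel q"
    and t: "0 \<le> t" and d: "has_L1_derivative lborel f q t"
  shows "has_L1_derivative (velocities j) (\<lambda>s. tensor_power j (f s)) (tensor_derivative j (f t) q) t"
proof (induction j)
  case 0
  show ?case by (simp add: tensor_derivative_def tensor_power_def has_L1_derivative_def)
next
  case (Suc j)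
  show ?case
    unfolding tensor_derivative_Suc[abs_def] tensor_power_Suc[abs_def]
    by (rule has_L1_derivative_tensor) (intro Suc f q t d integrable_tensor_power integrable_tensor_derivative
        tensor_derivative_restrict tensor_power_restrict; assumption)+
qed

subsection \<open>Weak form of the hierarchies\<close>

text \<open>Fubini for the last coordinate. Where a section fails to be integrable its integral is
  0, so the bound by the integral of the norm holds at every point.\<close>

lemma integrable_partial_integral:
  fixes G :: "configuration \<Rightarrow> real"
  assumes G: "integrable (velocities (Suc j)) G"
  shows "integrable (velocities j) (\<lambda>V. LINT w|lborel. G (V(j := w)))"
proof (rule integrableI_bounded)
  have Gm: "G \<in> borel_measurable (velocities (Suc j))" using G by auto
  have "(\<lambda>(V, w). G (V(j := w))) \<in> borel_measurable (velocities j \<Otimes>\<^sub>M lborel)"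
    using measurable_compose[OF measurable_update_velocities Gm] by (simp only: split_beta')
  then show "(\<lambda>V. LINT w|lborel. G (V(j := w))) \<in> borel_measurable (velocities j)"
    by (rule lborel.borel_measurable_lebesgue_integral)
  have m: "(\<lambda>V. ennreal (norm (G V))) \<in> borel_measurable (Pi\<^sub>M (insert j {..<j}) (\<lambda>_. lborel))"
    using measurable_compose[OF measurable_compose[OF Gm borel_measurable_norm] measurable_ennreal]
    by (simp only: lessThan_Suc)
  have "(\<integral>\<^sup>+V. norm (LINT w|lborel. G (V(j := w))) \<partial>velocities j)
      \<le> (\<integral>\<^sup>+V. \<integral>\<^sup>+w. norm (G (V(j := w))) \<partial>lborel \<partial>velocities j)"
  proof (rule nn_integral_mono)
    fix V show "ennreal (norm (LINT w|lborel. G (V(j := w)))) \<le> (\<integral>\<^sup>+w. norm (G (V(j := w))) \<partial>lborel)"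
      by (cases "integrable lborel (\<lambda>w. G (V(j := w)))")
        (simp_all add: integral_norm_bound_ennreal not_integrable_integral_eq del: real_norm_def)
  qed
  also have "\<dots> = (\<integral>\<^sup>+V. norm (G V) \<partial>velocities (Suc j))"
    unfolding lessThan_Suc_velocities
    by (rule velocity_product.product_nn_integral_insert[OF _ _ m, symmetric]) auto
  also have "\<dots> < \<infinity>" using G by (simp add: integrable_iff_bounded)
  finally show "(\<integral>\<^sup>+V. norm (LINT w|lborel. G (V(j := w))) \<partial>velocities j) < \<infinity>" .
qed

lemma pairing_partial_integral:
  assumes G: "integrable (velocities (Suc j)) G" and \<phi>: "test_function j K \<phi>"
  shows "pairing j (\<lambda>V. LINT w|lborel. G (V(j := w))) \<phi> = pairing (Suc j) G \<phi>"
proof -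
  have u: "\<phi> (V(j := w)) = \<phi> V" for V w
    by (rule test_function_cong[OF \<phi>]) auto
  have "pairing (Suc j) G \<phi> = (LINT V|velocities j. LINT w|lborel. G (V(j := w)) * \<phi> (V(j := w)))"
    unfolding pairing_def lessThan_Suc_velocities
    by (rule velocity_product.product_integral_insert)
      (use integrable_test[OF G \<phi>] in \<open>auto simp: lessThan_Suc\<close>)
  then show ?thesis by (simp add: u pairing_def)
qed

lemma sum_lessThan_split:
  fixes g :: "nat \<Rightarrow> 'a :: comm_monoid_add"
  assumes "j \<le> n"
  shows "(\<Sum>k<n. g k) = (\<Sum>k<j. g k) + (\<Sum>k\<in>{j..<n}. g k)"
  using sum.atLeastLessThan_concat[of 0 j n g] assms by (simp add: atLeast0LessThan)

section \<open>Invariance under relabelling of particles\<close>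

lemma measurable_permute:
  assumes "\<pi> permutes {..<n}"
  shows "(\<lambda>V. V \<circ> \<pi>) \<in> velocities n \<rightarrow>\<^sub>M velocities n"
proof (rule measurable_PiM_single')
  fix l assume "l \<in> {..<n}"
  then have "\<pi> l \<in> {..<n}" using assms by (meson permutes_in_image)
  then show "(\<lambda>V. (V \<circ> \<pi>) l) \<in> velocities n \<rightarrow>\<^sub>M lborel"
    unfolding comp_def by (rule measurable_component_singleton)
next
  show "(\<lambda>V. V \<circ> \<pi>) \<in> space (velocities n) \<rightarrow> (\<Pi>\<^sub>E l\<in>{..<n}. space lborel)"
    using permutes_not_in[OF assms] by (auto simp: space_PiM PiE_def extensional_def)
qed

text \<open>A product measure is determined by rectangles, and relabelling only permutes the factors
  in the measure of a rectangle.\<close>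

lemma distr_permute:
  assumes \<pi>: "\<pi> permutes {..<n}"
  shows "distr (velocities n) (velocities n) (\<lambda>V. V \<circ> \<pi>) = velocities n"
proof (rule velocity_product.PiM_eqI)
  fix A :: "nat \<Rightarrow> velocity set"
  assume A: "\<And>i. i \<in> {..<n} \<Longrightarrow> A i \<in> sets lborel"
  have inv: "inv \<pi> permutes {..<n}" using \<pi> by (rule permutes_inv)
  have A': "A (inv \<pi> i) \<in> sets lborel" if "i \<in> {..<n}" for i
    using A[of "inv \<pi> i"] that permutes_in_image[OF inv] by blast
  have "emeasure (distr (velocities n) (velocities n) (\<lambda>V. V \<circ> \<pi>)) (Pi\<^sub>E {..<n} A)
      = emeasure (velocities n) ((\<lambda>V. V \<circ> \<pi>) -` Pi\<^sub>E {..<n} A \<inter> space (velocities n))"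
    using A by (intro emeasure_distr measurable_permute[OF \<pi>] sets_PiM_I_finite) auto
  also have "(\<lambda>V. V \<circ> \<pi>) -` Pi\<^sub>E {..<n} A \<inter> space (velocities n) = Pi\<^sub>E {..<n} (\<lambda>i. A (inv \<pi> i))"
  proof (intro equalityI subsetI)
    fix V assume V: "V \<in> (\<lambda>V. V \<circ> \<pi>) -` Pi\<^sub>E {..<n} A \<inter> space (velocities n)"
    then have "V i \<in> A (inv \<pi> i)" if "i \<in> {..<n}" for i
    proof -
      have "inv \<pi> i \<in> {..<n}" using that permutes_in_image[OF inv] by blast
      then have "(V \<circ> \<pi>) (inv \<pi> i) \<in> A (inv \<pi> i)" using V by (auto simp: PiE_def Pi_def)
      then show ?thesis using permutes_inverses(1)[OF \<pi>] by simp
    qed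
    then show "V \<in> Pi\<^sub>E {..<n} (\<lambda>i. A (inv \<pi> i))"
      using V by (auto simp: space_PiM PiE_def)
  next
    fix V assume V: "V \<in> Pi\<^sub>E {..<n} (\<lambda>i. A (inv \<pi> i))"
    have "V (\<pi> i) \<in> A i" if "i \<in> {..<n}" for i
    proof -
      have "\<pi> i \<in> {..<n}" using that permutes_in_image[OF \<pi>] by blast
      then have "V (\<pi> i) \<in> A (inv \<pi> (\<pi> i))" using V by (auto simp: PiE_def Pi_def)
      then show ?thesis using permutes_inverses(2)[OF \<pi>] by simp
    qed
    moreover have "V \<in> extensional {..<n}" using V by (simp add: PiE_def)
    ultimately show "V \<in> (\<lambda>V. V \<circ> \<pi>) -` Pi\<^sub>E {..<n} A \<inter> space (velocities n)"
      using permutes_not_in[OF \<pi>] by (auto simp: space_PiM PiE_def extensional_def)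
  qed
  also have "emeasure (velocities n) (Pi\<^sub>E {..<n} (\<lambda>i. A (inv \<pi> i))) = (\<Prod>i<n. emeasure lborel (A (inv \<pi> i)))"
    using A' by (intro velocity_product.emeasure_PiM) auto
  also have "\<dots> = (\<Prod>i<n. emeasure lborel (A i))"
    using prod.permute[OF inv, of "\<lambda>i. emeasure lborel (A i)"] by (simp add: comp_def)
  finally show "emeasure (distr (velocities n) (velocities n) (\<lambda>V. V \<circ> \<pi>)) (Pi\<^sub>E {..<n} A)
      = (\<Prod>i<n. emeasure lborel (A i))" .
qed simp_all

lemma pairing_permute:
  assumes \<pi>: "\<pi> permutes {..<n}" and u: "integrable (velocities n) u"
    and sym: "AE V in velocities n. u (V \<circ> \<pi>) = u V"
    and \<phi>: "\<phi> \<in> borel_measurable (velocities n)"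
  shows "pairing n u (\<lambda>V. \<phi> (V \<circ> \<pi>)) = pairing n u \<phi>"
proof -
  have um: "u \<in> borel_measurable (velocities n)" using u by auto
  note \<phi>p = measurable_compose[OF measurable_permute[OF \<pi>] \<phi>] and up = measurable_compose[OF measurable_permute[OF \<pi>] um]
  have "pairing n u \<phi> = (LINT V|distr (velocities n) (velocities n) (\<lambda>V. V \<circ> \<pi>). u V * \<phi> V)"
    by (simp add: distr_permute[OF \<pi>] pairing_def)
  also have "\<dots> = (LINT V|velocities n. u (V \<circ> \<pi>) * \<phi> (V \<circ> \<pi>))"
    by (intro integral_distr measurable_permute[OF \<pi>] borel_measurable_times um \<phi>)
  also have "\<dots> = pairing n u (\<lambda>V. \<phi> (V \<circ> \<pi>))"
    unfolding pairing_def using sym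
    by (intro integral_cong_AE borel_measurable_times um up \<phi>p) auto
  finally show ?thesis by simp
qed

section \<open>Dual hierarchies for tensor powers and for the Kac evolution\<close>

context bounded_kernel
begin

text \<open>The formal adjoint of the operator C_{j+1} of the hierarchy: each of the particles 0,
  ..., j - 1 collides with an additional one, which carries the index \<open>j\<close>.\<close>

definition collision_adjoint :: "nat \<Rightarrow> (configuration \<Rightarrow> real) \<Rightarrow> configuration \<Rightarrow> real" where
  "collision_adjoint j \<phi> V = (\<Sum>i<j. T_pair B i j \<phi> V)"

lemma test_function_collision_adjoint:
  assumes "test_function j K \<phi>"
  shows "test_function (Suc j) (real j * (2 * rate * K)) (collision_adjoint j \<phi>)"
proof -
  have "test_function (Suc j) K \<phi>" using assms by (rule test_function_mono_dim) simp
  from test_function_sum[OF finite_lessThan test_function_T_pair[OF this], of j "\<lambda>i. i" "\<lambda>_. j"]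
  show ?thesis by (simp add: collision_adjoint_def[abs_def])
qed

text \<open>The completed gain costs only \<open>rate * K\<close> per pair, without the factor 2 of
  the bare operator. This constant is what lets a damping with rate \<open>rate * j\<close> balance
  the gain to leading order in \<open>j\<close>.\<close>

lemma test_function_collision_gain:
  assumes "test_function j K \<phi>"
  shows "test_function (Suc j) (real j * (rate * K)) (\<lambda>V. collision_adjoint j \<phi> V + rate * j * \<phi> V)"
proof -
  have \<phi>: "test_function (Suc j) K \<phi>" using assms by (rule test_function_mono_dim) simp
  have "test_function (Suc j) (rate * K) (\<lambda>V. T_pair B i j \<phi> V + rate * \<phi> V)" if "i < j" for i
    using test_function_add[OF test_function_T_pair[OF \<phi> that lessI] test_function_cmult[OF \<phi>, of rate]]
      T_pair_gain_bound[of \<phi> K i j, OF test_function_bound[OF \<phi>]]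
    by (simp add: test_function_def)
  from test_function_sum[OF finite_lessThan this, of j "\<lambda>i. i"]
  show ?thesis by (simp add: collision_adjoint_def[abs_def] sum.distrib mult_ac)
qed

text \<open>A collision of particles \<open>i\<close> and \<open>j\<close> leaves the other factors
  alone; what remains is the inner integral of the Boltzmann operator at velocity
  \<open>V i\<close>.\<close>

lemma T_pair_tensor_power:
  assumes "i < j"
  shows "T_pair B i j (tensor_power (Suc j) f) (V(j := w)) =
    (\<Prod>k\<in>{..<j} - {i}. f (V k)) *
    (LINT \<omega>|sphere_measure. B \<omega> (V i - w) * (f (outgoing1 \<omega> (V i) w) * f (outgoing2 \<omega> (V i) w) - f (V i) * f w))"
proof -
  have split: "tensor_power (Suc j) f X = (\<Prod>k\<in>{..<j} - {i}. f (X k)) * (f (X i) * f (X j))" for X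
  proof -
    have "tensor_power j f X = f (X i) * (\<Prod>k\<in>{..<j} - {i}. f (X k))"
      unfolding tensor_power_def using assms by (intro prod.remove) auto
    then show ?thesis by (simp add: tensor_power_Suc)
  qed
  have P: "(\<Prod>k\<in>{..<j} - {i}. f (X k)) = (\<Prod>k\<in>{..<j} - {i}. f (V k))"
    if "\<And>k. k < j \<Longrightarrow> k \<noteq> i \<Longrightarrow> X k = V k" for X
    using that by (intro prod.cong) auto
  have 1: "tensor_power (Suc j) f (collide \<omega> i j (V(j := w)))
      = (\<Prod>k\<in>{..<j} - {i}. f (V k)) * (f (outgoing1 \<omega> (V i) w) * f (outgoing2 \<omega> (V i) w))" for \<omega>
    unfolding split using assms by (subst P) (auto simp: collide_def)
  have 2: "tensor_power (Suc j) f (V(j := w)) = (\<Prod>k\<in>{..<j} - {i}. f (V k)) * (f (V i) * f w)"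
    unfolding split using assms by (subst P) auto
  show ?thesis
    unfolding T_pair_def 1 2 using assms
    by (subst Bochner_Integration.integral_mult_right_zero[symmetric])
      (simp add: right_diff_distrib mult.left_commute)
qed

lemma partial_integral_T_pair_tensor_power:
  assumes "i < j"
  shows "(LINT w|lborel. T_pair B i j (tensor_power (Suc j) f) (V(j := w)))
    = (\<Prod>k\<in>{..<j} - {i}. f (V k)) * boltzmann_operator B f (V i)"
  unfolding T_pair_tensor_power[OF assms] boltzmann_operator_def by simp

text \<open>For one particle, the partial integral of \<open>T_pair\<close> applied to the tensor
  square is the Boltzmann operator. Integrability is thus inherited from \<open>T_pair\<close> and
  only has to be carried from the one-fold product to \<open>lborel\<close>.\<close>

lemma integrable_boltzmann_operator:
  assumes f: "integrable lborel f"
  shows "integrable lborel (boltzmann_operator B f)"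
proof -
  have "integrable (velocities (Suc 1)) (T_pair B 0 1 (tensor_power (Suc 1) f))"
    by (intro integrable_T_pair integrable_tensor_power f) auto
  from integrable_partial_integral[OF this]
  have "integrable (velocities 1) (\<lambda>V. LINT w|lborel. T_pair B 0 1 (tensor_power (Suc 1) f) (V(1 := w)))" .
  moreover have "(LINT w|lborel. T_pair B 0 1 (tensor_power (Suc 1) f) (V(1 := w))) = boltzmann_operator B f (V 0)" for V
    using partial_integral_T_pair_tensor_power[of 0 "Suc 0" f V] by (simp add: lessThan_Suc)
  ultimately have i: "integrable (velocities 1) (\<lambda>V. boltzmann_operator B f (V 0))"
    by (simp only:)
  have v: "velocities 1 = Pi\<^sub>M {0} (\<lambda>_. lborel)" by (simp add: lessThan_Suc)
  have "(\<lambda>v. \<lambda>_\<in>{0}. v) \<in> lborel \<rightarrow>\<^sub>M Pi\<^sub>M {0 :: nat} (\<lambda>_. lborel :: velocity measure)"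
    by (intro measurable_restrict) auto
  from measurable_compose[OF this, of "\<lambda>V. boltzmann_operator B f (V 0)" borel] i
  have m: "boltzmann_operator B f \<in> borel_measurable lborel"
    unfolding v by (simp add: borel_measurable_integrable)
  have "integrable (distr (Pi\<^sub>M {0 :: nat} (\<lambda>_. lborel)) lborel (\<lambda>V. V 0)) (boltzmann_operator B f)"
    by (subst integrable_distr_eq[OF _ m]) (use i[unfolded v] in auto)
  then show ?thesis by (simp only: velocity_product.distr_singleton)
qed

text \<open>The derivative of a tensor power is the partial integral of the collisions of all
  \<open>i < j\<close> with particle \<open>j\<close>; self-adjointness moves these collisions onto
  \<phi>.\<close>

lemma pairing_tensor_derivative:
  assumes f: "integrable lborel f" and \<phi>: "test_function j K \<phi>"
  shows "pairing j (tensor_derivative j f (boltzmann_operator B f)) \<phi>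
    = pairing (Suc j) (tensor_power (Suc j) f) (collision_adjoint j \<phi>)"
proof -
  have \<phi>': "test_function (Suc j) K \<phi>" using \<phi> by (rule test_function_mono_dim) simp
  have F: "integrable (velocities (Suc j)) (tensor_power (Suc j) f)" using f by (rule integrable_tensor_power)
  have TF: "integrable (velocities (Suc j)) (T_pair B i j (tensor_power (Suc j) f))" if "i < j" for i
    by (rule integrable_T_pair[OF that lessI F])
  let ?G = "\<lambda>i V. LINT w|lborel. T_pair B i j (tensor_power (Suc j) f) (V(j := w))"
  have iG: "integrable (velocities j) (\<lambda>V. ?G i V * \<phi> V)" if "i < j" for i
    by (rule integrable_test[OF integrable_partial_integral[OF TF[OF that]] \<phi>]) simp
  have "pairing j (tensor_derivative j f (boltzmann_operator B f)) \<phi>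
      = (LINT V|velocities j. (\<Sum>i<j. ?G i V * \<phi> V))"
    unfolding pairing_def tensor_derivative_def sum_distrib_right
    by (intro Bochner_Integration.integral_cong refl sum.cong) (simp add: partial_integral_T_pair_tensor_power)
  also have "\<dots> = (\<Sum>i<j. pairing j (?G i) \<phi>)"
    unfolding pairing_def by (rule Bochner_Integration.integral_sum) (simp add: iG)
  also have "\<dots> = (\<Sum>i<j. pairing (Suc j) (tensor_power (Suc j) f) (T_pair B i j \<phi>))"
    by (intro sum.cong refl) (simp add: pairing_partial_integral[OF TF \<phi>] T_pair_adjoint[OF _ lessI F \<phi>'])
  also have "\<dots> = pairing (Suc j) (tensor_power (Suc j) f) (collision_adjoint j \<phi>)"
    unfolding collision_adjoint_def[abs_def]
    by (rule pairing_sum[symmetric, OF F test_function_T_pair[OF \<phi>' _ lessI]]) auto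
  finally show ?thesis .
qed

lemma boltzmann_tensor_derivative:
  assumes f: "boltzmann_solution B f0 f" and t: "0 \<le> t" and \<phi>: "test_function j K \<phi>"
  shows "((\<lambda>s. pairing j (tensor_power j (f s)) \<phi>) has_real_derivative
    pairing (Suc j) (tensor_power (Suc j) (f t)) (collision_adjoint j \<phi>)) (at t within {0..})"
proof -
  have i: "integrable lborel (f s)" if "0 \<le> s" for s
    using f that by (simp add: boltzmann_solution_def)
  have d: "has_L1_derivative lborel f (boltzmann_operator B (f t)) t"
    using f t by (simp add: boltzmann_solution_def)
  have "((\<lambda>s. pairing j (tensor_power j (f s)) \<phi>) has_real_derivative
    pairing j (tensor_derivative j (f t) (boltzmann_operator B (f t))) \<phi>) (at t within {0..})"
    by (rule pairing_has_derivative[OF _ _ t _ \<phi> order_refl])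
      (intro integrable_tensor_power integrable_tensor_derivative integrable_boltzmann_operator i t
        has_L1_derivative_tensor_power d; assumption)+
  then show ?thesis by (simp add: pairing_tensor_derivative[OF i[OF t] \<phi>])
qed

lemma integrable_T_op:
  assumes "integrable (velocities n) u" shows "integrable (velocities n) (T_op B n u)"
  unfolding T_op_def[abs_def]
  by (intro Bochner_Integration.integrable_sum integrable_T_pair assms) auto

lemma T_pair_eq_0:
  assumes "test_function j K \<phi>" "j \<le> i" "j \<le> k" shows "T_pair B i k \<phi> V = 0"
proof -
  have "\<phi> (collide \<omega> i k V) = \<phi> V" for \<omega>
    by (rule test_function_cong[OF assms(1)]) (use assms in \<open>auto simp: collide_def\<close>)
  then show ?thesis by (simp add: T_pair_def)
qed

text \<open>Transposing \<open>j\<close> and \<open>k\<close> replaces one collision partner that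
  \<phi> does not see by another, and the symmetry of \<open>u\<close> makes the pairing blind to
  this.\<close>

lemma pairing_T_pair_exchangeable:
  assumes u: "integrable (velocities n) u"
    and sym: "\<And>\<pi>. \<pi> permutes {..<n} \<Longrightarrow> AE V in velocities n. u (V \<circ> \<pi>) = u V"
    and \<phi>: "test_function j K \<phi>" and ijk: "i < j" "j \<le> k" "k < n"
  shows "pairing n u (T_pair B i k \<phi>) = pairing n u (T_pair B i j \<phi>)"
proof -
  let ?\<pi> = "Transposition.transpose j k"
  have \<pi>: "?\<pi> permutes {..<n}" using ijk by (intro permutes_swap_id) auto
  have \<phi>n: "test_function n K \<phi>" by (rule test_function_mono_dim[OF \<phi>]) (use ijk in simp)
  have c: "\<phi> (collide \<omega> i j (V \<circ> ?\<pi>)) = \<phi> (collide \<omega> i k V)" for \<omega> V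
    by (rule test_function_cong[OF \<phi>]) (use ijk in \<open>auto simp: collide_def transpose_def\<close>)
  have "\<phi> (V \<circ> ?\<pi>) = \<phi> V" for V
    by (rule test_function_cong[OF \<phi>]) (use ijk in \<open>auto simp: transpose_def\<close>)
  then have "T_pair B i j \<phi> (V \<circ> ?\<pi>) = T_pair B i k \<phi> V" for V
    unfolding T_pair_def c using ijk by (simp add: transpose_def)
  then have "pairing n u (T_pair B i k \<phi>) = pairing n u (\<lambda>V. T_pair B i j \<phi> (V \<circ> ?\<pi>))" by simp
  also have "\<dots> = pairing n u (T_pair B i j \<phi>)"
    using ijk by (intro pairing_permute[OF \<pi> u sym[OF \<pi>]] T_pair_measurable test_function_measurable[OF \<phi>n]) auto
  finally show ?thesis .
qed

text \<open>Pairs are classified by how many of their particles \<phi> sees. Inner pairs give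
  \<open>T_op B j\<close>; for mixed pairs each inner particle has \<open>n - j\<close> partners,
  all equivalent by exchangeability; outer pairs leave \<phi> unchanged and give 0.\<close>

lemma pairing_T_op:
  assumes u: "integrable (velocities n) u"
    and sym: "\<And>\<pi>. \<pi> permutes {..<n} \<Longrightarrow> AE V in velocities n. u (V \<circ> \<pi>) = u V"
    and \<phi>: "test_function j K \<phi>" and jn: "j \<le> n"
  shows "pairing n (T_op B n u) \<phi>
    = pairing n u (T_op B j \<phi>) + real (n - j) * pairing n u (collision_adjoint j \<phi>)"
proof -
  have \<phi>n: "test_function n K \<phi>" by (rule test_function_mono_dim[OF \<phi> jn])
  have tT: "test_function n (2 * rate * K) (T_pair B i k \<phi>)" if "i < k" "k < n" for i k
    using that by (rule test_function_T_pair[OF \<phi>n])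
  have T: "integrable (velocities n) (T_pair B i k u)" if "i < k" "k < n" for i k
    using that u by (rule integrable_T_pair)
  have "pairing n (T_op B n u) \<phi> = (LINT V|velocities n. (\<Sum>k<n. \<Sum>i<k. T_pair B i k u V * \<phi> V))"
    by (simp add: pairing_def T_op_def sum_distrib_right)
  also have "\<dots> = (\<Sum>k<n. \<Sum>i<k. pairing n (T_pair B i k u) \<phi>)"
    unfolding pairing_def using integrable_test[OF T \<phi> jn]
    by (subst Bochner_Integration.integral_sum) (auto intro!: Bochner_Integration.integrable_sum sum.cong)
  also have "\<dots> = (\<Sum>k<n. \<Sum>i<k. pairing n u (T_pair B i k \<phi>))"
    by (intro sum.cong refl) (simp add: T_pair_adjoint[OF _ _ u \<phi>n])
  also have "\<dots> = (\<Sum>k<j. \<Sum>i<k. pairing n u (T_pair B i k \<phi>)) + (\<Sum>k\<in>{j..<n}. \<Sum>i<k. pairing n u (T_pair B i k \<phi>))"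
    by (rule sum_lessThan_split[OF jn])
  also have "(\<Sum>k<j. \<Sum>i<k. pairing n u (T_pair B i k \<phi>))
      = (\<Sum>k<j. pairing n u (\<lambda>V. \<Sum>i<k. T_pair B i k \<phi> V))"
    by (intro sum.cong refl pairing_sum[symmetric, OF u tT order_refl]) (use jn in auto)
  also have "\<dots> = pairing n u (T_op B j \<phi>)"
    unfolding T_op_def[abs_def]
    by (rule pairing_sum[symmetric, OF u test_function_sum[OF finite_lessThan tT] order_refl]) (use jn in auto)
  also have "(\<Sum>k\<in>{j..<n}. \<Sum>i<k. pairing n u (T_pair B i k \<phi>)) = (\<Sum>k\<in>{j..<n}. pairing n u (collision_adjoint j \<phi>))"
  proof (rule sum.cong[OF refl])
    fix k assume k: "k \<in> {j..<n}"
    have "(\<Sum>i<k. pairing n u (T_pair B i k \<phi>)) = (\<Sum>i<j. pairing n u (T_pair B i k \<phi>))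
        + (\<Sum>i\<in>{j..<k}. pairing n u (T_pair B i k \<phi>))"
      by (rule sum_lessThan_split) (use k in simp)
    also have "(\<Sum>i\<in>{j..<k}. pairing n u (T_pair B i k \<phi>)) = 0"
      using k T_pair_eq_0[OF \<phi>] by (intro sum.neutral) (auto simp: pairing_def)
    also have "(\<Sum>i<j. pairing n u (T_pair B i k \<phi>)) = (\<Sum>i<j. pairing n u (T_pair B i j \<phi>))"
      using k by (intro sum.cong refl pairing_T_pair_exchangeable[OF u sym \<phi>]) auto
    also have "\<dots> = pairing n u (collision_adjoint j \<phi>)"
      unfolding collision_adjoint_def[abs_def] using k
      by (intro pairing_sum[symmetric, OF u tT]) auto
    finally show "(\<Sum>i<k. pairing n u (T_pair B i k \<phi>)) = pairing n u (collision_adjoint j \<phi>)" by simp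
  qed
  finally show ?thesis by simp
qed

lemma kac_pairing_derivative:
  assumes W: "kac_evolution B \<mu> W" and t: "0 \<le> t" and \<phi>: "test_function j K \<phi>" and jn: "j \<le> n"
  shows "((\<lambda>s. pairing n (W s n) \<phi>) has_real_derivative
    (pairing n (W t n) (T_op B j \<phi>) + real (n - j) * pairing n (W t n) (collision_adjoint j \<phi>)) / \<mu>)
    (at t within {0..})"
proof -
  have i: "integrable (velocities n) (W s n)" if "0 \<le> s" for s
    using W that by (simp add: kac_evolution_def grand_canonical_state_def)
  have sym: "AE V in velocities n. W t n (V \<circ> \<pi>) = W t n V" if "\<pi> permutes {..<n}" for \<pi>
    using W t that by (simp add: kac_evolution_def grand_canonical_state_def)
  have d: "has_L1_derivative (velocities n) (\<lambda>s. W s n) (\<lambda>V. (1 / \<mu>) * T_op B n (W t n) V) t"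
    using W t by (simp add: kac_evolution_def)
  have "((\<lambda>s. pairing n (W s n) \<phi>) has_real_derivative
      pairing n (\<lambda>V. (1 / \<mu>) * T_op B n (W t n) V) \<phi>) (at t within {0..})"
    by (rule pairing_has_derivative[OF i _ t d \<phi> jn])
      ((intro integrable_mult_right integrable_T_op i t | assumption)+)
  also have "pairing n (\<lambda>V. (1 / \<mu>) * T_op B n (W t n) V) \<phi> = pairing n (T_op B n (W t n)) \<phi> / \<mu>"
    by (simp add: pairing_def)
  finally show ?thesis by (simp only: pairing_T_op[OF i[OF t] sym \<phi> jn])
qed

text \<open>Each of the \<open>j * (j - 1) / 2\<close> pairs contributes at most
  \<open>2 * rate * K\<close>; this count sets the quadratic order of the source term.\<close>

lemma test_function_T_op:
  assumes "test_function j K \<phi>"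
  shows "test_function j (rate * (real j)\<^sup>2 * K) (T_op B j \<phi>)"
proof -
  have "test_function j (\<Sum>k<j. \<Sum>i<k. 2 * rate * K) (T_op B j \<phi>)"
    unfolding T_op_def[abs_def]
    by (intro test_function_sum finite_lessThan test_function_T_pair[OF assms]) auto
  moreover have "(\<Sum>k<j. \<Sum>i<k. 2 * rate * K) \<le> rate * (real j)\<^sup>2 * K"
  proof -
    have K: "0 \<le> K" using test_function_bound[OF assms, of undefined] by linarith
    have "(\<Sum>k<m. 2 * real k) = real m * (real m - 1)" for m
      by (induction m) (simp_all add: algebra_simps)
    then have "(\<Sum>k<j. \<Sum>i<k. 2 * rate * K) = rate * K * (real j * (real j - 1))"
      by (simp add: sum_distrib_left[symmetric] sum_distrib_right[symmetric] mult_ac)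
    also have "\<dots> \<le> rate * K * (real j * real j)"
      using K rate_nonneg by (intro mult_left_mono) auto
    finally show ?thesis by (simp add: power2_eq_square mult_ac)
  qed
  ultimately show ?thesis by (rule test_function_mono)
qed

end

subsection \<open>The Boltzmann flow\<close>

text \<open>Comparison by an integrating factor: \<open>exp (a * r) * (\<psi> r - x r)\<close>
  starts nonnegative and does not decrease. Conservation laws and error bounds are deduced from it
  by exhibiting a supersolution \<psi>.\<close>

lemma linear_ode_upper_bound:
  fixes x p \<psi> \<psi>' :: "real \<Rightarrow> real"
  assumes s: "0 \<le> s"
    and x: "\<And>r. 0 \<le> r \<Longrightarrow> r \<le> s \<Longrightarrow> (x has_real_derivative p r - a * x r) (at r within {0..})"
    and \<psi>: "\<And>r. 0 \<le> r \<Longrightarrow> r \<le> s \<Longrightarrow> (\<psi> has_real_derivative \<psi>' r) (at r within {0..})"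
    and le: "\<And>r. 0 \<le> r \<Longrightarrow> r \<le> s \<Longrightarrow> p r \<le> \<psi>' r + a * \<psi> r"
    and init: "x 0 \<le> \<psi> 0"
  shows "x s \<le> \<psi> s"
proof -
  define g where "g r = exp (a * r) * (\<psi> r - x r)" for r
  define g' where "g' r = exp (a * r) * (\<psi>' r + a * \<psi> r - p r)" for r
  have g: "(g has_real_derivative g' r) (at r within {0..})" if "0 \<le> r" "r \<le> s" for r
    unfolding g_def[abs_def] g'_def
    by (rule derivative_eq_intros x[OF that] \<psi>[OF that] refl | simp)+ (simp add: algebra_simps)
  have "g 0 \<le> g s"
  proof (rule DERIV_nonneg_imp_increasing_open[OF s])
    fix r assume r: "0 < r" "r < s"
    then have "at r within {0..} = at r" by (intro at_within_interior) auto
    then have "(g has_real_derivative g' r) (at r)" using g[of r] r by simp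
    moreover have "0 \<le> g' r" using le[of r] r by (simp add: g'_def)
    ultimately show "\<exists>y. (g has_real_derivative y) (at r) \<and> 0 \<le> y" by blast
  next
    show "continuous_on {0..s} g"
      by (rule DERIV_continuous_on, rule has_field_derivative_subset[OF g]) auto
  qed
  moreover have "0 \<le> g 0" using init by (simp add: g_def)
  ultimately have "0 \<le> g s" by linarith
  then show ?thesis by (simp add: g_def zero_le_mult_iff)
qed

lemma linear_ode_bound:
  fixes x p \<psi> \<psi>' :: "real \<Rightarrow> real"
  assumes s: "0 \<le> s"
    and x: "\<And>r. 0 \<le> r \<Longrightarrow> r \<le> s \<Longrightarrow> (x has_real_derivative p r - a * x r) (at r within {0..})"
    and \<psi>: "\<And>r. 0 \<le> r \<Longrightarrow> r \<le> s \<Longrightarrow> (\<psi> has_real_derivative \<psi>' r) (at r within {0..})"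
    and le: "\<And>r. 0 \<le> r \<Longrightarrow> r \<le> s \<Longrightarrow> \<bar>p r\<bar> \<le> \<psi>' r + a * \<psi> r"
    and init: "\<bar>x 0\<bar> \<le> \<psi> 0"
  shows "\<bar>x s\<bar> \<le> \<psi> s"
proof -
  have "x s \<le> \<psi> s"
    by (rule linear_ode_upper_bound[OF s x \<psi>]) (use le init in \<open>force+\<close>)
  moreover have "- x s \<le> \<psi> s"
  proof (rule linear_ode_upper_bound[OF s _ \<psi>])
    show "((\<lambda>r. - x r) has_real_derivative (- p r) - a * (- x r)) (at r within {0..})" if "0 \<le> r" "r \<le> s" for r
      using DERIV_minus[OF x[OF that]] by (simp add: algebra_simps)
  qed (use le init in \<open>force+\<close>)
  ultimately show ?thesis by (simp add: abs_le_iff)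
qed

lemma pairing_tensor_Suc:
  assumes f: "integrable lborel f" and \<phi>: "test_function j K \<phi>"
  shows "pairing (Suc j) (tensor_power (Suc j) f) \<phi> = pairing j (tensor_power j f) \<phi> * (LINT v|lborel. f v)"
proof -
  have "integrable (velocities j) (\<lambda>V. tensor_power j f V * \<phi> V)"
    by (rule integrable_test[OF integrable_tensor_power[OF f] \<phi> order_refl])
  moreover have "tensor_power j f (restrict V {..<j}) * \<phi> (restrict V {..<j}) = tensor_power j f V * \<phi> V" for V
    using \<phi> by (simp add: test_function_def tensor_power_restrict)
  ultimately show ?thesis
    using tensor_integrable(2)[of j "\<lambda>V. tensor_power j f V * \<phi> V" f] f
    by (simp add: pairing_def tensor_power_Suc mult_ac)
qed

lemma pairing_tensor_mono:
  assumes f: "integrable lborel f" "(LINT v|lborel. f v) = 1" and \<phi>: "test_function j K \<phi>" and "j \<le> n"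
  shows "pairing n (tensor_power n f) \<phi> = pairing j (tensor_power j f) \<phi>"
  using \<open>j \<le> n\<close>
proof (induction n rule: dec_induct)
  case (step m)
  then show ?case using pairing_tensor_Suc[OF f(1) test_function_mono_dim[OF \<phi> step(1)]] f(2) by simp
qed simp

text \<open>The exceptional configurations lie in a rectangle with one null side, and its measure is
  0 although all other sides are infinite.\<close>

lemma AE_velocities_component:
  assumes "AE v in lborel. P v" "i < n"
  shows "AE V in velocities n. P (V i)"
proof -
  obtain N where N: "N \<in> null_sets lborel" "{v. \<not> P v} \<subseteq> N"
    using assms(1) by (auto elim: AE_E simp: null_sets_def)
  define A where "A k = (if k = i then N else UNIV)" for k :: nat
  have A: "A k \<in> sets lborel" for k using N by (auto simp: A_def)
  have "emeasure (velocities n) (Pi\<^sub>E {..<n} A) = (\<Prod>k<n. emeasure lborel (A k))"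
    by (rule velocity_product.emeasure_PiM) (simp, rule A)
  also have "\<dots> = 0"
    using assms(2) N by (intro prod_zero bexI[of _ i]) (auto simp: A_def)
  finally have "Pi\<^sub>E {..<n} A \<in> null_sets (velocities n)"
    using A by (auto intro!: null_setsI sets_PiM_I_finite)
  moreover have "{V \<in> space (velocities n). \<not> P (V i)} \<subseteq> Pi\<^sub>E {..<n} A"
    using N(2) by (auto simp: space_PiM PiE_def A_def)
  ultimately show ?thesis by (rule AE_I')
qed

text \<open>Serves the initial condition of a solution, which holds only almost everywhere; with
  finitely many factors the exceptional set stays null.\<close>

lemma pairing_tensor_cong_AE:
  assumes f: "integrable lborel f" and g: "g \<in> borel_measurable borel" "AE v in lborel. f v = g v"
    and \<phi>: "test_function n K \<phi>"
  shows "pairing n (tensor_power n f) \<phi> = pairing n (tensor_power n g) \<phi>"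
proof -
  have g': "integrable lborel g"
    by (rule integrable_cong_AE_imp[OF f]) (use g in auto)
  have "AE V in velocities n. \<forall>i\<in>{..<n}. f (V i) = g (V i)"
    by (rule AE_finite_allI) (auto intro: AE_velocities_component[OF g(2)])
  then have "AE V in velocities n. tensor_power n f V = tensor_power n g V"
    by eventually_elim (simp add: tensor_power_def)
  then show ?thesis
    unfolding pairing_def
    using integrable_test[OF integrable_tensor_power[OF f] \<phi> order_refl]
      integrable_test[OF integrable_tensor_power[OF g'] \<phi> order_refl]
    by (intro integral_cong_AE) auto
qed

text \<open>The sign of \<open>u\<close> is the test function of bound 1 at which duality attains
  the L^1 norm.\<close>

lemma pairing_sgn:
  assumes "integrable (velocities n) u" "\<And>V. u (restrict V {..<n}) = u V"
  shows "test_function n 1 (\<lambda>V. sgn (u V))" "pairing n u (\<lambda>V. sgn (u V)) = (LINT V|velocities n. \<bar>u V\<bar>)"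
proof -
  have "u \<in> borel_measurable (velocities n)" using assms(1) by auto
  then show "test_function n 1 (\<lambda>V. sgn (u V))"
    using assms(2) by (auto simp: test_function_def sgn_if)
  show "pairing n u (\<lambda>V. sgn (u V)) = (LINT V|velocities n. \<bar>u V\<bar>)"
    unfolding pairing_def by (simp add: mult_sgn_abs abs_sgn mult.commute)
qed

lemma LIMSEQ_power_over_fact: "(\<lambda>m. x ^ m / fact m :: real) \<longlonglongrightarrow> 0"
  using summable_LIMSEQ_zero[OF summable_exp[of x]] by (simp add: divide_inverse mult.commute)

section \<open>Mass conservation and the L^1 bound for the Boltzmann solution\<close>

locale boltzmann_flow = bounded_kernel B C for B C +
  fixes f0 :: "velocity \<Rightarrow> real" and f :: "real \<Rightarrow> velocity \<Rightarrow> real"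
  assumes f0: "probability_density f0" and solution: "boltzmann_solution B f0 f"
begin

abbreviation moment :: "nat \<Rightarrow> real \<Rightarrow> (configuration \<Rightarrow> real) \<Rightarrow> real" where
  "moment j s \<phi> \<equiv> pairing j (tensor_power j (f s)) \<phi>"

lemma integrable_f: "0 \<le> s \<Longrightarrow> integrable lborel (f s)"
  using solution by (simp add: boltzmann_solution_def)

lemma integrable_f0: "integrable lborel f0" and integral_f0: "(LINT v|lborel. f0 v) = 1"
proof -
  have "f0 \<in> borel_measurable lborel" "\<And>v. 0 \<le> f0 v" "(\<integral>\<^sup>+v. ennreal (f0 v) \<partial>lborel) = ennreal 1"
    using f0 by (auto simp: probability_density_def)
  then show "integrable lborel f0" "(LINT v|lborel. f0 v) = 1"
    by (auto intro: integrableI_nn_integral_finite simp: integral_eq_nn_integral)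
qed

lemma moment_initial:
  "test_function n K \<phi> \<Longrightarrow> moment n 0 \<phi> = pairing n (tensor_power n f0) \<phi>"
  using solution f0 by (intro pairing_tensor_cong_AE integrable_f)
    (auto simp: boltzmann_solution_def probability_density_def)

lemma moment_derivative:
  assumes "0 \<le> t" "test_function j K \<phi>"
  shows "((\<lambda>s. moment j s \<phi>) has_real_derivative moment (Suc j) t (collision_adjoint j \<phi>)) (at t within {0..})"
  by (rule boltzmann_tensor_derivative[OF solution assms])

text \<open>Collisions annihilate constants, so the first moment of the function 1 has derivative 0,
  and comparison with zero data shows that it is constant.\<close>

lemma integral_f:
  assumes s: "0 \<le> s" shows "(LINT v|lborel. f s v) = 1"
proof -
  have c: "test_function 1 1 (\<lambda>_. 1)" using test_function_const[of 1 1] by simp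
  have z: "collision_adjoint 1 (\<lambda>_. 1) = (\<lambda>_. 0)"
    by (simp add: collision_adjoint_def T_pair_def fun_eq_iff)
  have m: "moment 1 r (\<lambda>_. 1) = (LINT v|lborel. f r v)" if "0 \<le> r" for r
    using integral_tensor_power[OF integrable_f[OF that], of 1] by (simp add: pairing_def)
  have "moment 1 0 (\<lambda>_. 1) = 1"
    using moment_initial[OF c] integral_tensor_power[OF integrable_f0, of 1]
    by (simp add: pairing_def integral_f0)
  moreover have "\<bar>moment 1 s (\<lambda>_. 1) - moment 1 0 (\<lambda>_. 1)\<bar> \<le> 0"
  proof (rule linear_ode_bound[OF s, where p = "\<lambda>_. 0" and a = 0 and \<psi> = "\<lambda>_. 0" and \<psi>' = "\<lambda>_. 0"])
    fix r :: real assume r: "0 \<le> r"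
    show "((\<lambda>r. moment 1 r (\<lambda>_. 1) - moment 1 0 (\<lambda>_. 1)) has_real_derivative
        0 - 0 * (moment 1 r (\<lambda>_. 1) - moment 1 0 (\<lambda>_. 1))) (at r within {0..})"
    proof -
      have "moment (Suc 1) r (collision_adjoint 1 (\<lambda>_. 1)) = 0" unfolding z by (simp add: pairing_def)
      then show ?thesis
        using DERIV_diff[OF moment_derivative[OF r c] DERIV_const[of "moment 1 0 (\<lambda>_. 1)"]] by (simp only: mult_zero_left)
    qed
  qed auto
  ultimately show ?thesis using m[OF s] by simp
qed

text \<open>The term \<open>rate * j * \<phi>\<close> is added and subtracted. By conservation of
  mass \<phi> has the same moment on the levels \<open>j\<close> and \<open>Suc j\<close>, so the
  subtracted part is a damping of the moment itself.\<close>

lemma moment_derivative_gain_loss: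
  assumes t: "0 \<le> t" and \<phi>: "test_function j K \<phi>"
  shows "((\<lambda>s. moment j s \<phi>) has_real_derivative
    moment (Suc j) t (\<lambda>V. collision_adjoint j \<phi> V + rate * j * \<phi> V) - rate * j * moment j t \<phi>) (at t within {0..})"
proof -
  have i: "integrable (velocities (Suc j)) (tensor_power (Suc j) (f t))"
    by (intro integrable_tensor_power integrable_f t)
  have "moment (Suc j) t (\<lambda>V. collision_adjoint j \<phi> V + rate * j * \<phi> V)
      = moment (Suc j) t (collision_adjoint j \<phi>) + rate * j * moment j t \<phi>"
    using pairing_add[OF i test_function_collision_adjoint[OF \<phi>]
        test_function_cmult[OF test_function_mono_dim[OF \<phi>], of "Suc j" "rate * j"] order_refl]
      pairing_tensor_Suc[OF integrable_f[OF t] \<phi>] integral_f[OF t]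
    by (simp add: pairing_cmult)
  then show ?thesis using moment_derivative[OF assms] by simp
qed

text \<open>Supplies the maximum over a compact time interval from which the iteration for the L^1
  bound starts.\<close>

lemma L1_continuous:
  "continuous_on {0..} (\<lambda>s. LINT v|lborel. \<bar>f s v\<bar>)"
  unfolding continuous_on
proof -
  show "\<forall>t\<in>{0..}. ((\<lambda>s. LINT v|lborel. \<bar>f s v\<bar>) \<longlongrightarrow> (LINT v|lborel. \<bar>f t v\<bar>)) (at t within {0..})"
  proof
    fix t :: real assume t: "t \<in> {0..}"
    have d: "has_L1_derivative lborel f (boltzmann_operator B (f t)) t"
      using solution t by (simp add: boltzmann_solution_def)
    have l: "((\<lambda>s. LINT v|lborel. \<bar>f s v - f t v\<bar>) \<longlongrightarrow> 0) (at t within {0..})"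
      by (rule has_L1_derivative_imp_continuous[OF integrable_f integrable_boltzmann_operator _ d])
        (use t in \<open>auto intro: integrable_f\<close>)
    show "((\<lambda>s. LINT v|lborel. \<bar>f s v\<bar>) \<longlongrightarrow> (LINT v|lborel. \<bar>f t v\<bar>)) (at t within {0..})"
    proof (rule Lim_null[THEN iffD2], rule Lim_null_comparison[OF _ l])
      show "\<forall>\<^sub>F s in at t within {0..}. norm ((LINT v|lborel. \<bar>f s v\<bar>) - (LINT v|lborel. \<bar>f t v\<bar>))
          \<le> (LINT v|lborel. \<bar>f s v - f t v\<bar>)"
        unfolding eventually_at_filter
      proof (intro always_eventually allI impI)
        fix s :: real assume s: "s \<in> {0..}"
        have i: "integrable lborel (f s)" "integrable lborel (f t)" using s t by (auto intro: integrable_f)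
        have "(LINT v|lborel. \<bar>f s v\<bar>) - (LINT v|lborel. \<bar>f t v\<bar>) = (LINT v|lborel. \<bar>f s v\<bar> - \<bar>f t v\<bar>)"
          using i by (intro Bochner_Integration.integral_diff[symmetric]) auto
        also have "norm \<dots> \<le> (LINT v|lborel. \<bar>\<bar>f s v\<bar> - \<bar>f t v\<bar>\<bar>)"
          unfolding real_norm_def by (rule integral_abs_bound)
        also have "\<dots> \<le> (LINT v|lborel. \<bar>f s v - f t v\<bar>)"
          using i by (intro integral_mono integrable_abs Bochner_Integration.integrable_diff) auto
        finally show "norm ((LINT v|lborel. \<bar>f s v\<bar>) - (LINT v|lborel. \<bar>f t v\<bar>)) \<le> (LINT v|lborel. \<bar>f s v - f t v\<bar>)" .
      qed
    qed
  qed
qed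

text \<open>The \<open>L\<^sup>1\<close> norm \<open>y\<close> satisfies
  \<open>y' \<le> rate * (y\<^sup>2 - y)\<close> in integrated form, and the Picard iteration forces \<open>y \<le> 1\<close>.\<close>

lemma L1_norm_f_le_1:
  assumes s: "0 \<le> s" shows "(LINT v|lborel. \<bar>f s v\<bar>) \<le> 1"
proof -
  define y where "y r = (LINT v|lborel. \<bar>f r v\<bar>)" for r
  have "continuous_on {0..s} y"
    unfolding y_def[abs_def] using L1_continuous by (rule continuous_on_subset) auto
  from continuous_attains_sup[OF compact_Icc _ this] s
  obtain z where z: "\<And>r. 0 \<le> r \<Longrightarrow> r \<le> s \<Longrightarrow> y r \<le> y z" by fastforce
  define K where "K = max 1 (y z)"
  have K: "1 \<le> K" "\<And>r. 0 \<le> r \<Longrightarrow> r \<le> s \<Longrightarrow> y r \<le> K" using z by (auto simp: K_def le_max_iff_disj)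
  have y0: "0 \<le> y r" for r by (simp add: y_def)
  define L where "L = rate * (K + 1)"
  have L: "0 \<le> L" using rate_nonneg K by (simp add: L_def)
  \<comment> \<open>Each pass through the inequality turns the bound on the excess over 1 into the
    next term of an exponential series, and these terms tend to 0.\<close>
  have "y r \<le> 1 + K * ((L * r) ^ m / fact m)" if "0 \<le> r" "r \<le> s" for m r
    using that
  proof (induction m arbitrary: r)
    case 0
    then show ?case using K(2)[of r] by simp
  next
    case (Suc m)
    let ?u = "tensor_power 1 (f r)"
    \<comment> \<open>The sign is frozen at the final time \<open>r\<close>; the resulting linear
      moment is then followed over all earlier times \<open>q\<close>.\<close>
    define \<phi> where "\<phi> V = sgn (?u V)" for V
    note sg = pairing_sgn[OF integrable_tensor_power[OF integrable_f[OF Suc.prems(1)]] tensor_power_restrict, of 1]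
    have \<phi>: "test_function 1 1 \<phi>" unfolding \<phi>_def[abs_def] by (rule sg(1))
    have "y r = moment 1 r \<phi>"
      unfolding \<phi>_def[abs_def] sg(2) using L1_norm_tensor_power[OF integrable_f[OF Suc.prems(1)], of 1]
      by (simp add: y_def)
    also have "\<dots> \<le> 1 + K * ((L * r) ^ Suc m / fact (Suc m))"
    proof (rule linear_ode_upper_bound[OF Suc.prems(1) moment_derivative_gain_loss[OF _ \<phi>]])
      show "((\<lambda>r. 1 + K * ((L * r) ^ Suc m / fact (Suc m))) has_real_derivative K * L * ((L * q) ^ m / fact m))
          (at q within {0..})" for q
        by (rule derivative_eq_intros refl | simp)+
    next
      fix q assume q: "0 \<le> q" "q \<le> r"
      define e where "e = K * ((L * q) ^ m / fact m)"
      have e: "0 \<le> e" using K(1) L q by (simp add: e_def)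
      have ye: "y q \<le> 1 + e" using Suc.IH[of q] q Suc.prems by (simp add: e_def)
      have yK: "y q \<le> K" using K(2)[of q] q Suc.prems by simp
      have "moment (Suc 1) q (\<lambda>V. collision_adjoint 1 \<phi> V + rate * real 1 * \<phi> V) \<le> rate * (y q)\<^sup>2"
        using pairing_bound[OF integrable_tensor_power[OF integrable_f[OF q(1)]] test_function_collision_gain[OF \<phi>] order_refl]
          L1_norm_tensor_power[OF integrable_f[OF q(1)], of 2]
        by (simp add: y_def numeral_2_eq_2)
      \<comment> \<open>The constant 1 is balanced by the loss term. The rest is the excess
        \<open>e\<close> times at most \<open>K + 1\<close>, which explains the choice of
        \<open>L\<close>.\<close>
      also have "(y q)\<^sup>2 = 1 + (y q - 1) * (y q + 1)" by (simp add: power2_eq_square algebra_simps)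
      also have "(y q - 1) * (y q + 1) \<le> e * (K + 1)"
      proof -
        have "(y q - 1) * (y q + 1) \<le> e * (y q + 1)" using ye y0[of q] by (intro mult_right_mono) auto
        also have "\<dots> \<le> e * (K + 1)" using e yK by (intro mult_left_mono) auto
        finally show ?thesis .
      qed
      finally have "moment (Suc 1) q (\<lambda>V. collision_adjoint 1 \<phi> V + rate * real 1 * \<phi> V)
          \<le> rate * (1 + e * (K + 1))"
        using rate_nonneg by (simp add: mult_left_mono)
      also have "\<dots> \<le> L * e + rate * (1 + K * ((L * q) ^ Suc m / fact (Suc m)))"
      proof -
        have "0 \<le> rate * (K * ((L * q) ^ Suc m / fact (Suc m)))"
          using rate_nonneg K(1) L q by simp
        then show ?thesis by (simp add: L_def algebra_simps)
      qed
      finally show "moment (Suc 1) q (\<lambda>V. collision_adjoint 1 \<phi> V + rate * real 1 * \<phi> V)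
        \<le> K * L * ((L * q) ^ m / fact m) + rate * real 1 * (1 + K * ((L * q) ^ Suc m / fact (Suc m)))"
        by (simp add: e_def mult_ac)
    next
      have "(LINT v|lborel. \<bar>f 0 v\<bar>) = (LINT v|lborel. f0 v)"
        using solution f0 integrable_f[of 0]
        by (intro integral_cong_AE) (auto simp: boltzmann_solution_def probability_density_def)
      then have "y 0 = 1" by (simp add: y_def integral_f0)
      then have "\<bar>moment 1 0 \<phi>\<bar> \<le> 1"
        using pairing_bound[OF integrable_tensor_power[OF integrable_f[of 0]] \<phi> order_refl]
          L1_norm_tensor_power[OF integrable_f[of 0], of 1] by (simp add: y_def)
      then show "moment 1 0 \<phi> \<le> 1 + K * ((L * 0) ^ Suc m / fact (Suc m))" by simp
    qed simp
    finally show ?case .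
  qed
  then have "y s \<le> 1 + K * ((L * s) ^ m / fact m)" for m using s by simp
  moreover have "(\<lambda>m. 1 + K * ((L * s) ^ m / fact m)) \<longlonglongrightarrow> 1 + K * 0"
    by (intro tendsto_intros LIMSEQ_power_over_fact)
  ultimately have "y s \<le> 1 + K * 0" by (intro LIMSEQ_le_const) auto
  then show ?thesis by (simp add: y_def)
qed

text \<open>Since the L^1 norm of \<open>f s\<close> is at most 1, its \<open>j\<close>-th power
  costs nothing, and no factor exponential in \<open>j\<close> appears.\<close>

lemma moment_bound:
  assumes s: "0 \<le> s" and \<phi>: "test_function j K \<phi>"
  shows "\<bar>moment j s \<phi>\<bar> \<le> K"
proof -
  have K: "0 \<le> K" using test_function_bound[OF \<phi>, of undefined] by linarith
  have "\<bar>moment j s \<phi>\<bar> \<le> K * (LINT v|lborel. \<bar>f s v\<bar>) ^ j"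
    using pairing_bound[OF integrable_tensor_power[OF integrable_f[OF s]] \<phi> order_refl]
    by (simp add: L1_norm_tensor_power[OF integrable_f[OF s]])
  also have "\<dots> \<le> K * 1"
    using K L1_norm_f_le_1[OF s] by (intro mult_left_mono power_le_one) auto
  finally show ?thesis by simp
qed

end

subsection \<open>The Kac flow\<close>

text \<open>Pascal's rule makes the sum telescope to a single binomial coefficient, the source of
  the Bonferroni inequalities.\<close>

lemma alternating_binomial_partial_sum:
  "(\<Sum>l<Suc N. (- 1) ^ l * real (Suc m choose l)) = (- 1) ^ N * real (m choose N)"
  by (induction N) (simp_all add: algebra_simps)

text \<open>Inclusion-exclusion for factorial moments: the Bonferroni remainder after \<open>N\<close> terms is at most
  \<open>a * \<mu> ^ (n + N) / fact N\<close>.\<close>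

lemma factorial_moments_unique:
  fixes w :: "nat \<Rightarrow> real"
  assumes w: "\<And>m. 0 \<le> w m" and sums: "\<And>j. n \<le> j \<Longrightarrow> (\<lambda>k. w (j + k) / fact k) sums (\<mu> ^ j * a)"
  shows "w n = exp (- \<mu>) * \<mu> ^ n * a"
proof -
  \<comment> \<open>For \<open>m \<ge> l\<close> the quotient \<open>(m choose l) / fact m\<close>
    is \<open>1 / (fact l * fact (m - l))\<close>, so the binomial moment of order \<open>l\<close>
    is the hypothesis at level \<open>n + l\<close> divided by \<open>fact l\<close>.\<close>
  have tm: "(\<lambda>m. w (n + m) / fact m * real (m choose l)) sums (\<mu> ^ (n + l) * a / fact l)" for l
  proof -
    have "(\<lambda>k. w (n + (k + l)) / fact (k + l) * real ((k + l) choose l)) = (\<lambda>k. w (n + l + k) / fact k / fact l)"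
      by (rule ext) (simp add: binomial_fact[of l] field_simps add_ac)
    then have "(\<lambda>k. w (n + (k + l)) / fact (k + l) * real ((k + l) choose l)) sums (\<mu> ^ (n + l) * a / fact l)"
      using sums_divide[OF sums[of "n + l"], of "fact l"] by simp
    moreover have "(\<Sum>m<l. w (n + m) / fact m * real (m choose l)) = 0"
      by (intro sum.neutral) auto
    ultimately show ?thesis
      using sums_iff_shift[of "\<lambda>m. w (n + m) / fact m * real (m choose l)" l] by simp
  qed
  define S where "S N = (\<Sum>l<N. (- 1) ^ l * (\<mu> ^ (n + l) * a / fact l))" for N
  have bound: "\<bar>S (Suc N) - w n\<bar> \<le> \<mu> ^ (n + Suc N) * a / fact (Suc N)" for N
  proof -
    \<comment> \<open>The weighted difference between the truncated inclusion-exclusion sum and the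
      indicator of \<open>m = 0\<close>, which singles out \<open>w n\<close>.\<close>
    let ?h = "\<lambda>m. w (n + m) / fact m * ((\<Sum>l<Suc N. (- 1) ^ l * real (m choose l)) - (if m = 0 then 1 else 0))"
    have "(\<lambda>m. \<Sum>l<Suc N. (- 1) ^ l * (w (n + m) / fact m * real (m choose l))) sums S (Suc N)"
      unfolding S_def by (intro sums_sum sums_mult tm)
    moreover have "(\<lambda>m. if m = 0 then w (n + m) / fact m else 0) sums w n"
      using sums_single[of 0 "\<lambda>m. w (n + m) / fact m"] by simp
    ultimately have "(\<lambda>m. (\<Sum>l<Suc N. (- 1) ^ l * (w (n + m) / fact m * real (m choose l)))
        - (if m = 0 then w (n + m) / fact m else 0)) sums (S (Suc N) - w n)"
      by (rule sums_diff)
    moreover have "(\<lambda>m. (\<Sum>l<Suc N. (- 1) ^ l * (w (n + m) / fact m * real (m choose l)))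
        - (if m = 0 then w (n + m) / fact m else 0)) = ?h"
      by (rule ext) (simp add: right_diff_distrib sum_distrib_left mult.left_commute del: sum.lessThan_Suc)
    ultimately have h: "?h sums (S (Suc N) - w n)" by simp
    have hb: "\<bar>?h m\<bar> \<le> w (n + m) / fact m * real (m choose Suc N)" for m
    proof (cases m)
      case 0
      have "(\<Sum>l<Suc N. (- 1) ^ l * real (0 choose l)) = 1"
        by (simp add: sum.lessThan_Suc_shift del: sum.lessThan_Suc)
      then show ?thesis using 0 by simp
    next
      \<comment> \<open>Here the truncated sum is \<open>m' choose N\<close> up to sign, which
        Pascal's rule bounds by \<open>Suc m' choose Suc N\<close>.\<close>
      case (Suc m')
      then show ?thesis
        using w[of "n + m"] unfolding Suc alternating_binomial_partial_sum
        by (simp add: abs_mult power_abs) (intro divide_right_mono mult_left_mono; simp)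
    qed
    have "S (Suc N) - w n \<le> \<mu> ^ (n + Suc N) * a / fact (Suc N)"
      by (rule sums_le[OF abs_le_D1[OF hb] h tm[of "Suc N"]])
    moreover have "- (S (Suc N) - w n) \<le> \<mu> ^ (n + Suc N) * a / fact (Suc N)"
      by (rule sums_le[OF abs_le_D2[OF hb] sums_minus[OF h] tm[of "Suc N"]])
    ultimately show ?thesis by (simp add: abs_le_iff)
  qed
  have "(\<lambda>N. \<mu> ^ n * a * (\<mu> ^ Suc N / fact (Suc N))) \<longlonglongrightarrow> \<mu> ^ n * a * 0"
    by (intro tendsto_intros LIMSEQ_Suc[OF LIMSEQ_power_over_fact])
  then have "(\<lambda>N. \<mu> ^ (n + Suc N) * a / fact (Suc N)) \<longlonglongrightarrow> 0" by (simp add: power_add mult_ac)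
  then have "(\<lambda>N. S (Suc N) - w n) \<longlonglongrightarrow> 0"
    by (rule Lim_null_comparison[rotated]) (use bound in auto)
  then have 1: "(\<lambda>N. S (Suc N)) \<longlonglongrightarrow> w n" by (simp add: Lim_null[symmetric])
  have "(\<lambda>l. \<mu> ^ n * a * ((- \<mu>) ^ l /\<^sub>R fact l)) sums (\<mu> ^ n * a * exp (- \<mu>))"
    by (intro sums_mult exp_converges)
  moreover have "\<mu> ^ n * a * ((- \<mu>) ^ l /\<^sub>R fact l) = (- 1) ^ l * (\<mu> ^ (n + l) * a / fact l)" for l
    by (simp add: power_add power_minus[of \<mu>] divide_inverse mult_ac)
  ultimately have "S \<longlonglongrightarrow> \<mu> ^ n * a * exp (- \<mu>)"
    unfolding sums_def S_def[abs_def] by simp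
  then have "(\<lambda>N. S (Suc N)) \<longlonglongrightarrow> \<mu> ^ n * a * exp (- \<mu>)" by (rule LIMSEQ_Suc)
  from LIMSEQ_unique[OF 1 this] show ?thesis by (simp add: mult_ac)
qed

section \<open>Correlation functions as series of pairings\<close>

lemma measurable_merge_velocities:
  "merge {..<j} {j..<j + k} \<in> velocities j \<Otimes>\<^sub>M Pi\<^sub>M {j..<j + k} (\<lambda>_. lborel) \<rightarrow>\<^sub>M velocities (j + k)"
proof -
  have "{..<j} \<union> {j..<j + k} = {..<j + k}" by auto
  then show ?thesis using measurable_merge[of "{..<j}" "{j..<j + k}" "\<lambda>_. lborel"] by simp
qed

lemma nn_integral_marginal_measurable:
  assumes "h \<in> borel_measurable (velocities (j + k))"
  shows "(\<lambda>V. \<integral>\<^sup>+U. h (merge {..<j} {j..<j + k} (V, U)) \<partial>Pi\<^sub>M {j..<j + k} (\<lambda>_. lborel)) \<in> borel_measurable (velocities j)"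
  by (rule sigma_finite_measure.borel_measurable_nn_integral_fst[OF sigma_finite_velocities
        measurable_compose[OF measurable_merge_velocities assms]]) simp

lemma nn_integral_marginal:
  assumes "h \<in> borel_measurable (velocities (j + k))"
  shows "(\<integral>\<^sup>+V. \<integral>\<^sup>+U. h (merge {..<j} {j..<j + k} (V, U)) \<partial>Pi\<^sub>M {j..<j + k} (\<lambda>_. lborel) \<partial>velocities j)
    = (\<integral>\<^sup>+V. h V \<partial>velocities (j + k))"
proof -
  have u: "{..<j} \<union> {j..<j + k} = {..<j + k}" by auto
  show ?thesis
    using velocity_product.product_nn_integral_fold[of "{..<j}" "{j..<j + k}" h] assms
    by (simp add: u ivl_disj_int(1)[symmetric] disjoint_iff)
qed

lemma correlation_measurable:
  assumes "\<And>n. W n \<in> borel_measurable (velocities n)"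
  shows "correlation \<mu> W j \<in> borel_measurable (velocities j)"
  unfolding correlation_def[abs_def]
  by (intro borel_measurable_times_ennreal borel_measurable_suminf_order borel_measurable_const
      nn_integral_marginal_measurable measurable_compose[OF assms measurable_ennreal])

text \<open>A test function sees only the first \<open>j\<close> velocities, so it passes through
  the inner integrals, and by Tonelli the term with \<open>k\<close> further particles becomes a
  pairing at level \<open>j + k\<close>. Nonnegativity of \<phi> permits this before the correlation
  is known to be finite.\<close>

lemma nn_integral_correlation:
  assumes \<mu>: "0 < \<mu>" and W: "grand_canonical_state \<mu> W" and \<phi>: "test_function j K \<phi>" "\<And>V. 0 \<le> \<phi> V"
  shows "(\<integral>\<^sup>+V. correlation \<mu> W j V * ennreal (\<phi> V) \<partial>velocities j)
    = (\<Sum>k. ennreal (pairing (j + k) (W (j + k)) \<phi> / (\<mu> ^ j * fact k)))"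
proof -
  have Wi: "integrable (velocities n) (W n)" and W0: "AE V in velocities n. 0 \<le> W n V" for n
    using W by (auto simp: grand_canonical_state_def)
  have Wm: "(\<lambda>V. ennreal (W n V)) \<in> borel_measurable (velocities n)" for n
    using Wi[of n] by auto
  have \<phi>m: "(\<lambda>V. ennreal (\<phi> V)) \<in> borel_measurable (velocities n)" if "j \<le> n" for n
    using test_function_measurable[OF \<phi>(1) that] by auto
  let ?I = "\<lambda>k V. \<integral>\<^sup>+U. ennreal (W (j + k) (merge {..<j} {j..<j + k} (V, U))) \<partial>Pi\<^sub>M {j..<j + k} (\<lambda>_. lborel)"
  have Im: "?I k \<in> borel_measurable (velocities j)" for k
    by (rule nn_integral_marginal_measurable[OF Wm])
  have merge: "\<phi> (merge {..<j} {j..<j + k} (V, U)) = \<phi> V" for k V U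
    by (rule test_function_cong[OF \<phi>(1)]) (simp add: merge_def)
  have "(\<integral>\<^sup>+V. correlation \<mu> W j V * ennreal (\<phi> V) \<partial>velocities j)
      = (\<integral>\<^sup>+V. (\<Sum>k. ennreal (1 / (\<mu> ^ j * fact k)) * (?I k V * ennreal (\<phi> V))) \<partial>velocities j)"
    unfolding correlation_def using \<mu>
    by (simp add: ennreal_suminf_multc[symmetric] ennreal_suminf_cmult[symmetric] mult.assoc[symmetric] ennreal_mult[symmetric]
        del: ennreal_suminf_multc ennreal_suminf_cmult)
  also have "\<dots> = (\<Sum>k. ennreal (1 / (\<mu> ^ j * fact k)) * (\<integral>\<^sup>+V. ?I k V * ennreal (\<phi> V) \<partial>velocities j))"
    using Im \<phi>m[OF order_refl] by (subst nn_integral_suminf) (auto simp: nn_integral_cmult)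
  also have "\<dots> = (\<Sum>k. ennreal (pairing (j + k) (W (j + k)) \<phi> / (\<mu> ^ j * fact k)))"
  proof (rule suminf_cong)
    fix k
    let ?h = "\<lambda>V. ennreal (W (j + k) V) * ennreal (\<phi> V)"
    have hm: "?h \<in> borel_measurable (velocities (j + k))"
      by (intro borel_measurable_times_ennreal Wm \<phi>m) simp
    have Um: "(\<lambda>U. ennreal (W (j + k) (merge {..<j} {j..<j + k} (V, U)))) \<in> borel_measurable (Pi\<^sub>M {j..<j + k} (\<lambda>_. lborel))"
      if "V \<in> space (velocities j)" for V
      using measurable_compose[OF measurable_Pair1'[OF that] measurable_compose[OF measurable_merge_velocities Wm]] .
    have "(\<integral>\<^sup>+V. ?I k V * ennreal (\<phi> V) \<partial>velocities j)
        = (\<integral>\<^sup>+V. \<integral>\<^sup>+U. ?h (merge {..<j} {j..<j + k} (V, U)) \<partial>Pi\<^sub>M {j..<j + k} (\<lambda>_. lborel) \<partial>velocities j)"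
      by (rule nn_integral_cong) (simp add: merge nn_integral_multc[OF Um])
    also have "\<dots> = (\<integral>\<^sup>+V. ?h V \<partial>velocities (j + k))" by (rule nn_integral_marginal[OF hm])
    also have "\<dots> = (\<integral>\<^sup>+V. ennreal (W (j + k) V * \<phi> V) \<partial>velocities (j + k))"
      using \<phi>(2) by (intro nn_integral_cong) (simp add: ennreal_mult'')
    also have "\<dots> = ennreal (pairing (j + k) (W (j + k)) \<phi>)"
      unfolding pairing_def using W0[of "j + k"] \<phi>(2)
      by (intro nn_integral_eq_integral integrable_test[OF Wi \<phi>(1)]) auto
    finally show "ennreal (1 / (\<mu> ^ j * fact k)) * (\<integral>\<^sup>+V. ?I k V * ennreal (\<phi> V) \<partial>velocities j)
        = ennreal (pairing (j + k) (W (j + k)) \<phi> / (\<mu> ^ j * fact k))"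
      using \<mu> by (simp add: ennreal_mult'[symmetric])
  qed
  finally show ?thesis .
qed

lemma pairing_nonneg:
  assumes "AE V in velocities n. 0 \<le> u V" "\<And>V. 0 \<le> \<phi> V"
  shows "0 \<le> pairing n u \<phi>"
  unfolding pairing_def by (rule integral_nonneg_AE) (use assms in auto)

section \<open>Normalised observables of the system with n particles\<close>

locale kac_flow = boltzmann_flow B C f0 f for B C f0 f +
  fixes \<mu> :: real and W :: "real \<Rightarrow> nat \<Rightarrow> configuration \<Rightarrow> real"
  assumes \<mu>_pos: "0 < \<mu>" and evolution: "kac_evolution B \<mu> W"
    and initial: "\<And>j. 1 \<le> j \<Longrightarrow> AE V in velocities j. correlation \<mu> (W 0) j V = ennreal (tensor_power j f0 V)"
begin

lemma state: "0 \<le> t \<Longrightarrow> grand_canonical_state \<mu> (W t)"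
  using evolution by (simp add: kac_evolution_def)

lemma integrable_W: "0 \<le> t \<Longrightarrow> integrable (velocities n) (W t n)"
  and W_nonneg: "0 \<le> t \<Longrightarrow> AE V in velocities n. 0 \<le> W t n V"
  using state by (auto simp: grand_canonical_state_def)

text \<open>Normalised by the weight of \<open>n\<close> particles in the initial state; the weights are conserved.\<close>

definition observable :: "nat \<Rightarrow> real \<Rightarrow> (configuration \<Rightarrow> real) \<Rightarrow> real" where
  "observable n t \<phi> = pairing n (W t n) \<phi> / (exp (- \<mu>) * \<mu> ^ n)"

text \<open>For fixed \<phi>, the initial correlations of all orders \<open>j \<ge> n\<close>
  prescribe the factorial moments of the sequence of pairings; inverting them returns the Poisson
  weight times the tensor power.\<close>

lemma pairing_initial:
  assumes n: "1 \<le> n" and \<phi>: "test_function n K \<phi>"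
  shows "pairing n (W 0 n) \<phi> = exp (- \<mu>) * \<mu> ^ n * pairing n (tensor_power n f0) \<phi>"
proof -
  have pos: "pairing n (W 0 n) \<phi> = exp (- \<mu>) * \<mu> ^ n * pairing n (tensor_power n f0) \<phi>"
    if \<phi>: "test_function n K \<phi>" "\<And>V. 0 \<le> \<phi> V" for \<phi> K
  proof (rule factorial_moments_unique[of "\<lambda>m. pairing m (W 0 m) \<phi>"])
    show nn: "0 \<le> pairing m (W 0 m) \<phi>" for m
      by (rule pairing_nonneg[OF W_nonneg \<phi>(2)]) simp
    fix j assume j: "n \<le> j"
    note \<phi>j = test_function_mono_dim[OF \<phi>(1) j]
    have T: "AE V in velocities j. 0 \<le> tensor_power j f0 V"
      using f0 by (auto simp: tensor_power_def probability_density_def intro!: prod_nonneg)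
    have "(\<Sum>k. ennreal (pairing (j + k) (W 0 (j + k)) \<phi> / (\<mu> ^ j * fact k)))
        = (\<integral>\<^sup>+V. correlation \<mu> (W 0) j V * ennreal (\<phi> V) \<partial>velocities j)"
      by (rule nn_integral_correlation[OF \<mu>_pos state \<phi>j \<phi>(2), symmetric]) simp
    also have "\<dots> = (\<integral>\<^sup>+V. ennreal (tensor_power j f0 V * \<phi> V) \<partial>velocities j)"
      using initial[of j] n j T by (intro nn_integral_cong_AE) (auto simp: ennreal_mult'' \<phi>(2))
    also have "\<dots> = ennreal (pairing j (tensor_power j f0) \<phi>)"
      unfolding pairing_def using T \<phi>(2)
      by (intro nn_integral_eq_integral integrable_test[OF integrable_tensor_power[OF integrable_f0] \<phi>j]) auto
    also have "pairing j (tensor_power j f0) \<phi> = pairing n (tensor_power n f0) \<phi>"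
      by (rule pairing_tensor_mono[OF integrable_f0 integral_f0 \<phi>(1) j])
    finally have s: "(\<Sum>k. ennreal (pairing (j + k) (W 0 (j + k)) \<phi> / (\<mu> ^ j * fact k)))
        = ennreal (pairing n (tensor_power n f0) \<phi>)" .
    have t: "0 \<le> pairing (j + k) (W 0 (j + k)) \<phi> / (\<mu> ^ j * fact k)" for k
      using nn \<mu>_pos by simp
    have p: "0 \<le> pairing n (tensor_power n f0) \<phi>"
      using f0 \<phi>(2) by (intro pairing_nonneg) (auto simp: tensor_power_def probability_density_def intro!: prod_nonneg)
    have "(\<lambda>k. ennreal (pairing (j + k) (W 0 (j + k)) \<phi> / (\<mu> ^ j * fact k))) sums
        ennreal (pairing n (tensor_power n f0) \<phi>)"
      using summable_sums[OF summableI, of "\<lambda>k. ennreal (pairing (j + k) (W 0 (j + k)) \<phi> / (\<mu> ^ j * fact k))"]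
      unfolding s .
    then have "(\<lambda>k. pairing (j + k) (W 0 (j + k)) \<phi> / (\<mu> ^ j * fact k)) sums pairing n (tensor_power n f0) \<phi>"
      using sums_ennreal[of "\<lambda>k. pairing (j + k) (W 0 (j + k)) \<phi> / (\<mu> ^ j * fact k)", OF t p] by blast
    from sums_mult[OF this, of "\<mu> ^ j"]
    show "(\<lambda>k. pairing (j + k) (W 0 (j + k)) \<phi> / fact k) sums (\<mu> ^ j * pairing n (tensor_power n f0) \<phi>)"
      using \<mu>_pos by (simp add: field_simps)
  qed
  have K: "0 \<le> K" using test_function_bound[OF \<phi>, of undefined] by linarith
  \<comment> \<open>The inversion was carried out for nonnegative \<phi>. A general one is the
    difference of the nonnegative functions \<open>\<phi> + K\<close> and \<open>K\<close>, and the
    claim is linear.\<close>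
  have cK: "test_function n K (\<lambda>_. K)" using test_function_const[of n K] K by simp
  have sum: "test_function n (K + K) (\<lambda>V. \<phi> V + K)" by (rule test_function_add[OF \<phi> cK])
  have nn: "0 \<le> \<phi> V + K" for V using test_function_bound[OF \<phi>, of V] by linarith
  have W: "integrable (velocities n) (W 0 n)" by (rule integrable_W) simp
  have F: "integrable (velocities n) (tensor_power n f0)" by (rule integrable_tensor_power[OF integrable_f0])
  show ?thesis
    using pos[OF sum nn] pos[OF cK K] pairing_add[OF W \<phi> cK order_refl] pairing_add[OF F \<phi> cK order_refl]
    by (simp add: algebra_simps)
qed

lemma observable_initial:
  assumes n: "1 \<le> n" and \<phi>: "test_function j K \<phi>" "j \<le> n"
  shows "observable n 0 \<phi> = moment j 0 \<phi>"
proof -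
  have "observable n 0 \<phi> = pairing n (tensor_power n f0) \<phi>"
    using pairing_initial[OF n test_function_mono_dim[OF \<phi>]] \<mu>_pos by (simp add: observable_def)
  also have "\<dots> = moment j 0 \<phi>"
    unfolding moment_initial[OF \<phi>(1)] by (rule pairing_tensor_mono[OF integrable_f0 integral_f0 \<phi>])
  finally show ?thesis .
qed

lemma observable_derivative:
  assumes "0 \<le> t" "test_function j K \<phi>" "j \<le> n"
  shows "((\<lambda>s. observable n s \<phi>) has_real_derivative
    (observable n t (T_op B j \<phi>) + real (n - j) * observable n t (collision_adjoint j \<phi>)) / \<mu>) (at t within {0..})"
  unfolding observable_def
  using DERIV_cdivide[OF kac_pairing_derivative[OF evolution assms], of "exp (- \<mu>) * \<mu> ^ n"]
  by (simp add: add_divide_distrib mult_ac)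

text \<open>A constant is a test function of level 0, where both collision terms are empty sums;
  hence the weight of each particle number is conserved.\<close>

lemma observable_one:
  assumes t: "0 \<le> t" and n: "1 \<le> n" shows "observable n t (\<lambda>_. 1) = 1"
proof -
  have c: "test_function 0 1 (\<lambda>_. 1)" using test_function_const[of 0 1] by simp
  have "observable n 0 (\<lambda>_. 1) = 1"
    unfolding observable_initial[OF n c le0]
    using integral_tensor_power[OF integrable_f[of 0], of 0] by (simp add: pairing_def)
  moreover have "\<bar>observable n t (\<lambda>_. 1) - observable n 0 (\<lambda>_. 1)\<bar> \<le> 0"
  proof (rule linear_ode_bound[OF t, where p = "\<lambda>_. 0" and a = 0 and \<psi> = "\<lambda>_. 0" and \<psi>' = "\<lambda>_. 0"])
    fix r :: real assume r: "0 \<le> r"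
    have "observable n r (T_op B 0 (\<lambda>_. 1)) = 0" "observable n r (collision_adjoint 0 (\<lambda>_. 1)) = 0"
      by (simp_all add: observable_def pairing_def T_op_def collision_adjoint_def)
    then show "((\<lambda>r. observable n r (\<lambda>_. 1) - observable n 0 (\<lambda>_. 1)) has_real_derivative
        0 - 0 * (observable n r (\<lambda>_. 1) - observable n 0 (\<lambda>_. 1))) (at r within {0..})"
      using DERIV_diff[OF observable_derivative[OF r c le0] DERIV_const[of "observable n 0 (\<lambda>_. 1)"], of n] by simp
  qed auto
  ultimately show ?thesis by simp
qed

text \<open>Nonnegativity of \<open>W\<close> and conservation of its weight make the normalised L^1
  norm equal to 1.\<close>

lemma observable_bound:
  assumes t: "0 \<le> t" and n: "1 \<le> n" and \<phi>: "test_function j K \<phi>" "j \<le> n"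
  shows "\<bar>observable n t \<phi>\<bar> \<le> K"
proof -
  have c: "0 < exp (- \<mu>) * \<mu> ^ n" using \<mu>_pos by simp
  have "(LINT V|velocities n. \<bar>W t n V\<bar>) = pairing n (W t n) (\<lambda>_. 1)"
    unfolding pairing_def using W_nonneg[OF t, of n] integrable_W[OF t, of n]
    by (intro integral_cong_AE) auto
  then have "(LINT V|velocities n. \<bar>W t n V\<bar>) = exp (- \<mu>) * \<mu> ^ n"
    using observable_one[OF t n] c by (simp add: observable_def field_simps)
  then show ?thesis
    using pairing_bound[OF integrable_W[OF t] \<phi>] c by (simp add: observable_def abs_div_pos[symmetric] field_simps)
qed

lemma observable_add:
  assumes "0 \<le> t" "test_function j K \<phi>" "test_function j K' \<psi>" "j \<le> n"
  shows "observable n t (\<lambda>V. \<phi> V + \<psi> V) = observable n t \<phi> + observable n t \<psi>"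
  unfolding observable_def pairing_add[OF integrable_W[OF assms(1)] assms(2-)] by (rule add_divide_distrib)

lemma observable_cmult: "observable n t (\<lambda>V. c * \<phi> V) = c * observable n t \<phi>"
  by (simp add: observable_def pairing_cmult)

text \<open>The \<open>n\<close>-particle system runs at speed \<open>\<alpha> = n / \<mu>\<close>.\<close>

lemma observable_moment_bound:
  assumes n: "1 \<le> n" and \<alpha>: "\<alpha> = n / \<mu>" "1 / 2 \<le> \<alpha>" "\<alpha> \<le> 2" and "j \<le> n"
    and "test_function j K \<phi>" "0 \<le> t"
  shows "\<bar>observable n t \<phi> - moment j (\<alpha> * t) \<phi>\<bar> \<le> K * (4 * exp (7 * rate * t) * (real j * (real j + 1) / \<mu>))"
  using \<open>j \<le> n\<close> assms(6,7)
proof (induction j arbitrary: K \<phi> t rule: inc_induct)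
  case base
  have K: "0 \<le> K" using test_function_bound[OF base(1), of undefined] by linarith
  have "0 \<le> \<alpha> * t" using base(2) \<alpha>(2) by simp
  from observable_bound[OF base(2) n base(1) order_refl] moment_bound[OF this base(1)]
  have "\<bar>observable n t \<phi> - moment n (\<alpha> * t) \<phi>\<bar> \<le> K + K" by linarith
  \<comment> \<open>The factor 4 of the estimate is fixed here: \<open>n * (n + 1) / \<mu>\<close>
    equals \<open>\<alpha> * (n + 1)\<close>, which is at least 1/2, and the trivial bound is
    \<open>2 * K\<close>.\<close>
  also have "\<dots> = K * (4 * 1 * (1 / 2 * (0 + 1)))" by simp
  also have "\<dots> \<le> K * (4 * exp (7 * rate * t) * (\<alpha> * (real n + 1)))"
    using K base rate_nonneg \<alpha>(2) by (intro mult_left_mono mult_mono) auto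
  finally show ?case by (simp add: \<alpha>(1))
next
  case (step j)
  define g where "g V = collision_adjoint j \<phi> V + rate * j * \<phi> V" for V
  have g: "test_function (Suc j) (real j * (rate * K)) g"
    unfolding g_def[abs_def] by (rule test_function_collision_gain[OF step.prems(1)])
  have K: "0 \<le> K" using test_function_bound[OF step.prems(1), of undefined] by linarith
  define X where "X s = observable n s \<phi> - moment j (\<alpha> * s) \<phi>" for s
  \<comment> \<open>The defect with respect to the Boltzmann hierarchy: collisions among the first
    \<open>j\<close> particles, and the \<open>j\<close> partners missing in
    \<open>n - j\<close>.\<close>
  define R where "R s = (observable n s (T_op B j \<phi>) - real j * observable n s (collision_adjoint j \<phi>)) / \<mu>" for s
  define p where "p s = \<alpha> * (observable n s g - moment (Suc j) (\<alpha> * s) g) + R s" for s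
  define J where "J = real j * (real j + 1) / \<mu>"
  have \<alpha>0: "0 \<le> \<alpha>" using \<alpha>(2) by simp
  have jn: "j \<le> n" "Suc j \<le> n" using step by auto
  have J: "0 \<le> J" using \<mu>_pos by (simp add: J_def)
  have "\<bar>X t\<bar> \<le> K * (4 * exp (7 * rate * t) * J)"
  proof (rule linear_ode_bound[OF step.prems(2)])
    fix s assume s: "0 \<le> s" "s \<le> t"
    have \<alpha>s: "0 \<le> \<alpha> * s" using \<alpha>0 s by simp
    have adj: "observable n s (collision_adjoint j \<phi>) = observable n s g - rate * j * observable n s \<phi>"
      using observable_add[OF s(1) test_function_collision_adjoint[OF step.prems(1)]
          test_function_cmult[OF test_function_mono_dim[OF step.prems(1)], of "Suc j" "rate * j"] jn(2)]
      by (simp add: g_def[abs_def] observable_cmult)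
    have "((\<lambda>s. moment j s \<phi>) has_real_derivative moment (Suc j) (\<alpha> * s) g - rate * j * moment j (\<alpha> * s) \<phi>)
        (at (\<alpha> * s) within ((\<lambda>r. \<alpha> * r) ` {0..}))"
      unfolding g_def[abs_def] using \<alpha>0
      by (intro has_field_derivative_subset[OF moment_derivative_gain_loss[OF \<alpha>s step.prems(1)]]) auto
    from DERIV_image_chain[OF this DERIV_cmult_Id]
    have 1: "((\<lambda>s. moment j (\<alpha> * s) \<phi>) has_real_derivative
        (moment (Suc j) (\<alpha> * s) g - rate * j * moment j (\<alpha> * s) \<phi>) * \<alpha>) (at s within {0..})"
      by (simp add: comp_def)
    have 2: "(observable n s (T_op B j \<phi>) + real (n - j) * observable n s (collision_adjoint j \<phi>)) / \<mu>
       = \<alpha> * observable n s (collision_adjoint j \<phi>) + R s"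
      using jn(1) by (simp add: R_def \<alpha>(1) of_nat_diff add_divide_distrib diff_divide_distrib algebra_simps)
    have 3: "p s - \<alpha> * rate * j * X s = \<alpha> * observable n s (collision_adjoint j \<phi>) + R s
        - (moment (Suc j) (\<alpha> * s) g - rate * j * moment j (\<alpha> * s) \<phi>) * \<alpha>"
      unfolding adj p_def X_def by (simp add: algebra_simps)
    show "(X has_real_derivative p s - \<alpha> * rate * j * X s) (at s within {0..})"
      unfolding 3 unfolding X_def[abs_def]
      by (rule DERIV_diff[OF observable_derivative[OF s(1) step.prems(1) jn(1), unfolded 2] 1])
    show "((\<lambda>s. K * (4 * exp (7 * rate * s) * J)) has_real_derivative K * (4 * (7 * rate * exp (7 * rate * s)) * J))
        (at s within {0..})"
      by (rule derivative_eq_intros refl | simp)+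
    define E where "E = 4 * exp (7 * rate * s)"
    have "1 \<le> exp (7 * rate * s)" using rate_nonneg s by simp
    then have E: "1 \<le> E" "0 \<le> E" unfolding E_def by linarith+
    have R: "\<bar>R s\<bar> \<le> 3 * rate * K * E * J"
    proof -
      have "\<bar>observable n s (T_op B j \<phi>)\<bar> \<le> rate * (real j)\<^sup>2 * K"
        by (rule observable_bound[OF s(1) n test_function_T_op[OF step.prems(1)] jn(1)])
      moreover have "real j * \<bar>observable n s (collision_adjoint j \<phi>)\<bar> \<le> real j * (real j * (2 * rate * K))"
        by (intro mult_left_mono observable_bound[OF s(1) n test_function_collision_adjoint[OF step.prems(1)] jn(2)]) simp
      ultimately have "\<bar>observable n s (T_op B j \<phi>) - real j * observable n s (collision_adjoint j \<phi>)\<bar>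
          \<le> 3 * rate * K * (real j * real j)"
        using abs_triangle_ineq4[of "observable n s (T_op B j \<phi>)" "real j * observable n s (collision_adjoint j \<phi>)"]
        by (simp add: abs_mult power2_eq_square algebra_simps)
      also have "\<dots> \<le> 3 * rate * K * (E * (real j * (real j + 1)))"
      proof (rule mult_left_mono)
        have "real j * real j \<le> 1 * (real j * (real j + 1))" by (simp add: algebra_simps)
        also have "\<dots> \<le> E * (real j * (real j + 1))" using E by (intro mult_right_mono) auto
        finally show "real j * real j \<le> E * (real j * (real j + 1))" .
      qed (use rate_nonneg K in auto)
      finally show ?thesis using \<mu>_pos by (simp add: R_def J_def abs_div_pos[symmetric] divide_right_mono mult_ac)
    qed
    have G: "\<alpha> * \<bar>observable n s g - moment (Suc j) (\<alpha> * s) g\<bar>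
        \<le> \<alpha> * (real j * (rate * K) * (E * (real (Suc j) * (real (Suc j) + 1) / \<mu>)))"
      unfolding E_def using step.IH[OF g s(1)] \<alpha>0 by (rule mult_left_mono)
    \<comment> \<open>The factor \<open>j\<close> of the gain turns the weight of level
      \<open>Suc j\<close> into a multiple of the weight of level \<open>j\<close>. The multiple
      exceeds the \<open>j\<close> of the damping rate by only 2.\<close>
    have Q: "real j * (real (Suc j) * (real (Suc j) + 1) / \<mu>) = (real j + 2) * J"
      by (simp add: J_def algebra_simps add_divide_distrib)
    have "\<alpha> * (real j * (rate * K) * (E * q)) = \<alpha> * (rate * K * E * (real j * q))" for q
      by (simp add: mult_ac)
    from G[unfolded this Q] have G': "\<alpha> * \<bar>observable n s g - moment (Suc j) (\<alpha> * s) g\<bar> \<le> \<alpha> * (rate * K * E * ((real j + 2) * J))" .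
    have "\<bar>p s\<bar> \<le> \<alpha> * \<bar>observable n s g - moment (Suc j) (\<alpha> * s) g\<bar> + \<bar>R s\<bar>"
      unfolding p_def using \<alpha>0 abs_triangle_ineq[of "\<alpha> * (observable n s g - moment (Suc j) (\<alpha> * s) g)" "R s"]
      by (simp add: abs_mult)
    also have "\<dots> \<le> \<alpha> * (rate * K * E * ((real j + 2) * J)) + 3 * rate * K * E * J"
      using G' R by (rule add_mono)
    \<comment> \<open>The last summand is exactly the damping applied to the supersolution. The
      remaining coefficient, with 3 stemming from \<open>R\<close>, is at most 7 since
      \<open>\<alpha> \<le> 2\<close>, and this is the 7 in the exponential.\<close>
    also have "\<dots> = (2 * \<alpha> + 3) * (rate * K * E * J) + \<alpha> * rate * j * (K * (E * J))"
      by (simp add: algebra_simps)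
    also have "\<dots> \<le> 7 * (rate * K * E * J) + \<alpha> * rate * j * (K * (E * J))"
      using \<alpha>(3) rate_nonneg K E J by (intro add_right_mono mult_right_mono) auto
    finally show "\<bar>p s\<bar> \<le> K * (4 * (7 * rate * exp (7 * rate * s)) * J) + \<alpha> * rate * j * (K * (4 * exp (7 * rate * s) * J))"
      by (simp add: E_def mult_ac)
  next
    show "\<bar>X 0\<bar> \<le> K * (4 * exp (7 * rate * 0) * J)"
      using K J by (simp add: X_def observable_initial[OF n step.prems(1) jn(1)])
  qed
  then show ?case by (simp add: X_def J_def)
qed

end

subsection \<open>Poisson superposition\<close>

text \<open>The identity \<open>p (Suc k) * real (Suc k) = \<mu> * p k\<close> reduces each moment
  to lower ones by a shift of the index.\<close>

lemma poisson_moments: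
  fixes \<mu> :: real
  defines "p \<equiv> \<lambda>k. exp (- \<mu>) * \<mu> ^ k / fact k"
  shows "p sums 1" "(\<lambda>k. p k * real k) sums \<mu>" "(\<lambda>k. p k * (real k)\<^sup>2) sums (\<mu>\<^sup>2 + \<mu>)"
proof -
  have "(\<lambda>k. exp (- \<mu>) * (\<mu> ^ k /\<^sub>R fact k)) sums (exp (- \<mu>) * exp \<mu>)"
    by (intro sums_mult exp_converges)
  then show 0: "p sums 1" by (simp add: p_def divide_inverse mult_ac exp_minus)
  have Suc: "p (Suc k) * real (Suc k) = \<mu> * p k" for k
    by (simp add: p_def field_simps del: of_nat_Suc)
  have "(\<lambda>k. p (Suc k) * real (Suc k)) sums \<mu>"
    unfolding Suc using sums_mult[OF 0, of \<mu>] by simp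
  then show 1: "(\<lambda>k. p k * real k) sums \<mu>"
    by (subst (asm) sums_Suc_iff) simp
  have "(\<lambda>k. \<mu> * (p k * real k) + \<mu> * p k) sums (\<mu> * \<mu> + \<mu> * 1)"
    by (intro sums_add sums_mult 0 1)
  moreover have "p (Suc k) * (real (Suc k))\<^sup>2 = \<mu> * (p k * real k) + \<mu> * p k" for k
  proof -
    have "p (Suc k) * (real (Suc k))\<^sup>2 = (p (Suc k) * real (Suc k)) * real (Suc k)"
      by (simp add: power2_eq_square)
    then show ?thesis unfolding Suc by (simp add: algebra_simps)
  qed
  ultimately have "(\<lambda>k. p (Suc k) * (real (Suc k))\<^sup>2) sums (\<mu>\<^sup>2 + \<mu>)"
    by (simp add: power2_eq_square)
  then show "(\<lambda>k. p k * (real k)\<^sup>2) sums (\<mu>\<^sup>2 + \<mu>)"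
    by (subst (asm) sums_Suc_iff) simp
qed

text \<open>Taylor's formula with Lagrange remainder between two positive times, where derivatives
  within the half-line are two-sided.\<close>

lemma second_order_Taylor_bound:
  fixes x x' x'' :: "real \<Rightarrow> real"
  assumes x: "\<And>r. 0 \<le> r \<Longrightarrow> (x has_real_derivative x' r) (at r within {0..})"
    and x': "\<And>r. 0 \<le> r \<Longrightarrow> (x' has_real_derivative x'' r) (at r within {0..})"
    and M: "\<And>r. 0 \<le> r \<Longrightarrow> \<bar>x'' r\<bar> \<le> M" and s: "0 < s" and t: "0 < t"
  shows "\<bar>x s - x t - x' t * (s - t)\<bar> \<le> M / 2 * (s - t)\<^sup>2"
proof (cases "s = t")
  case False
  define d where "d m = (if m = 0 then x else if m = 1 then x' else x'')" for m :: nat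
  have at: "at r within {0..} = at r" if "0 < r" for r :: real
    using that by (intro at_within_interior) auto
  have "\<exists>r. (if s < t then s < r \<and> r < t else t < r \<and> r < s) \<and>
      x s = (\<Sum>m<2. d m t / fact m * (s - t) ^ m) + d 2 r / fact 2 * (s - t) ^ 2"
  proof (rule Taylor)
    show "\<forall>(m :: nat) r. m < 2 \<and> min s t \<le> r \<and> r \<le> max s t \<longrightarrow> (d m has_real_derivative d (Suc m) r) (at r)"
    proof (intro allI impI)
      fix m :: nat and r :: real assume mr: "m < 2 \<and> min s t \<le> r \<and> r \<le> max s t"
      then have r: "0 < r" using s t by (auto simp: min_def split: if_splits)
      have "m = 0 \<or> m = 1" using mr by auto
      then show "(d m has_real_derivative d (Suc m) r) (at r)"
        using x[of r] x'[of r] r by (auto simp: d_def at)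
    qed
  qed (use False in \<open>auto simp: d_def\<close>)
  then obtain r where r: "if s < t then s < r \<and> r < t else t < r \<and> r < s"
      "x s = (\<Sum>m<2. d m t / fact m * (s - t) ^ m) + d 2 r / fact 2 * (s - t) ^ 2"
    by blast
  have r0: "0 < r" using r(1) s t by (auto split: if_splits)
  have "x s - x t - x' t * (s - t) = x'' r / 2 * (s - t)\<^sup>2"
    using r(2) by (simp add: d_def numeral_2_eq_2)
  also have "\<bar>\<dots>\<bar> \<le> M / 2 * (s - t)\<^sup>2"
    using M[of r] r0 by (simp add: abs_mult mult_right_mono)
  finally show ?thesis .
qed simp

context boltzmann_flow
begin

text \<open>The summands collect, as multiples of \<open>j\<^sup>2 / \<mu>\<close>, the comparison
  at time \<open>n / \<mu> * t\<close>, then the linear term in \<open>n / \<mu> - 1\<close>, and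
  finally the quadratic terms, whose second moment is at most \<open>2 / \<mu>\<close>.\<close>

definition chaos_constant :: "real \<Rightarrow> real" where
  "chaos_constant t = 8 * exp (7 * rate * t) + 2 * rate * t + 16 + 8 * rate\<^sup>2 * t\<^sup>2"

lemma chaos_constant_ge_1: "0 \<le> t \<Longrightarrow> 1 \<le> chaos_constant t"
  unfolding chaos_constant_def using rate_nonneg
  by (intro add_increasing2 add_increasing) auto

text \<open>Each time derivative applies \<open>collision_adjoint\<close> once more, which
  multiplies the sup bound by \<open>2 * rate\<close> times the current level.\<close>

lemma moment_Taylor:
  assumes "0 < s" "0 < t" and \<phi>: "test_function j 1 \<phi>"
  shows "\<bar>moment j s \<phi> - moment j t \<phi> - moment (Suc j) t (collision_adjoint j \<phi>) * (s - t)\<bar>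
    \<le> (2 * rate * (real j + 1)) * (2 * rate * real j) / 2 * (s - t)\<^sup>2"
proof (rule second_order_Taylor_bound[OF _ _ _ assms(1,2)])
  fix r :: real assume r: "0 \<le> r"
  note \<phi>1 = test_function_collision_adjoint[OF \<phi>]
  note \<phi>2 = test_function_collision_adjoint[OF \<phi>1]
  show "((\<lambda>s. moment j s \<phi>) has_real_derivative moment (Suc j) r (collision_adjoint j \<phi>)) (at r within {0..})"
    by (rule moment_derivative[OF r \<phi>])
  show "((\<lambda>s. moment (Suc j) s (collision_adjoint j \<phi>)) has_real_derivative
      moment (Suc (Suc j)) r (collision_adjoint (Suc j) (collision_adjoint j \<phi>))) (at r within {0..})"
    by (rule moment_derivative[OF r \<phi>1])
  show "\<bar>moment (Suc (Suc j)) r (collision_adjoint (Suc j) (collision_adjoint j \<phi>))\<bar>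
      \<le> (2 * rate * (real j + 1)) * (2 * rate * real j)"
    using moment_bound[OF r \<phi>2] by (simp add: algebra_simps)
qed

end

context kac_flow
begin

text \<open>Away from \<open>n = \<mu>\<close> the trivial bound \<open>2 \<le> 8 * (n / \<mu> - 1)\<^sup>2\<close> suffices; near it, compare with the
  Boltzmann flow at time \<open>n / \<mu> * t\<close> and expand in time.\<close>

lemma observable_expansion:
  assumes t: "0 < t" and j: "1 \<le> j" "j \<le> n" and \<phi>: "test_function j 1 \<phi>"
  shows "\<bar>observable n t \<phi> - moment j t \<phi> - moment (Suc j) t (collision_adjoint j \<phi>) * t * (n / \<mu> - 1)\<bar>
    \<le> 8 * exp (7 * rate * t) * ((real j)\<^sup>2 / \<mu>) + (8 + 4 * rate\<^sup>2 * t\<^sup>2 * (real j)\<^sup>2) * (n / \<mu> - 1)\<^sup>2"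
proof -
  define \<alpha> where "\<alpha> = n / \<mu>"
  have \<alpha>: "0 < \<alpha>" using j \<mu>_pos by (simp add: \<alpha>_def)
  have n: "1 \<le> n" using j by simp
  have 1: "\<bar>observable n t \<phi> - moment j (\<alpha> * t) \<phi>\<bar> \<le> 8 * exp (7 * rate * t) * ((real j)\<^sup>2 / \<mu>) + 8 * (\<alpha> - 1)\<^sup>2"
  proof (cases "1 / 2 \<le> \<alpha> \<and> \<alpha> \<le> 2")
    case True
    have "\<bar>observable n t \<phi> - moment j (\<alpha> * t) \<phi>\<bar> \<le> 1 * (4 * exp (7 * rate * t) * (real j * (real j + 1) / \<mu>))"
      using True t j by (intro observable_moment_bound[OF n \<alpha>_def _ _ j(2) \<phi>]) auto
    also have "\<dots> \<le> 1 * (4 * exp (7 * rate * t) * ((real j * (2 * real j)) / \<mu>))"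
      using j \<mu>_pos by (intro mult_left_mono divide_right_mono) auto
    also have "\<dots> = 8 * exp (7 * rate * t) * ((real j)\<^sup>2 / \<mu>)" by (simp add: power2_eq_square)
    finally show ?thesis using zero_le_power2[of "\<alpha> - 1"] by linarith
  next
    case False
    have "1 / 4 \<le> (\<alpha> - 1)\<^sup>2"
    proof -
      have "1 / 2 \<le> \<bar>\<alpha> - 1\<bar>" using False by auto
      then have "(1 / 2)\<^sup>2 \<le> \<bar>\<alpha> - 1\<bar>\<^sup>2" by (rule power_mono) simp
      then show ?thesis by (simp add: power2_eq_square)
    qed
    moreover have "0 \<le> \<alpha> * t" using \<alpha> t by simp
    then have "\<bar>observable n t \<phi> - moment j (\<alpha> * t) \<phi>\<bar> \<le> 1 + 1"
      using observable_bound[of t n j 1 \<phi>] moment_bound[of "\<alpha> * t" j 1 \<phi>] t n \<phi> j by linarith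
    moreover have "0 \<le> 8 * exp (7 * rate * t) * ((real j)\<^sup>2 / \<mu>)" using \<mu>_pos by simp
    ultimately show ?thesis by linarith
  qed
  have "\<bar>moment j (\<alpha> * t) \<phi> - moment j t \<phi> - moment (Suc j) t (collision_adjoint j \<phi>) * (\<alpha> * t - t)\<bar>
      \<le> (2 * rate * (real j + 1)) * (2 * rate * real j) / 2 * (\<alpha> * t - t)\<^sup>2"
    by (rule moment_Taylor[OF _ t \<phi>]) (use \<alpha> t in simp)
  also have "\<dots> \<le> (2 * rate * (2 * real j)) * (2 * rate * real j) / 2 * (\<alpha> * t - t)\<^sup>2"
    using j rate_nonneg by (intro mult_right_mono divide_right_mono mult_left_mono) auto
  also have "\<dots> = 4 * rate\<^sup>2 * t\<^sup>2 * (real j)\<^sup>2 * (\<alpha> - 1)\<^sup>2"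
    by (simp add: power2_eq_square algebra_simps)
  finally have 2: "\<bar>moment j (\<alpha> * t) \<phi> - moment j t \<phi> - moment (Suc j) t (collision_adjoint j \<phi>) * t * (\<alpha> - 1)\<bar>
      \<le> 4 * rate\<^sup>2 * t\<^sup>2 * (real j)\<^sup>2 * (\<alpha> - 1)\<^sup>2"
    by (simp add: algebra_simps)
  show ?thesis
    using 1 2 unfolding \<alpha>_def[symmetric] distrib_right by linarith
qed

definition poisson :: "nat \<Rightarrow> real" where "poisson k = exp (- \<mu>) * \<mu> ^ k / fact k"

lemma poisson_nonneg: "0 \<le> poisson k"
  using \<mu>_pos by (simp add: poisson_def)

lemma poisson_sums_one: "poisson sums 1"
  using poisson_moments(1)[of \<mu>] by (simp add: poisson_def[abs_def])

text \<open>The shift by \<open>j\<close> moves the mean of \<open>(j + k) / \<mu>\<close> to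
  \<open>1 + j / \<mu>\<close>; the second moment is the variance \<open>1 / \<mu>\<close> plus the
  square of this mean deviation.\<close>

lemma poisson_deviation:
  shows "(\<lambda>k. poisson k * (real (j + k) / \<mu> - 1)) sums (real j / \<mu>)"
    and "(\<lambda>k. poisson k * (real (j + k) / \<mu> - 1)\<^sup>2) sums (1 / \<mu> + (real j)\<^sup>2 / \<mu>\<^sup>2)"
proof -
  note m = poisson_moments[of \<mu>, folded poisson_def]
  have m0: "(\<lambda>k. poisson k) sums 1" by (rule poisson_sums_one)
  have "(\<lambda>k. 1 / \<mu> * (poisson k * real k) + (real j / \<mu> - 1) * poisson k) sums (1 / \<mu> * \<mu> + (real j / \<mu> - 1) * 1)"
    by (intro sums_add sums_mult m m0)
  then show "(\<lambda>k. poisson k * (real (j + k) / \<mu> - 1)) sums (real j / \<mu>)"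
    using \<mu>_pos by (simp add: algebra_simps add_divide_distrib)
  have "(\<lambda>k. 1 / \<mu>\<^sup>2 * (poisson k * (real k)\<^sup>2) + (2 * (real j / \<mu> - 1) / \<mu>) * (poisson k * real k)
        + (real j / \<mu> - 1)\<^sup>2 * poisson k)
      sums (1 / \<mu>\<^sup>2 * (\<mu>\<^sup>2 + \<mu>) + (2 * (real j / \<mu> - 1) / \<mu>) * \<mu> + (real j / \<mu> - 1)\<^sup>2 * 1)"
    by (intro sums_add sums_mult m m0)
  moreover have "1 / \<mu>\<^sup>2 * (\<mu>\<^sup>2 + \<mu>) + (2 * (real j / \<mu> - 1) / \<mu>) * \<mu> + (real j / \<mu> - 1)\<^sup>2 * 1
      = 1 / \<mu> + (real j)\<^sup>2 / \<mu>\<^sup>2"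
    using \<mu>_pos by (simp add: field_simps power2_eq_square)
  moreover have "1 / \<mu>\<^sup>2 * (poisson k * (real k)\<^sup>2) + (2 * (real j / \<mu> - 1) / \<mu>) * (poisson k * real k)
        + (real j / \<mu> - 1)\<^sup>2 * poisson k = poisson k * (real (j + k) / \<mu> - 1)\<^sup>2" for k
    using \<mu>_pos by (simp add: field_simps power2_eq_square)
  ultimately show "(\<lambda>k. poisson k * (real (j + k) / \<mu> - 1)\<^sup>2) sums (1 / \<mu> + (real j)\<^sup>2 / \<mu>\<^sup>2)" by simp
qed

lemma summable_poisson_observable:
  assumes "0 \<le> t" "1 \<le> j" "test_function j K \<phi>"
  shows "summable (\<lambda>k. poisson k * observable (j + k) t \<phi>)"
proof (rule summable_comparison_test')
  show "summable (\<lambda>k. poisson k * K)" using poisson_sums_one by (intro summable_mult2 sums_summable)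
  show "norm (poisson k * observable (j + k) t \<phi>) \<le> poisson k * K" for k
    using observable_bound[OF assms(1) _ assms(3), of "j + k"] assms(2) poisson_nonneg[of k]
    by (simp add: abs_mult mult_left_mono)
qed

text \<open>The linear term is subtracted before absolute values are taken and summed with its sign.
  It therefore contributes the mean deviation \<open>j / \<mu>\<close>, and not the mean modulus of
  the deviation.\<close>

lemma poisson_observable_bound:
  assumes t: "0 < t" and j: "1 \<le> j" and j\<mu>: "(real j)\<^sup>2 \<le> \<mu>" and \<phi>: "test_function j 1 \<phi>"
  shows "\<bar>(\<Sum>k. poisson k * observable (j + k) t \<phi>) - moment j t \<phi>\<bar> \<le> chaos_constant t * ((real j)\<^sup>2 / \<mu>)"
proof -
  define m where "m = moment j t \<phi>"
  define b where "b = moment (Suc j) t (collision_adjoint j \<phi>) * t"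
  define S where "S = (\<Sum>k. poisson k * observable (j + k) t \<phi>)"
  define A where "A = 8 * exp (7 * rate * t) * ((real j)\<^sup>2 / \<mu>)"
  define D where "D = 8 + 4 * rate\<^sup>2 * t\<^sup>2 * (real j)\<^sup>2"
  define x where "x k = real (j + k) / \<mu> - 1" for k
  note p = poisson_deviation[of j, folded x_def]
  have J: "0 \<le> (real j)\<^sup>2 / \<mu>" using \<mu>_pos by simp
  have S: "(\<lambda>k. poisson k * observable (j + k) t \<phi>) sums S"
    unfolding S_def using t by (intro summable_sums summable_poisson_observable[OF _ j \<phi>]) simp
  have h: "(\<lambda>k. poisson k * observable (j + k) t \<phi> - m * poisson k - b * (poisson k * x k))
      sums (S - m * 1 - b * (real j / \<mu>))"
    by (intro sums_diff sums_mult S poisson_sums_one p)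
  have g: "(\<lambda>k. A * poisson k + D * (poisson k * (x k)\<^sup>2)) sums (A * 1 + D * (1 / \<mu> + (real j)\<^sup>2 / \<mu>\<^sup>2))"
    by (intro sums_add sums_mult poisson_sums_one p)
  have le: "\<bar>poisson k * observable (j + k) t \<phi> - m * poisson k - b * (poisson k * x k)\<bar>
      \<le> A * poisson k + D * (poisson k * (x k)\<^sup>2)" for k
  proof -
    have "poisson k * observable (j + k) t \<phi> - m * poisson k - b * (poisson k * x k)
        = poisson k * (observable (j + k) t \<phi> - m - b * x k)" by (simp add: algebra_simps)
    also have "\<bar>\<dots>\<bar> \<le> poisson k * (A + D * (x k)\<^sup>2)"
      unfolding abs_mult abs_of_nonneg[OF poisson_nonneg] m_def b_def A_def D_def x_def
      by (intro mult_left_mono observable_expansion[OF t j _ \<phi>] poisson_nonneg) simp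
    finally show ?thesis by (simp add: algebra_simps)
  qed
  have "S - m * 1 - b * (real j / \<mu>) \<le> A * 1 + D * (1 / \<mu> + (real j)\<^sup>2 / \<mu>\<^sup>2)"
    by (rule sums_le[OF abs_le_D1[OF le] h g])
  moreover have "- (S - m * 1 - b * (real j / \<mu>)) \<le> A * 1 + D * (1 / \<mu> + (real j)\<^sup>2 / \<mu>\<^sup>2)"
    by (rule sums_le[OF abs_le_D2[OF le] sums_minus[OF h] g])
  ultimately have 1: "\<bar>S - m\<bar> \<le> \<bar>b\<bar> * (real j / \<mu>) + A + D * (1 / \<mu> + (real j)\<^sup>2 / \<mu>\<^sup>2)"
    using abs_ge_self[of "b * (real j / \<mu>)"] abs_ge_minus_self[of "b * (real j / \<mu>)"] \<mu>_pos
    by (simp add: abs_mult abs_le_iff)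
  have "\<bar>b\<bar> \<le> real j * (2 * rate * 1) * t"
    unfolding b_def using t moment_bound[OF _ test_function_collision_adjoint[OF \<phi>], of t]
    by (simp add: abs_mult mult_right_mono)
  then have "\<bar>b\<bar> * (real j / \<mu>) \<le> real j * (2 * rate * 1) * t * (real j / \<mu>)"
    using \<mu>_pos by (intro mult_right_mono) auto
  then have 2: "\<bar>b\<bar> * (real j / \<mu>) \<le> 2 * rate * t * ((real j)\<^sup>2 / \<mu>)"
    by (simp add: power2_eq_square mult_ac)
  \<comment> \<open>The smallness of \<open>j / sqrt \<mu>\<close> enters here: the squared mean
    deviation is dominated by the variance.\<close>
  have "(real j)\<^sup>2 / \<mu>\<^sup>2 \<le> 1 / \<mu>"
    using j\<mu> \<mu>_pos by (simp add: field_simps power2_eq_square)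
  then have q: "1 / \<mu> + (real j)\<^sup>2 / \<mu>\<^sup>2 \<le> 2 / \<mu>" by simp
  have j2: "1 \<le> (real j)\<^sup>2" using j by simp
  have "D * (1 / \<mu> + (real j)\<^sup>2 / \<mu>\<^sup>2) \<le> D * (2 / \<mu>)"
    using q by (intro mult_left_mono) (auto simp: D_def)
  also have "\<dots> \<le> ((8 + 4 * rate\<^sup>2 * t\<^sup>2) * (real j)\<^sup>2) * (2 / \<mu>)"
    using j2 \<mu>_pos by (intro mult_right_mono) (auto simp: D_def algebra_simps)
  finally have 3: "D * (1 / \<mu> + (real j)\<^sup>2 / \<mu>\<^sup>2) \<le> (16 + 8 * rate\<^sup>2 * t\<^sup>2) * ((real j)\<^sup>2 / \<mu>)"
    by (simp add: algebra_simps)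
  have "\<bar>S - m\<bar> \<le> 2 * rate * t * ((real j)\<^sup>2 / \<mu>) + A + (16 + 8 * rate\<^sup>2 * t\<^sup>2) * ((real j)\<^sup>2 / \<mu>)"
    using 1 2 3 by linarith
  then show ?thesis by (simp add: S_def m_def A_def chaos_constant_def algebra_simps)
qed

text \<open>Normalising a pairing by \<open>exp (- \<mu>) * \<mu> ^ (j + k)\<close> leaves, after
  division by \<open>\<mu> ^ j * fact k\<close>, the Poisson weight of \<open>k\<close>. The average
  thus runs over the number of particles beyond the \<open>j\<close> observed ones.\<close>

lemma correlation_pairing:
  assumes t: "0 \<le> t" and j: "1 \<le> j" and \<phi>: "test_function j K \<phi>" "\<And>V. 0 \<le> \<phi> V"
  shows "(\<integral>\<^sup>+V. correlation \<mu> (W t) j V * ennreal (\<phi> V) \<partial>velocities j)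
    = ennreal (\<Sum>k. poisson k * observable (j + k) t \<phi>)"
proof -
  have eq: "pairing (j + k) (W t (j + k)) \<phi> / (\<mu> ^ j * fact k) = poisson k * observable (j + k) t \<phi>" for k
    using \<mu>_pos by (simp add: poisson_def observable_def power_add)
  have nn: "0 \<le> poisson k * observable (j + k) t \<phi>" for k
    unfolding eq[symmetric] using \<mu>_pos pairing_nonneg[OF W_nonneg[OF t] \<phi>(2)] by simp
  show ?thesis
    unfolding nn_integral_correlation[OF \<mu>_pos state[OF t] \<phi>] eq
    by (rule suminf_ennreal_eq[OF nn summable_sums[OF summable_poisson_observable[OF t j \<phi>(1)]]])
qed

section \<open>From tested correlations to the L^1 norm\<close>

lemma correlation_restrict: "correlation \<mu> (W t) j (restrict V {..<j}) = correlation \<mu> (W t) j V"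
  unfolding correlation_def merge_restrict ..

text \<open>Both functions have integral 1, so their L^1 distance is twice the integral of the
  difference over the set where it is positive. The indicator of that set is a nonnegative test
  function of bound 1, as \<open>correlation_pairing\<close> requires.\<close>

lemma L1_norm_correlation_bound:
  assumes t: "0 < t" and j: "1 \<le> j" and j\<mu>: "(real j)\<^sup>2 \<le> \<mu>"
  shows "L1_norm (velocities j) (\<lambda>V. enn2ereal (correlation \<mu> (W t) j V) - ereal (tensor_power j (f t) V))
    \<le> ennreal (2 * chaos_constant t * ((real j)\<^sup>2 / \<mu>))"
proof -
  have t0: "0 \<le> t" using t by simp
  let ?c = "correlation \<mu> (W t) j" and ?F = "tensor_power j (f t)"
  define g where "g V = enn2real (?c V)" for V
  define h where "h V = g V - ?F V" for V
  have cm: "?c \<in> borel_measurable (velocities j)"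
    by (rule correlation_measurable) (rule borel_measurable_integrable[OF integrable_W[OF t0]])
  have one: "test_function j 1 (\<lambda>_. 1)" using test_function_const[of j 1] by simp
  have "(\<Sum>k. poisson k * observable (j + k) t (\<lambda>_. 1)) = 1"
    using poisson_sums_one j by (simp add: observable_one[OF t0] sums_iff)
  then have c1: "(\<integral>\<^sup>+V. ?c V \<partial>velocities j) = ennreal 1"
    using correlation_pairing[OF t0 j one] by simp
  \<comment> \<open>Total mass 1 makes the extended-valued correlation finite almost everywhere, so
    that a real density \<open>g\<close> can replace it.\<close>
  have fin: "AE V in velocities j. ?c V \<noteq> \<infinity>"
    by (rule nn_integral_PInf_AE[OF cm]) (simp add: c1)
  have gm: "g \<in> borel_measurable (velocities j)" unfolding g_def[abs_def] using cm by simp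
  have cg: "AE V in velocities j. ?c V = ennreal (g V)"
    using fin by eventually_elim (simp add: g_def less_top)
  have g0: "0 \<le> g V" for V by (simp add: g_def)
  have gi: "integrable (velocities j) g"
  proof (rule integrableI_nonneg[OF gm])
    have "(\<integral>\<^sup>+V. ennreal (g V) \<partial>velocities j) = (\<integral>\<^sup>+V. ?c V \<partial>velocities j)"
      using cg by (intro nn_integral_cong_AE) auto
    then show "(\<integral>\<^sup>+V. ennreal (g V) \<partial>velocities j) < \<infinity>" by (simp add: c1)
  qed (simp add: g0)
  have Fi: "integrable (velocities j) ?F" by (rule integrable_tensor_power[OF integrable_f[OF t0]])
  have hi: "integrable (velocities j) h" unfolding h_def[abs_def] using gi Fi by auto
  have pg: "pairing j g \<phi> = (\<Sum>k. poisson k * observable (j + k) t \<phi>)"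
    if \<phi>: "test_function j K \<phi>" "\<And>V. 0 \<le> \<phi> V" for \<phi> K
  proof -
    have nn: "0 \<le> (\<Sum>k. poisson k * observable (j + k) t \<phi>)"
      using pairing_nonneg[OF W_nonneg[OF t0] \<phi>(2)] \<mu>_pos
      by (intro suminf_nonneg summable_poisson_observable[OF t0 j \<phi>(1)] mult_nonneg_nonneg poisson_nonneg)
        (simp add: observable_def)
    have "ennreal (pairing j g \<phi>) = (\<integral>\<^sup>+V. ennreal (g V * \<phi> V) \<partial>velocities j)"
      unfolding pairing_def using g0 \<phi>(2)
      by (intro nn_integral_eq_integral[symmetric] integrable_test[OF gi \<phi>(1)]) auto
    also have "\<dots> = (\<integral>\<^sup>+V. ?c V * ennreal (\<phi> V) \<partial>velocities j)"
      using cg \<phi>(2) by (intro nn_integral_cong_AE) (auto simp: ennreal_mult'')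
    also have "\<dots> = ennreal (\<Sum>k. poisson k * observable (j + k) t \<phi>)"
      by (rule correlation_pairing[OF t0 j \<phi>])
    finally show ?thesis
      using nn pairing_nonneg[where n = j and u = g and \<phi> = \<phi>] g0 \<phi>(2) by (simp add: ennreal_inj)
  qed
  define \<phi> where "\<phi> V = (if 0 < h V then 1 else 0 :: real)" for V
  have hloc: "h (restrict V {..<j}) = h V" for V
    by (simp add: h_def g_def correlation_restrict tensor_power_restrict)
  have \<phi>: "test_function j 1 \<phi>"
    unfolding test_function_def \<phi>_def[abs_def] using borel_measurable_integrable[OF hi] by (simp add: hloc)
  have "(LINT V|velocities j. \<bar>h V\<bar>) = (LINT V|velocities j. 2 * (h V * \<phi> V) - h V)"
    by (intro Bochner_Integration.integral_cong) (auto simp: \<phi>_def)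
  also have "\<dots> = 2 * pairing j h \<phi> - (LINT V|velocities j. h V)"
    unfolding pairing_def using integrable_test[OF hi \<phi> order_refl] hi by simp
  also have "(LINT V|velocities j. h V) = 0"
  proof -
    have "pairing j g (\<lambda>_. 1) = 1" using pg[OF one] \<open>(\<Sum>k. poisson k * observable (j + k) t (\<lambda>_. 1)) = 1\<close> by simp
    then have "(LINT V|velocities j. g V) = 1" by (simp add: pairing_def)
    moreover have "(LINT V|velocities j. ?F V) = 1"
      by (simp add: integral_tensor_power[OF integrable_f[OF t0]] integral_f[OF t0])
    ultimately show ?thesis unfolding h_def using gi Fi by simp
  qed
  also have "pairing j h \<phi> = pairing j g \<phi> - moment j t \<phi>"
    unfolding pairing_def h_def left_diff_distrib
    by (rule Bochner_Integration.integral_diff[OF integrable_test[OF gi \<phi> order_refl] integrable_test[OF Fi \<phi> order_refl]])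
  also have "\<dots> \<le> chaos_constant t * ((real j)\<^sup>2 / \<mu>)"
    using poisson_observable_bound[OF t j j\<mu> \<phi>] pg[OF \<phi>] by (simp add: \<phi>_def abs_le_iff)
  finally have le: "(LINT V|velocities j. \<bar>h V\<bar>) \<le> 2 * chaos_constant t * ((real j)\<^sup>2 / \<mu>)" by simp
  have "L1_norm (velocities j) (\<lambda>V. enn2ereal (?c V) - ereal (?F V)) = (\<integral>\<^sup>+V. ennreal \<bar>h V\<bar> \<partial>velocities j)"
    unfolding L1_norm_def
  proof (rule nn_integral_cong_AE)
    show "AE V in velocities j. e2ennreal \<bar>enn2ereal (?c V) - ereal (?F V)\<bar> = ennreal \<bar>h V\<bar>"
      using cg by eventually_elim (simp add: h_def enn2ereal_ennreal g0 ennreal.rep_eq)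
  qed
  also have "\<dots> = ennreal (LINT V|velocities j. \<bar>h V\<bar>)"
    by (rule nn_integral_eq_integral) (use hi in auto)
  finally show ?thesis using le by (simp add: ennreal_leI)
qed

end

theorem theorem3p2:
  fixes B :: "velocity \<Rightarrow> velocity \<Rightarrow> real"
    and f0 :: "velocity \<Rightarrow> real"
    and f :: "real \<Rightarrow> velocity \<Rightarrow> real"
    and W :: "real \<Rightarrow> real \<Rightarrow> nat \<Rightarrow> configuration \<Rightarrow> real"
  assumes "collision_kernel B"
    and "probability_density f0"
    and "boltzmann_solution B f0 f"
    and "\<And>\<mu>. \<mu> > 0 \<Longrightarrow> kac_evolution B \<mu> (W \<mu>)"
    and "\<And>\<mu> j. \<mu> > 0 \<Longrightarrow> j \<ge> 1 \<Longrightarrow>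
           AE V in velocities j. correlation \<mu> (W \<mu> 0) j V = ennreal (tensor_power j f0 V)"
  shows "\<forall>t>0. \<exists>G \<delta>. G > 1 \<and> \<delta> > 0 \<and>
           (\<forall>j\<ge>1. \<forall>\<mu>>0. real j / sqrt \<mu> \<le> \<delta> \<longrightarrow>
              L1_norm (velocities j)
                (\<lambda>V. enn2ereal (correlation \<mu> (W \<mu> t) j V) - ereal (tensor_power j (f t) V))
              \<le> ennreal (G * (real j)\<^sup>2 / \<mu>))"
proof (intro allI impI)
  fix t :: real assume t: "0 < t"
  obtain C where C: "\<And>\<omega> v. \<omega> \<in> sphere 0 1 \<Longrightarrow> B \<omega> v \<le> C"
    using assms(1) unfolding collision_kernel_def by blast
  interpret boltzmann_flow B C f0 f
    by standard (use assms(1-3) C in auto)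
  \<comment> \<open>The 2 comes from passing to the L^1 norm and, as \<open>chaos_constant t\<close>
    is at least 1, also ensures \<open>G > 1\<close>. The constant involves only \<open>t\<close>
    and the kernel bound \<open>C\<close>, neither \<open>j\<close> nor \<mu>.\<close>
  define G where "G = 2 * chaos_constant t"
  have "1 < G" using chaos_constant_ge_1[of t] t by (simp add: G_def)
  moreover have "L1_norm (velocities j)
      (\<lambda>V. enn2ereal (correlation \<mu> (W \<mu> t) j V) - ereal (tensor_power j (f t) V)) \<le> ennreal (G * (real j)\<^sup>2 / \<mu>)"
    if j: "1 \<le> j" and \<mu>: "0 < \<mu>" and le: "real j / sqrt \<mu> \<le> 1" for j \<mu>
  proof -
    interpret kac_flow B C f0 f \<mu> "W \<mu>"
      by standard (use \<mu> assms(4,5) in auto)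
    have "real j \<le> sqrt \<mu>" using le \<mu> by (simp add: field_simps)
    then have "(real j)\<^sup>2 \<le> (sqrt \<mu>)\<^sup>2" by (rule power_mono) simp
    then have "(real j)\<^sup>2 \<le> \<mu>" using \<mu> by simp
    from L1_norm_correlation_bound[OF t j this] show ?thesis
      by (simp add: G_def)
  qed
  ultimately show "\<exists>G \<delta>. G > 1 \<and> \<delta> > 0 \<and>
           (\<forall>j\<ge>1. \<forall>\<mu>>0. real j / sqrt \<mu> \<le> \<delta> \<longrightarrow>
              L1_norm (velocities j)
                (\<lambda>V. enn2ereal (correlation \<mu> (W \<mu> t) j V) - ereal (tensor_power j (f t) V))
              \<le> ennreal (G * (real j)\<^sup>2 / \<mu>))"
    by (intro exI[of _ G] exI[of _ 1]) auto
qed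

end
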